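(* Let $m\ge1$, let $F\in C^\infty(\mathbb{R},\mathbb{R}^m)$, and suppose that for some $M>0$ the nonlinearity index $d_F$ of $F$ on $[-M,M]$ is an odd (finite) integer $p$. Let $s=1/p$. Then there exists an entropy solution $U$ of $$\partial_t U+\mathrm{div}_X F(U)=0\quad (X\in\mathbb{R}^m,\ t>0),\qquad U(X,0)=U_0(X),$$ (for some initial datum $U_0\in L^\infty(\mathbb{R}^m)$) such that for all $\varepsilon>0$ and all $t>0$, $$U(\cdot,t)\in BV^{s}_{loc}(\mathbb{R}^m,\mathbb{R})\quad\text{and}\quad U(\cdot,t)\notin BV^{s+\varepsilon}_{loc}(\mathbb{R}^m,\mathbb{R}).$$
   Context: The nonlinearity index of $F$ on an interval $[a,b]$ is $$d_F=\sup_{U\in[a,b]}\inf\{k\in\mathbb{N}:\ k\ge1,\ \mathrm{span}(F''(U),\dots,F^{(k+1)}(U))=\mathbb{R}^m\}\in\mathbb{N}\cup\{+\infty\}.$$ For $\sigma>0$, $\mathrm{Lip}^\sigma(\mathbb{R},\mathbb{R})$ is the set of functions $L:\mathbb{R}\to\mathbb{R}$ that are globally $\sigma$-Hölder: $|L(a)-L(b)|\le C|a-b|^\sigma$ for all $a,b\in\mathbb{R}$, for some constant $C$. The space $BV^\sigma_{loc}(\mathbb{R}^m,\mathbb{R})$ is the set of functions $u$ that can be written (almost everywhere) as $u=L\circ v$ with $L\in \mathrm{Lip}^\sigma(\mathbb{R},\mathbb{R})$ and $v\in BV_{loc}(\mathbb{R}^m,\mathbb{R})$. "Entropy solution" means Kruzhkov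 entropy solution: $U$ is bounded, $U\in C([0,\infty);L^1_{loc}(\mathbb{R}^m))$, $U(\cdot,0)=U_0$, and for every $k\in\mathbb{R}$, $\partial_t|U-k|+\mathrm{div}_X\big(\mathrm{sgn}(U-k)(F(U)-F(k))\big)\le0$ in the sense of distributions on $\mathbb{R}^m\times(0,\infty)$. *)

theory Defs
  imports "HOL-Analysis.Analysis" "HOL-Library.Extended_Nat"
begin

text \<open>Regularity \<open>C\<^sup>k\<close> on the whole space, by recursion on the directional derivatives. In finite
  dimension, continuity of all directional derivatives of a differentiable map is continuity of its
  derivative.\<close>

primrec C_k :: "nat \<Rightarrow> ('a::euclidean_space \<Rightarrow> 'b::euclidean_space) \<Rightarrow> bool" where
  "C_k 0 f \<longleftrightarrow> continuous_on UNIV f"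
| "C_k (Suc k) f \<longleftrightarrow>
     (\<forall>x. f differentiable (at x)) \<and> (\<forall>h. C_k k (\<lambda>x. frechet_derivative f (at x) h))"

definition C_infinity :: "('a::euclidean_space \<Rightarrow> 'b::euclidean_space) \<Rightarrow> bool" where
  "C_infinity f \<longleftrightarrow> (\<forall>k. C_k k f)"

definition compactly_supported_in ::
    "'a::topological_space set \<Rightarrow> ('a \<Rightarrow> 'b::zero) \<Rightarrow> bool" where
  "compactly_supported_in \<Omega> \<phi> \<longleftrightarrow>
     compact (closure {x. \<phi> x \<noteq> 0}) \<and> closure {x. \<phi> x \<noteq> 0} \<subseteq> \<Omega>"

definition nth_derivative :: "nat \<Rightarrow> (real \<Rightarrow> 'a::real_normed_vector) \<Rightarrow> real \<Rightarrow> 'a" where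
  "nth_derivative n F = ((\<lambda>f x. vector_derivative f (at x)) ^^ n) F"

text \<open>In \<^typ>\<open>enat\<close>, the infimum of the empty set is \<open>\<infinity>\<close>, as required.\<close>

definition nonlinearity_index :: "(real \<Rightarrow> 'a::euclidean_space) \<Rightarrow> real \<Rightarrow> real \<Rightarrow> enat" where
  "nonlinearity_index F a b =
     (SUP u\<in>{a..b}. INF k\<in>{k::nat. k \<ge> 1 \<and> span ((\<lambda>j. nth_derivative j F u) ` {2..k+1}) = UNIV}.
        enat k)"

text \<open>Functions are representatives of their classes modulo Lebesgue null sets.\<close>

definition L_infinity :: "('a::euclidean_space \<Rightarrow> real) set" where
  "L_infinity = {u. u \<in> borel_measurable lebesgue \<and> (\<exists>C. AE x in lebesgue. \<bar>u x\<bar> \<le> C)}"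

definition L1_loc :: "('a::euclidean_space \<Rightarrow> real) set" where
  "L1_loc = {u. \<forall>K. compact K \<longrightarrow> set_integrable lebesgue K u}"

definition divergence :: "('a::euclidean_space \<Rightarrow> 'a) \<Rightarrow> 'a \<Rightarrow> real" where
  "divergence \<phi> x = (\<Sum>i\<in>Basis. frechet_derivative \<phi> (at x) i \<bullet> i)"

text \<open>Locally bounded variation through the total variation on bounded open sets: the
  distributional gradient of \<open>u\<close> is then a Radon measure.\<close>

definition BV_loc :: "('a::euclidean_space \<Rightarrow> real) set" where
  "BV_loc = {u. u \<in> L1_loc \<and>
     (\<forall>\<Omega>. open \<Omega> \<and> bounded \<Omega> \<longrightarrow>
        bdd_above {LINT x:\<Omega>|lebesgue. u x * divergence \<phi> x | \<phi>.
          C_k 1 \<phi> \<and> compactly_supported_in \<Omega> \<phi> \<and> (\<forall>x. norm (\<phi> x) \<le> 1)})}"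

text \<open>The exponent \<open>\<sigma>\<close> is meant to be positive. It may exceed 1, in which case only constant
  functions qualify.\<close>

definition Lip_pow :: "real \<Rightarrow> (real \<Rightarrow> real) set" where
  "Lip_pow \<sigma> = {L. \<exists>C. \<forall>a b. \<bar>L a - L b\<bar> \<le> C * \<bar>a - b\<bar> powr \<sigma>}"

definition BV_pow_loc :: "real \<Rightarrow> ('a::euclidean_space \<Rightarrow> real) set" where
  "BV_pow_loc \<sigma> = {u. \<exists>L\<in>Lip_pow \<sigma>. \<exists>v\<in>BV_loc. AE x in lebesgue. u x = L (v x)}"

text \<open>\<open>U X t\<close> is only relevant for \<open>t \<ge> 0\<close>; \<open>C([0,\<infinity>); L\<^sup>1\<^sub>l\<^sub>o\<^sub>c)\<close> is continuity for each of the
  seminorms given by integration over a compact set.\<close>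

definition continuous_in_L1_loc :: "('a::euclidean_space \<Rightarrow> real \<Rightarrow> real) \<Rightarrow> bool" where
  "continuous_in_L1_loc U \<longleftrightarrow>
     (\<forall>t\<ge>0. (\<lambda>X. U X t) \<in> L1_loc) \<and>
     (\<forall>K. compact K \<longrightarrow> (\<forall>t\<^sub>0\<ge>0.
        ((\<lambda>t. LINT X:K|lebesgue. \<bar>U X t - U X t\<^sub>0\<bar>) \<longlongrightarrow> 0) (at t\<^sub>0 within {0..})))"

text \<open>The derivative of the test function \<open>\<phi>\<close> in direction \<open>(0, 1)\<close> is \<open>\<partial>\<^sub>t \<phi>\<close>, and in direction
  \<open>(w, 0)\<close> it is \<open>w \<bullet> \<nabla>\<^sub>X \<phi>\<close>.\<close>

definition kruzhkov_inequality ::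
    "(real \<Rightarrow> 'a::euclidean_space) \<Rightarrow> ('a \<Rightarrow> real \<Rightarrow> real) \<Rightarrow> real \<Rightarrow> bool" where
  "kruzhkov_inequality F U k \<longleftrightarrow>
     (\<forall>\<phi> :: 'a \<times> real \<Rightarrow> real.
        C_infinity \<phi> \<and> compactly_supported_in (UNIV \<times> {0<..}) \<phi> \<and> (\<forall>z. \<phi> z \<ge> 0) \<longrightarrow>
        (LINT z:UNIV \<times> {0<..}|lebesgue.
           (let u = U (fst z) (snd z) in
              \<bar>u - k\<bar> * frechet_derivative \<phi> (at z) (0, 1)
              + frechet_derivative \<phi> (at z) (sgn (u - k) *\<^sub>R (F u - F k), 0))) \<ge> 0)"

definition entropy_solution ::
    "(real \<Rightarrow> 'a::euclidean_space) \<Rightarrow> ('a \<Rightarrow> real) \<Rightarrow> ('a \<Rightarrow> real \<Rightarrow> real) \<Rightarrow> bool" where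
  "entropy_solution F U\<^sub>0 U \<longleftrightarrow>
     (\<lambda>z. U (fst z) (snd z)) \<in> borel_measurable (lebesgue_on (UNIV \<times> {0<..})) \<and>
     (\<exists>C. AE z in lebesgue_on (UNIV \<times> {0<..}). \<bar>U (fst z) (snd z)\<bar> \<le> C) \<and>
     continuous_in_L1_loc U \<and>
     (AE X in lebesgue. U X 0 = U\<^sub>0 X) \<and>
     (\<forall>k. kruzhkov_inequality F U k)"

end

theory Submission
  imports Defs "HOL-Real_Asymp.Real_Asymp"
begin

text \<open>Let the index be attained at \<open>u\<close>, and let \<open>w\<close> be a unit vector orthogonal to
  \<open>F''(u), \<dots>, F\<^sup>(\<^sup>p\<^sup>)(u)\<close>. Up to a sign of \<open>w\<close> and an affine term, the scalar flux \<open>g\<close> of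
  plane waves in the direction \<open>w\<close> behaves near \<open>u\<close> like the power \<open>p + 1\<close>, which is even, so
  \<open>g\<close> is convex and the inverse \<open>B\<close> of \<open>g'\<close> is Hoelder continuous with exponent \<open>1 / p\<close> and no
  better. The solution consists of rarefaction fans centred at \<open>c\<^sub>0 < c\<^sub>1 < \<dots> \<rightarrow> 0\<close> and separated by
  shocks: its primitive is the minimum of the primitives of the single fans, all of which vanish at
  their centres. Each centre therefore survives for all times, and the characteristic speed
  oscillates by about \<open>c\<^sub>n\<^sub>+\<^sub>1 - c\<^sub>n\<close> in every gap. The speed is of bounded variation, since it grows at
  most linearly, and the solution is the image of the speed under \<open>B\<close>. A factorisation with a
  better exponent would make a sum of \<open>(c\<^sub>n\<^sub>+\<^sub>1 - c\<^sub>n)\<^sup>\<theta>\<close> with \<open>\<theta> < 1\<close> converge, which the choice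
  \<open>c\<^sub>n = - 1 / ln (n + 2)\<close> excludes.

  The Kruzhkov inequality for the minimum follows without any geometry of the shock curves: the
  minimum is replaced by a smooth one, with weights proportional to \<open>exp (- \<beta> V\<^sub>n)\<close> on the fans. The
  entropy production becomes a difference of covariances, whose sign is decided by the convexity of
  \<open>g\<close> for each pair of fans, and \<open>\<beta>\<close> tends to infinity.\<close>

section \<open>Differentiable functions and integrals of translates\<close>

text \<open>All fans issue from time -1, the zero of 1 + t: at time 0 they are already open, so no
  denominator degenerates there, and the positive extension \<open>time_shift\<close> lets the
  calculus run on the whole space although test functions live at positive times. The main obstacle
  is that \<open>B\<close> is only Hoelder continuous, so that a fan cannot be differentiated. Its
  primitive \<open>pot\<close> can, for every entropy pair: the x-derivative is the entropy, minus
  the t-derivative the entropy flux. The entropy equation of a single fan thus becomes the symmetry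
  of mixed derivatives, in a weak form valid for C^1 functions. Oddness of p enters through the
  second derivative of the flux, which behaves like the even power p - 1 and keeps its sign. The two
  halves of the regularity claim weigh a gap of length l differently: the speed pays l for it, and
  the gaps telescope, whereas the state oscillates there by l^(1/p), so that an inner function with
  outer exponent \<sigma> > 1/p pays at least a multiple of l^(1/(p \<sigma>)).\<close>

definition C1_deriv ::
    "('a::euclidean_space \<Rightarrow> 'b::euclidean_space) \<Rightarrow> ('a \<Rightarrow> 'a \<Rightarrow> 'b) \<Rightarrow> bool" where
  "C1_deriv f f' \<longleftrightarrow> (\<forall>z. (f has_derivative f' z) (at z)) \<and> (\<forall>h. continuous_on UNIV (\<lambda>z. f' z h))"

definition bounded_support :: "('a::real_normed_vector \<Rightarrow> 'b::zero) \<Rightarrow> bool" where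
  "bounded_support f \<longleftrightarrow> (\<exists>\<rho>. \<forall>z. f z \<noteq> 0 \<longrightarrow> norm z \<le> \<rho>)"

lemma C1_deriv_has_derivative: "C1_deriv f f' \<Longrightarrow> (f has_derivative f' z) (at z)"
  by (simp add: C1_deriv_def)

lemma C1_deriv_continuous: "C1_deriv f f' \<Longrightarrow> continuous_on UNIV (\<lambda>z. f' z h)"
  by (simp add: C1_deriv_def)

lemma C1_deriv_imp_continuous: "C1_deriv f f' \<Longrightarrow> continuous_on UNIV f"
  by (meson C1_deriv_def continuous_at_imp_continuous_on has_derivative_continuous)

lemma C1_deriv_linear: "C1_deriv f f' \<Longrightarrow> linear (f' z)"
  by (meson C1_deriv_def has_derivative_linear)

lemma C_k_1_imp_C1_deriv: "C_k 1 f \<Longrightarrow> C1_deriv f (\<lambda>z. frechet_derivative f (at z))"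
  by (simp add: C1_deriv_def frechet_derivative_works)

lemma C1_deriv_frechet: "C1_deriv f f' \<Longrightarrow> frechet_derivative f (at z) = f' z"
  using frechet_derivative_at[OF C1_deriv_has_derivative] by metis

lemma C1_deriv_imp_C_k_1: "C1_deriv f f' \<Longrightarrow> C_k 1 f"
  by (auto simp: C1_deriv_frechet differentiable_def C1_deriv_def)

lemma C1_deriv_const: "C1_deriv (\<lambda>z. c) (\<lambda>z h. 0)"
  by (simp add: C1_deriv_def)

lemma C1_deriv_bounded_linear: "bounded_linear f \<Longrightarrow> C1_deriv f (\<lambda>z. f)"
  by (simp add: C1_deriv_def bounded_linear_imp_has_derivative)

lemma C1_deriv_add:
  "C1_deriv f f' \<Longrightarrow> C1_deriv g g' \<Longrightarrow> C1_deriv (\<lambda>z. f z + g z) (\<lambda>z h. f' z h + g' z h)"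
  by (auto simp: C1_deriv_def intro!: continuous_intros has_derivative_add)

lemma C1_deriv_diff:
  "C1_deriv f f' \<Longrightarrow> C1_deriv g g' \<Longrightarrow> C1_deriv (\<lambda>z. f z - g z) (\<lambda>z h. f' z h - g' z h)"
  by (auto simp: C1_deriv_def intro!: continuous_intros has_derivative_diff)

lemma C1_deriv_sum:
  assumes "\<And>i. i \<in> I \<Longrightarrow> C1_deriv (f i) (f' i)"
  shows "C1_deriv (\<lambda>z. \<Sum>i\<in>I. f i z) (\<lambda>z h. \<Sum>i\<in>I. f' i z h)"
  using assms by (auto simp: C1_deriv_def intro!: continuous_intros has_derivative_sum)

lemma C1_deriv_mult:
  fixes f g :: "'a::euclidean_space \<Rightarrow> real"
  assumes "C1_deriv f f'" "C1_deriv g g'"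
  shows "C1_deriv (\<lambda>z. f z * g z) (\<lambda>z h. f z * g' z h + f' z h * g z)"
  using assms C1_deriv_imp_continuous[OF assms(1)] C1_deriv_imp_continuous[OF assms(2)]
  by (auto simp: C1_deriv_def intro!: continuous_intros has_derivative_mult)

lemma C1_deriv_scaleR_right:
  fixes f :: "'a::euclidean_space \<Rightarrow> real"
  assumes "C1_deriv f f'"
  shows "C1_deriv (\<lambda>z. f z *\<^sub>R w) (\<lambda>z h. f' z h *\<^sub>R w)"
  using assms by (auto simp: C1_deriv_def intro!: continuous_intros has_derivative_scaleR_left)

lemma C1_deriv_inner_right:
  assumes "C1_deriv f f'"
  shows "C1_deriv (\<lambda>z. f z \<bullet> w) (\<lambda>z h. f' z h \<bullet> w)"
  using assms by (auto simp: C1_deriv_def intro!: continuous_intros has_derivative_inner_left)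

lemma C1_deriv_compose_real:
  fixes f :: "'a::euclidean_space \<Rightarrow> real"
  assumes f: "C1_deriv f f'"
    and k: "\<And>z. (k has_real_derivative k' (f z)) (at (f z))" "continuous_on (range f) k'"
  shows "C1_deriv (\<lambda>z. k (f z)) (\<lambda>z h. k' (f z) * f' z h)"
proof -
  have c: "continuous_on UNIV (\<lambda>z. k' (f z))"
    using continuous_on_compose2[OF k(2) C1_deriv_imp_continuous[OF f]] by auto
  have "((\<lambda>z. k (f z)) has_derivative (\<lambda>h. k' (f z) * f' z h)) (at z)" for z
    using has_derivative_compose[OF C1_deriv_has_derivative[OF f, of z] k(1)[of z, unfolded
        has_field_derivative_def]]
    by simp
  then show ?thesis
    using f c by (auto simp: C1_deriv_def intro!: continuous_intros)
qed

lemma C1_deriv_translate: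
  assumes "C1_deriv f f'"
  shows "C1_deriv (\<lambda>z. f (z + a)) (\<lambda>z. f' (z + a))"
proof -
  have "((\<lambda>z. f (z + a)) has_derivative f' (z + a)) (at z)" for z
  proof -
    have "((\<lambda>z. z + a) has_derivative (\<lambda>h. h)) (at z)" by (auto intro!: derivative_eq_intros)
    from has_derivative_compose[OF this C1_deriv_has_derivative[OF assms]] show ?thesis by simp
  qed
  moreover have "continuous_on UNIV (\<lambda>z. f' (z + a) h)" for h
    by (rule continuous_on_compose2[OF C1_deriv_continuous[OF assms]]) (auto intro!: continuous_intros)
  ultimately show ?thesis by (simp add: C1_deriv_def)
qed

lemma C1_deriv_line:
  fixes f :: "'a::euclidean_space \<Rightarrow> real"
  assumes "C1_deriv f f'"
  shows "((\<lambda>s. f (z + s *\<^sub>R e)) has_real_derivative f' (z + s *\<^sub>R e) e) (at s)"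
proof -
  have "((\<lambda>s. f (z + s *\<^sub>R e)) has_derivative (\<lambda>h. f' (z + s *\<^sub>R e) (h *\<^sub>R e))) (at s)"
    by (rule has_derivative_compose[of "\<lambda>s. z + s *\<^sub>R e" "\<lambda>h. h *\<^sub>R e" s UNIV f "f' (z + s *\<^sub>R e)"])
       (auto intro!: derivative_eq_intros C1_deriv_has_derivative[OF assms])
  then show ?thesis
    by (simp add: has_field_derivative_def linear_scale[OF C1_deriv_linear[OF assms]]
        mult.commute[of _ "f' _ _"])
qed

lemma C1_deriv_mvt:
  fixes f :: "'a::euclidean_space \<Rightarrow> real"
  assumes "C1_deriv f f'"
  shows "\<exists>s. \<bar>s\<bar> \<le> \<bar>r\<bar> \<and> f (z + r *\<^sub>R e) - f z = r * f' (z + s *\<^sub>R e) e"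
proof (cases "r = 0")
  case True then show ?thesis by auto
next
  case False
  consider "0 < r" | "r < 0" using False by linarith
  then show ?thesis
  proof cases
    case 1
    from MVT2[OF 1, of "\<lambda>s. f (z + s *\<^sub>R e)" "\<lambda>s. f' (z + s *\<^sub>R e) e"] C1_deriv_line[OF assms]
    obtain s where "0 < s" "s < r" "f (z + r *\<^sub>R e) - f (z + 0 *\<^sub>R e) = (r - 0) * f' (z + s *\<^sub>R e)
        e" by blast
    then show ?thesis by (intro exI[of _ s]) auto
  next
    case 2
    from MVT2[OF 2, of "\<lambda>s. f (z + s *\<^sub>R e)" "\<lambda>s. f' (z + s *\<^sub>R e) e"] C1_deriv_line[OF assms]
    obtain s where "r < s" "s < 0" "f (z + 0 *\<^sub>R e) - f (z + r *\<^sub>R e) = (0 - r) * f' (z + s *\<^sub>R e)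
        e" by blast
    then show ?thesis by (intro exI[of _ s]) (auto simp: algebra_simps)
  qed
qed

lemma C1_deriv_zero_outside:
  assumes "C1_deriv f f'" and "\<And>z. f z \<noteq> 0 \<Longrightarrow> z \<in> K" "closed K" "z \<notin> K"
  shows "f' z h = 0"
proof -
  have "(f has_derivative (\<lambda>h. 0)) (at z)"
    by (rule has_derivative_transform_within_open[of "\<lambda>_. 0" _ _ _ "- K"])
      (use assms in \<open>auto simp: open_Compl\<close>)
  from has_derivative_unique[OF this C1_deriv_has_derivative[OF assms(1)]]
  show ?thesis by metis
qed

lemma bounded_support_obtain:
  fixes f :: "'a::real_normed_vector \<Rightarrow> 'b::zero"
  assumes "bounded_support f"
  obtains \<rho> where "\<rho> > 0" "\<And>z. f z \<noteq> 0 \<Longrightarrow> z \<in> cball 0 \<rho>"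
proof -
  from assms obtain \<rho> where r: "\<And>z. f z \<noteq> 0 \<Longrightarrow> norm z \<le> \<rho>" by (auto simp: bounded_support_def)
  show ?thesis
    by (rule that[of "max 1 \<rho>"]) (use r in \<open>auto simp: le_max_iff_disj\<close>)
qed

lemma bounded_support_deriv:
  fixes f :: "'a::euclidean_space \<Rightarrow> real"
  assumes "C1_deriv f f'" "bounded_support f"
  shows "bounded_support (\<lambda>z. f' z e)"
proof -
  obtain \<rho> where r: "\<And>z. f z \<noteq> 0 \<Longrightarrow> z \<in> cball 0 \<rho>"
    using bounded_support_obtain[OF assms(2)] by metis
  show ?thesis unfolding bounded_support_def
    using C1_deriv_zero_outside[OF assms(1) r] by (intro exI[of _ \<rho>]) (metis closed_cball mem_cball_0)
qed

lemma compactly_supported_C1: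
  fixes \<phi> :: "'a::euclidean_space \<Rightarrow> 'b::euclidean_space"
  assumes "C1_deriv \<phi> \<phi>'" "compactly_supported_in \<Omega> \<phi>"
  shows "bounded_support \<phi>" "\<And>X. X \<notin> \<Omega> \<Longrightarrow> \<phi> X = 0" "\<And>X v. X \<notin> \<Omega> \<Longrightarrow> \<phi>' X v = 0"
proof -
  let ?S = "closure {z. \<phi> z \<noteq> 0}"
  have S: "compact ?S" "?S \<subseteq> \<Omega>" using assms(2) by (simp_all add: compactly_supported_in_def)
  have inS: "z \<in> ?S" if "\<phi> z \<noteq> 0" for z by (rule subsetD[OF closure_subset]) (simp add: that)
  obtain \<rho> where "\<And>z. z \<in> ?S \<Longrightarrow> norm z \<le> \<rho>" using compact_imp_bounded[OF S(1)] unfolding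
      bounded_iff by auto
  then show "bounded_support \<phi>" unfolding bounded_support_def using inS by (intro exI[of _ \<rho>]) simp
  show "\<phi> X = 0" if "X \<notin> \<Omega>" for X using inS[of X] S(2) that by auto
  show "\<phi>' X v = 0" if "X \<notin> \<Omega>" for X v
    by (rule C1_deriv_zero_outside[OF assms(1) inS closed_closure]) (use S(2) that in auto)
qed

lemma bounded_support_mult:
  fixes f g :: "'a::real_normed_vector \<Rightarrow> real"
  assumes "bounded_support g"
  shows "bounded_support (\<lambda>z. f z * g z)" "bounded_support (\<lambda>z. g z * f z)"
  using assms by (auto simp: bounded_support_def)

lemma bounded_support_translate:
  fixes f :: "'a::real_normed_vector \<Rightarrow> 'b::zero"
  assumes "bounded_support f"
  shows "bounded_support (\<lambda>z. f (z + a))"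
proof -
  obtain \<rho> where r: "\<And>z. f z \<noteq> 0 \<Longrightarrow> norm z \<le> \<rho>" using assms by (auto simp: bounded_support_def)
  show ?thesis unfolding bounded_support_def
  proof (intro exI[of _ "\<rho> + norm a"] allI impI)
    fix z assume "f (z + a) \<noteq> 0"
    then have "norm (z + a) \<le> \<rho>" using r by auto
    then show "norm z \<le> \<rho> + norm a"
      using norm_triangle_ineq4[of "z + a" a] by auto
  qed
qed

section \<open>Local integrability and translations of Lebesgue measure\<close>

lemma L1_loc_measurable:
  assumes "G \<in> L1_loc" shows "G \<in> borel_measurable lebesgue"
proof (rule borel_measurable_LIMSEQ_real)
  fix z show "(\<lambda>n. indicator (cball 0 (real n)) z *\<^sub>R G z) \<longlonglongrightarrow> G z"
  proof (rule tendsto_eventually)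
    obtain N where N: "norm z \<le> real N" using real_arch_simple by blast
    show "\<forall>\<^sub>F n in sequentially. indicator (cball 0 (real n)) z *\<^sub>R G z = G z"
      using eventually_ge_at_top[of N] by eventually_elim (use N in \<open>auto simp: indicator_def\<close>)
  qed
next
  fix n :: nat
  have "integrable lebesgue (\<lambda>z. indicator (cball 0 (real n)) z *\<^sub>R G z)"
    using assms by (auto simp: L1_loc_def set_integrable_def)
  then show "(\<lambda>z. indicator (cball 0 (real n)) z *\<^sub>R G z) \<in> borel_measurable lebesgue" by auto
qed

lemma continuous_on_UNIV_borel_lebesgue:
  fixes f :: "'a::euclidean_space \<Rightarrow> real"
  assumes "continuous_on UNIV f" shows "f \<in> borel_measurable lebesgue"
  by (rule measurable_completion) (simp add: borel_measurable_continuous_onI[OF assms])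

lemma integrable_L1_loc_mult:
  fixes G f :: "'a::euclidean_space \<Rightarrow> real"
  assumes G: "G \<in> L1_loc" and f: "f \<in> borel_measurable lebesgue" "bounded_support f" "\<And>z. \<bar>f z\<bar> \<le> B"
  shows "integrable lebesgue (\<lambda>z. G z * f z)"
proof -
  obtain \<rho> where r: "\<And>z. f z \<noteq> 0 \<Longrightarrow> z \<in> cball 0 \<rho>"
    using bounded_support_obtain[OF f(2)] by metis
  have "integrable lebesgue (\<lambda>z. indicator (cball 0 \<rho>) z *\<^sub>R G z)"
    using G by (auto simp: L1_loc_def set_integrable_def)
  then have "integrable lebesgue (\<lambda>z. B * (indicator (cball 0 \<rho>) z *\<^sub>R G z))" by simp
  then show ?thesis
  proof (rule Bochner_Integration.integrable_bound)
    show "(\<lambda>z. G z * f z) \<in> borel_measurable lebesgue"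
      by (intro borel_measurable_times L1_loc_measurable[OF G] f(1))
    have "0 \<le> B" using f(3)[of 0] by linarith
    show "AE z in lebesgue. norm (G z * f z) \<le> norm (B * (indicator (cball 0 \<rho>) z *\<^sub>R G z))"
    proof (intro AE_I2)
      fix z show "norm (G z * f z) \<le> norm (B * (indicator (cball 0 \<rho>) z *\<^sub>R G z))"
      proof (cases "f z = 0")
        case False
        have "\<bar>G z\<bar> * \<bar>f z\<bar> \<le> \<bar>G z\<bar> * B" by (rule mult_left_mono[OF f(3)]) simp
        then show ?thesis using r[OF False] \<open>0 \<le> B\<close> by (simp add: abs_mult ac_simps)
      qed auto
    qed
  qed
qed

lemma L1_loc_bounded:
  fixes G :: "'a::euclidean_space \<Rightarrow> real"
  assumes "G \<in> borel_measurable lebesgue" "\<And>R. \<exists>B. \<forall>z. norm z \<le> R \<longrightarrow> \<bar>G z\<bar> \<le> B"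
  shows "G \<in> L1_loc"
proof -
  have "set_integrable lebesgue K G" if K: "compact K" for K
  proof -
    obtain R where R: "\<And>z. z \<in> K \<Longrightarrow> norm z \<le> R" using compact_imp_bounded[OF K] unfolding
        bounded_iff by blast
    obtain B where B: "\<And>z. norm z \<le> R \<Longrightarrow> \<bar>G z\<bar> \<le> B" using assms(2) by blast
    have "integrable lborel (\<lambda>z. indicator K z *\<^sub>R B)" using K by (intro borel_integrable_compact) auto
    then have "integrable lebesgue (\<lambda>z. indicator K z *\<^sub>R B)"
      using integrable_completion[of "\<lambda>z. indicator K z *\<^sub>R B" lborel] borel_measurable_integrable
          by blast
    then show ?thesis unfolding set_integrable_def
    proof (rule Bochner_Integration.integrable_bound)
      have "K \<in> sets lebesgue" by (intro sets_completionI_sets) (simp add: borel_compact K)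
      then show "(\<lambda>z. indicator K z *\<^sub>R G z) \<in> borel_measurable lebesgue"
        by (intro borel_measurable_scaleR assms(1) borel_measurable_indicator)
      show "AE z in lebesgue. norm (indicator K z *\<^sub>R G z) \<le> norm (indicator K z *\<^sub>R B)"
        using B R by (intro AE_I2) (force simp: indicator_def)
    qed
  qed
  then show ?thesis by (simp add: L1_loc_def)
qed

lemma continuous_L1_loc:
  fixes f :: "'a::euclidean_space \<Rightarrow> real"
  assumes "continuous_on UNIV f" shows "f \<in> L1_loc"
proof (rule L1_loc_bounded[OF continuous_on_UNIV_borel_lebesgue[OF assms]])
  fix R
  have "compact (f ` cball 0 R)"
    by (intro compact_continuous_image continuous_on_subset[OF assms]) auto
  from compact_imp_bounded[OF this]
  obtain B where "\<And>y. y \<in> f ` cball 0 R \<Longrightarrow> norm y \<le> B" unfolding bounded_iff by blast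
  then show "\<exists>B. \<forall>z. norm z \<le> R \<longrightarrow> \<bar>f z\<bar> \<le> B" by (intro exI[of _ B]) auto
qed

lemma continuous_bounded_support:
  fixes f :: "'a::euclidean_space \<Rightarrow> real"
  assumes "continuous_on UNIV f" "bounded_support f"
  obtains B where "\<And>z. \<bar>f z\<bar> \<le> B"
proof -
  obtain \<rho> where r: "\<And>z. f z \<noteq> 0 \<Longrightarrow> z \<in> cball 0 \<rho>"
    using bounded_support_obtain[OF assms(2)] by metis
  have "compact (f ` cball 0 \<rho>)"
    by (intro compact_continuous_image continuous_on_subset[OF assms(1)]) auto
  from compact_imp_bounded[OF this]
  obtain B where B: "B > 0" "\<And>z. z \<in> cball 0 \<rho> \<Longrightarrow> \<bar>f z\<bar> \<le> B"
    unfolding bounded_pos by auto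
  show ?thesis by (rule that[of B]) (use B r in force)
qed

lemma integrable_L1_loc_mult_continuous:
  fixes G f :: "'a::euclidean_space \<Rightarrow> real"
  assumes "G \<in> L1_loc" "continuous_on UNIV f" "bounded_support f"
  shows "integrable lebesgue (\<lambda>z. G z * f z)"
  proof -
  obtain B where "\<And>z. \<bar>f z\<bar> \<le> B" using continuous_bounded_support[OF assms(2,3)] by blast
  then show ?thesis
    by (rule integrable_L1_loc_mult[OF assms(1) continuous_on_UNIV_borel_lebesgue[OF assms(2)]
        assms(3)])
qed

lemma distr_lebesgue_translation:
  "distr lebesgue lebesgue (\<lambda>x. a + x) = (lebesgue :: 'a::euclidean_space measure)"
  using lebesgue_affine_euclidean[of "\<lambda>_. 1" a]
  by (simp add: euclidean_representation density_1)

lemma measurable_lebesgue_translation: "(\<lambda>x. a + x) \<in> lebesgue \<rightarrow>\<^sub>M (lebesgue ::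
    'a::euclidean_space measure)"
proof -
  have "(\<lambda>x. a + (\<Sum>j\<in>Basis. (1 * (x \<bullet> j)) *\<^sub>R j)) \<in> lebesgue \<rightarrow>\<^sub>M lebesgue"
    using lebesgue_affine_measurable[of "\<lambda>_. 1" a] by simp
  then show ?thesis by (simp add: euclidean_representation)
qed

lemma integral_lebesgue_translation:
  fixes f :: "'a::euclidean_space \<Rightarrow> real"
  assumes "f \<in> borel_measurable lebesgue"
  shows "(\<integral>x. f (x + a) \<partial>lebesgue) = (\<integral>x. f x \<partial>lebesgue)"
proof -
  have "(\<integral>x. f x \<partial>lebesgue) = (\<integral>x. f x \<partial>distr lebesgue lebesgue (\<lambda>x. a + x))"
    by (simp add: distr_lebesgue_translation)
  also have "\<dots> = (\<integral>x. f (a + x) \<partial>lebesgue)"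
    by (rule integral_distr[OF measurable_lebesgue_translation]) (use assms in auto)
  finally show ?thesis by (simp add: add.commute)
qed

lemma borel_measurable_lebesgue_translation:
  fixes f :: "'a::euclidean_space \<Rightarrow> real"
  assumes "f \<in> borel_measurable lebesgue"
  shows "(\<lambda>x. f (x + a)) \<in> borel_measurable lebesgue"
  using measurable_compose[OF measurable_lebesgue_translation assms, of a] by (simp add: add.commute)

lemma integrable_lebesgue_translation:
  fixes f :: "'a::euclidean_space \<Rightarrow> real"
  assumes "integrable lebesgue f"
  shows "integrable lebesgue (\<lambda>x. f (x + a))"
  using integrable_distr[OF measurable_lebesgue_translation[of a], of f] assms
  by (simp add: distr_lebesgue_translation add.commute[of _ a])

text \<open>The derivative falls on \<open>\<phi>\<close>, so that no regularity of \<open>G\<close> is needed.\<close>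

lemma integral_translate_has_derivative:
  fixes G \<phi> :: "'a::euclidean_space \<Rightarrow> real"
  assumes G: "G \<in> L1_loc" and phi: "C1_deriv \<phi> \<phi>'" and bs: "bounded_support \<phi> \<or> continuous_on UNIV
      G \<and> bounded_support G"
  shows "((\<lambda>s. \<integral>z. G z * \<phi> (z + s *\<^sub>R e) \<partial>lebesgue)
    has_real_derivative (\<integral>z. G z * \<phi>' (z + s0 *\<^sub>R e) e \<partial>lebesgue)) (at s0)"
proof -
  obtain \<rho> where r: "(\<forall>z. \<phi> z \<noteq> 0 \<longrightarrow> norm z \<le> \<rho>) \<or> (\<forall>z. G z \<noteq> 0 \<longrightarrow> norm z \<le> \<rho>)"
    using bs by (auto simp: bounded_support_def)
  have contp: "continuous_on UNIV (\<lambda>z. \<phi> (z + a))" for a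
    by (rule C1_deriv_imp_continuous[OF C1_deriv_translate[OF phi]])
  have int: "integrable lebesgue (\<lambda>z. G z * \<phi> (z + s *\<^sub>R e))" for s
    using bs
  proof
    assume "bounded_support \<phi>"
    then show ?thesis
      by (intro integrable_L1_loc_mult_continuous G bounded_support_translate contp)
  next
    assume "continuous_on UNIV G \<and> bounded_support G"
    then have "integrable lebesgue (\<lambda>z. \<phi> (z + s *\<^sub>R e) * G z)"
      by (intro integrable_L1_loc_mult_continuous continuous_L1_loc[OF contp]) simp_all
    then show ?thesis by (simp add: mult.commute)
  qed
  show ?thesis
    unfolding has_field_derivative_iff tendsto_at_iff_sequentially comp_def
  proof (intro allI impI)
    fix X :: "nat \<Rightarrow> real" assume X: "\<forall>i. X i \<in> UNIV - {s0}" "X \<longlonglongrightarrow> s0"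
    obtain R where R: "\<And>i. \<bar>X i\<bar> \<le> R" "R > 0"
      using convergent_imp_Bseq[OF convergentI[OF X(2)]] unfolding Bseq_def by auto
    \<comment> \<open>Beyond this radius the product of \<open>G\<close> with either translate in a
      difference quotient vanishes, for all parameters up to
      \<open>R + \<bar>s0\<bar>\<close>.\<close>
    define \<rho>' where "\<rho>' = \<bar>\<rho>\<bar> + (R + \<bar>s0\<bar>) * norm e"
    have supp: "G z = 0 \<or> \<phi> (z + s *\<^sub>R e) = 0" if "norm z > \<rho>'" "\<bar>s\<bar> \<le> R + \<bar>s0\<bar>" for z s
    proof (rule ccontr)
      assume n: "\<not> (G z = 0 \<or> \<phi> (z + s *\<^sub>R e) = 0)"
      have "norm (s *\<^sub>R e) \<le> (R + \<bar>s0\<bar>) * norm e"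
        using that(2) by (auto intro: mult_right_mono)
      moreover have "0 \<le> (R + \<bar>s0\<bar>) * norm e" using R(2) by simp
      moreover have "norm z \<le> norm (z + s *\<^sub>R e) + norm (s *\<^sub>R e)"
        using norm_triangle_ineq4[of "z + s *\<^sub>R e" "s *\<^sub>R e"] by simp
      moreover have "norm (z + s *\<^sub>R e) \<le> \<rho> \<or> norm z \<le> \<rho>" using n r by blast
      ultimately show False using that(1) by (auto simp: \<rho>'_def)
    qed
    have "bounded ((\<lambda>z. \<phi>' z e) ` cball 0 (\<rho>' + (R + 2 * \<bar>s0\<bar>) * norm e))"
      by (intro compact_imp_bounded compact_continuous_image continuous_on_subset[OF
          C1_deriv_continuous[OF phi]]) auto
    then obtain B where B: "B > 0" "\<And>z. norm z \<le> \<rho>' + (R + 2 * \<bar>s0\<bar>) * norm e \<Longrightarrow> \<bar>\<phi>' z e\<bar> \<le> B"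
      unfolding bounded_pos by auto
    have lim: "(\<lambda>i. \<integral>z. G z * ((\<phi> (z + X i *\<^sub>R e) - \<phi> (z + s0 *\<^sub>R e)) / (X i - s0)) \<partial>lebesgue)
      \<longlonglongrightarrow> (\<integral>z. G z * \<phi>' (z + s0 *\<^sub>R e) e \<partial>lebesgue)"
    proof (rule integral_dominated_convergence[where w="\<lambda>z. B * \<bar>indicator (cball 0 \<rho>') z *\<^sub>R G z\<bar>"])
      have "continuous_on UNIV (\<lambda>z. \<phi>' (z + s0 *\<^sub>R e) e)"
        by (rule C1_deriv_continuous[OF C1_deriv_translate[OF phi]])
      then show "(\<lambda>z. G z * \<phi>' (z + s0 *\<^sub>R e) e) \<in> borel_measurable lebesgue"
        using L1_loc_measurable[OF G] continuous_on_UNIV_borel_lebesgue by (intro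
            borel_measurable_times)
      show "(\<lambda>z. G z * ((\<phi> (z + X i *\<^sub>R e) - \<phi> (z + s0 *\<^sub>R e)) / (X i - s0))) \<in> borel_measurable
          lebesgue" for i
        by (intro borel_measurable_times L1_loc_measurable[OF G] borel_measurable_divide
            borel_measurable_diff continuous_on_UNIV_borel_lebesgue contp) auto
      have "integrable lebesgue (\<lambda>z. indicator (cball 0 \<rho>') z *\<^sub>R G z)"
        using G by (auto simp: L1_loc_def set_integrable_def)
      then show "integrable lebesgue (\<lambda>z. B * \<bar>indicator (cball 0 \<rho>') z *\<^sub>R G z\<bar>)" by simp
      show "AE z in lebesgue. (\<lambda>i. G z * ((\<phi> (z + X i *\<^sub>R e) - \<phi> (z + s0 *\<^sub>R e)) / (X i - s0)))
          \<longlonglongrightarrow> G z * \<phi>' (z + s0 *\<^sub>R e) e"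
      proof (intro AE_I2 tendsto_mult tendsto_const)
        fix z
        from C1_deriv_line[OF phi, of z e s0] X
        show "(\<lambda>i. (\<phi> (z + X i *\<^sub>R e) - \<phi> (z + s0 *\<^sub>R e)) / (X i - s0)) \<longlonglongrightarrow> \<phi>' (z + s0 *\<^sub>R e) e"
          unfolding has_field_derivative_iff tendsto_at_iff_sequentially comp_def by blast
      qed
      show "AE z in lebesgue. norm (G z * ((\<phi> (z + X i *\<^sub>R e) - \<phi> (z + s0 *\<^sub>R e)) / (X i - s0)))
          \<le> B * \<bar>indicator (cball 0 \<rho>') z *\<^sub>R G z\<bar>" for i
      proof (intro AE_I2)
        fix z
        show "norm (G z * ((\<phi> (z + X i *\<^sub>R e) - \<phi> (z + s0 *\<^sub>R e)) / (X i - s0)))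
          \<le> B * \<bar>indicator (cball 0 \<rho>') z *\<^sub>R G z\<bar>"
        proof (cases "norm z > \<rho>'")
          case True
          have "G z = 0 \<or> \<phi> (z + X i *\<^sub>R e) = 0 \<and> \<phi> (z + s0 *\<^sub>R e) = 0"
            using supp[OF True, of "X i"] supp[OF True, of s0] R(1)[of i] R(2) by auto
          then show ?thesis using B by auto
        next
          case False
          from C1_deriv_mvt[OF phi, of "X i - s0" "z + s0 *\<^sub>R e" e]
          obtain s where s: "\<bar>s\<bar> \<le> \<bar>X i - s0\<bar>"
            "\<phi> (z + X i *\<^sub>R e) - \<phi> (z + s0 *\<^sub>R e) = (X i - s0) * \<phi>' (z + s0 *\<^sub>R e + s *\<^sub>R e) e"
            by (auto simp: algebra_simps)
          have "norm (z + s0 *\<^sub>R e + s *\<^sub>R e) \<le> norm z + norm ((s0 + s) *\<^sub>R e)"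
            using norm_triangle_ineq[of z "(s0 + s) *\<^sub>R e"] by (simp add: algebra_simps)
          also have "norm ((s0 + s) *\<^sub>R e) \<le> (R + 2 * \<bar>s0\<bar>) * norm e"
            using s(1) R(1)[of i] by (auto intro!: mult_right_mono)
          finally have "norm (z + s0 *\<^sub>R e + s *\<^sub>R e) \<le> \<rho>' + (R + 2 * \<bar>s0\<bar>) * norm e"
            using False by simp
          note b = B(2)[OF this]
          have "X i - s0 \<noteq> 0" using X(1) by auto
          then have "\<bar>(\<phi> (z + X i *\<^sub>R e) - \<phi> (z + s0 *\<^sub>R e)) / (X i - s0)\<bar> \<le> B"
            using s(2) b by simp
          then have "\<bar>G z\<bar> * \<bar>(\<phi> (z + X i *\<^sub>R e) - \<phi> (z + s0 *\<^sub>R e)) / (X i - s0)\<bar> \<le> \<bar>G z\<bar> * B"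
            by (rule mult_left_mono) auto
          then show ?thesis using False by (simp add: abs_mult mult.commute)
        qed
      qed
    qed
    have "(\<integral>z. G z * ((\<phi> (z + X i *\<^sub>R e) - \<phi> (z + s0 *\<^sub>R e)) / (X i - s0)) \<partial>lebesgue) =
      ((\<integral>z. G z * \<phi> (z + X i *\<^sub>R e) \<partial>lebesgue) - (\<integral>z. G z * \<phi> (z + s0 *\<^sub>R e) \<partial>lebesgue)) / (X i -
          s0)" for i
    proof -
      have "(\<integral>z. G z * ((\<phi> (z + X i *\<^sub>R e) - \<phi> (z + s0 *\<^sub>R e)) / (X i - s0)) \<partial>lebesgue) =
         (\<integral>z. (G z * \<phi> (z + X i *\<^sub>R e) - G z * \<phi> (z + s0 *\<^sub>R e)) / (X i - s0) \<partial>lebesgue)"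
        by (simp add: right_diff_distrib diff_divide_distrib)
      also have "\<dots> = (\<integral>z. (G z * \<phi> (z + X i *\<^sub>R e) - G z * \<phi> (z + s0 *\<^sub>R e)) \<partial>lebesgue) / (X i - s0)"
        by simp
      also have "\<dots> = ((\<integral>z. G z * \<phi> (z + X i *\<^sub>R e) \<partial>lebesgue) - (\<integral>z. G z * \<phi> (z + s0 *\<^sub>R e)
          \<partial>lebesgue)) / (X i - s0)"
        using Bochner_Integration.integral_diff[OF int int] by simp
      finally show ?thesis .
    qed
    with lim show "(\<lambda>i. ((\<integral>z. G z * \<phi> (z + X i *\<^sub>R e) \<partial>lebesgue) - (\<integral>z. G z * \<phi> (z + s0 *\<^sub>R e)
        \<partial>lebesgue)) / (X i - s0))
      \<longlonglongrightarrow> (\<integral>z. G z * \<phi>' (z + s0 *\<^sub>R e) e \<partial>lebesgue)" by (simp only:)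
  qed
qed

lemma integral_translate_swap:
  fixes G \<phi> :: "'a::euclidean_space \<Rightarrow> real"
  assumes "G \<in> borel_measurable lebesgue" "\<phi> \<in> borel_measurable lebesgue"
  shows "(\<integral>z. G z * \<phi> (z + a) \<partial>lebesgue) = (\<integral>z. G (z - a) * \<phi> z \<partial>lebesgue)"
  using integral_lebesgue_translation[of "\<lambda>z. G z * \<phi> (z + a)" "- a"]
    borel_measurable_times[OF assms(1) borel_measurable_lebesgue_translation[OF assms(2), of a]] by simp

text \<open>The translation moves from \<open>\<phi>\<close> to \<open>G\<close>: the integral is
  the derivative at s = 0 of the pairing of G(z - s e) with \<open>\<phi>\<close>, which cannot
  exceed its value at 0 for positive s. This inequality is behind the variation bound for monotone
  functions.\<close>

lemma integral_deriv_nondecreasing: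
  fixes G \<phi> :: "'a::euclidean_space \<Rightarrow> real"
  assumes G: "G \<in> L1_loc" and mono: "\<And>z s. s \<ge> 0 \<Longrightarrow> G z \<le> G (z + s *\<^sub>R e)"
    and phi: "C1_deriv \<phi> \<phi>'" "bounded_support \<phi>" "\<And>z. \<phi> z \<ge> 0"
  shows "(\<integral>z. G z * \<phi>' z e \<partial>lebesgue) \<le> 0"
proof (rule ccontr)
  define \<Phi> where "\<Phi> s = (\<integral>z. G z * \<phi> (z + s *\<^sub>R e) \<partial>lebesgue)" for s
  assume "\<not> ?thesis"
  then have pos: "(\<integral>z. G z * \<phi>' z e \<partial>lebesgue) > 0" by simp
  have "(\<Phi> has_real_derivative (\<integral>z. G z * \<phi>' z e \<partial>lebesgue)) (at 0)"
    using integral_translate_has_derivative[OF G phi(1), of e 0] phi(2) by (simp add: \<Phi>_def[abs_def])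
  from DERIV_pos_inc_right[OF this pos] obtain d where d: "d > 0" "\<And>h. 0 < h \<Longrightarrow> h < d \<Longrightarrow> \<Phi> 0 < \<Phi> h"
    by auto
  define h where "h = d / 2"
  have h: "0 < h" "h < d" using d(1) by (auto simp: h_def)
  have contp: "continuous_on UNIV \<phi>" by (rule C1_deriv_imp_continuous[OF phi(1)])
  have "\<Phi> h = (\<integral>z. G (z - h *\<^sub>R e) * \<phi> z \<partial>lebesgue)"
    unfolding \<Phi>_def
    by (intro integral_translate_swap L1_loc_measurable[OF G] continuous_on_UNIV_borel_lebesgue contp)
  also have "\<dots> \<le> (\<integral>z. G z * \<phi> z \<partial>lebesgue)"
  proof (rule integral_mono)
    show "integrable lebesgue (\<lambda>z. G z * \<phi> z)"
      by (intro integrable_L1_loc_mult_continuous G phi contp)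
    have "integrable lebesgue (\<lambda>z. G z * \<phi> (z + h *\<^sub>R e))"
      by (intro integrable_L1_loc_mult_continuous G bounded_support_translate phi
          C1_deriv_imp_continuous[OF C1_deriv_translate[OF phi(1)]])
    from integrable_lebesgue_translation[OF this, of "- h *\<^sub>R e"]
    show "integrable lebesgue (\<lambda>z. G (z - h *\<^sub>R e) * \<phi> z)" by simp
    show "G (z - h *\<^sub>R e) * \<phi> z \<le> G z * \<phi> z" for z
      using mono[of h "z - h *\<^sub>R e"] h phi(3) by (intro mult_right_mono) auto
  qed
  also have "\<dots> = \<Phi> 0" by (simp add: \<Phi>_def)
  finally show False using d(2)[OF h] by simp
qed

text \<open>The translated integral is constant in s. With \<open>G = 1\<close> this yields
  integration by parts; applied to the flux it removes the directions transverse to the plane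
  wave.\<close>

lemma integral_deriv_invariant:
  fixes G \<phi> :: "'a::euclidean_space \<Rightarrow> real"
  assumes G: "G \<in> L1_loc" and inv: "\<And>z s. G (z + s *\<^sub>R e) = G z"
    and phi: "C1_deriv \<phi> \<phi>'" "bounded_support \<phi>"
  shows "(\<integral>z. G z * \<phi>' z e \<partial>lebesgue) = 0"
proof -
  define \<Phi> where "\<Phi> s = (\<integral>z. G z * \<phi> (z + s *\<^sub>R e) \<partial>lebesgue)" for s
  have "(\<Phi> has_real_derivative (\<integral>z. G z * \<phi>' z e \<partial>lebesgue)) (at 0)"
    using integral_translate_has_derivative[OF G phi(1), of e 0] phi(2) by (simp add: \<Phi>_def[abs_def])
  moreover have "\<Phi> s = \<Phi> 0" for s
  proof -
    have "\<Phi> s = (\<integral>z. G (z - s *\<^sub>R e) * \<phi> z \<partial>lebesgue)"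
      unfolding \<Phi>_def
      by (intro integral_translate_swap L1_loc_measurable[OF G] continuous_on_UNIV_borel_lebesgue
          C1_deriv_imp_continuous[OF phi(1)])
    also have "\<dots> = \<Phi> 0" using inv[of "z - s *\<^sub>R e" s for z] by (simp add: \<Phi>_def)
    finally show ?thesis .
  qed
  then have "\<Phi> = (\<lambda>s. \<Phi> 0)" by auto
  then have "(\<Phi> has_real_derivative 0) (at 0)" by (metis DERIV_const)
  ultimately show ?thesis using DERIV_unique by blast
qed

lemma integration_by_parts_C1:
  fixes f g :: "'a::euclidean_space \<Rightarrow> real"
  assumes f: "C1_deriv f f'" and g: "C1_deriv g g'" "bounded_support g"
  shows "(\<integral>z. f' z a * g z \<partial>lebesgue) = - (\<integral>z. f z * g' z a \<partial>lebesgue)"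
proof -
  have "(\<integral>z. 1 * (f z * g' z a + f' z a * g z) \<partial>lebesgue) = 0"
    by (rule integral_deriv_invariant[OF _ _ C1_deriv_mult[OF f g(1)]])
      (auto intro: continuous_L1_loc bounded_support_mult g)
  moreover have "integrable lebesgue (\<lambda>z. f z * g' z a)"
    by (intro integrable_L1_loc_mult_continuous continuous_L1_loc C1_deriv_imp_continuous[OF f]
        C1_deriv_continuous[OF g(1)] bounded_support_deriv[OF g])
  moreover have "integrable lebesgue (\<lambda>z. f' z a * g z)"
    by (intro integrable_L1_loc_mult_continuous continuous_L1_loc C1_deriv_continuous[OF f]
        C1_deriv_imp_continuous[OF g(1)] g(2))
  ultimately show ?thesis by (simp add: Bochner_Integration.integral_add)
qed

text \<open>For \<open>f\<close> of class \<open>C\<^sup>2\<close> this is two integrations by parts. Here the second derivative is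
  avoided by differentiating \<open>s \<mapsto> \<integral> \<partial>\<^sub>a f(z) g(z + s b) dz = - \<integral> f(z - s b) \<partial>\<^sub>a g(z) dz\<close> in two ways.\<close>

lemma integral_mixed_derivatives_swap:
  fixes f g :: "'a::euclidean_space \<Rightarrow> real"
  assumes f: "C1_deriv f f'" and g: "C1_deriv g g'" "bounded_support g"
  shows "(\<integral>z. f' z a * g' z b \<partial>lebesgue) = (\<integral>z. f' z b * g' z a \<partial>lebesgue)"
proof -
  have contf: "continuous_on UNIV f" and contg: "continuous_on UNIV g"
    using C1_deriv_imp_continuous f g by auto
  have contf': "continuous_on UNIV (\<lambda>z. f' z a)" and contg': "continuous_on UNIV (\<lambda>z. g' z a)"
    using C1_deriv_continuous f g by auto
  define \<Phi> where "\<Phi> s = (\<integral>z. f' z a * g (z + s *\<^sub>R b) \<partial>lebesgue)" for s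
  define \<Psi> where "\<Psi> s = (\<integral>z. g' z a * f (z + s *\<^sub>R b) \<partial>lebesgue)" for s
  have d1: "(\<Phi> has_real_derivative (\<integral>z. f' z a * g' z b \<partial>lebesgue)) (at 0)"
    using integral_translate_has_derivative[OF continuous_L1_loc[OF contf'] g(1), of b 0] g(2)
    by (simp add: \<Phi>_def[abs_def])
  have d2: "(\<Psi> has_real_derivative (\<integral>z. g' z a * f' z b \<partial>lebesgue)) (at (- 0))"
    using integral_translate_has_derivative[OF continuous_L1_loc[OF contg'] f, of b 0]
      contg' bounded_support_deriv[OF g] by (simp add: \<Psi>_def[abs_def])
  have eq: "\<Phi> s = - \<Psi> (- s)" for s
  proof -
    have "\<Phi> s = (\<integral>z. f' (z - s *\<^sub>R b) a * g z \<partial>lebesgue)"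
      unfolding \<Phi>_def
      by (intro integral_translate_swap continuous_on_UNIV_borel_lebesgue contf' contg)
    also have "\<dots> = - (\<integral>z. f (z - s *\<^sub>R b) * g' z a \<partial>lebesgue)"
      using integration_by_parts_C1[OF C1_deriv_translate[OF f, of "- s *\<^sub>R b"] g] by simp
    finally show ?thesis by (simp add: \<Psi>_def mult.commute)
  qed
  have "((\<lambda>s. - \<Psi> (- s)) has_real_derivative (\<integral>z. g' z a * f' z b \<partial>lebesgue)) (at 0)"
    using DERIV_minus[OF DERIV_chain2[OF d2 DERIV_minus[OF DERIV_ident]]] by simp
  moreover have "\<Phi> = (\<lambda>s. - \<Psi> (- s))" using eq by auto
  ultimately have "(\<Phi> has_real_derivative (\<integral>z. g' z a * f' z b \<partial>lebesgue)) (at 0)" by simp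
  with d1 show ?thesis using DERIV_unique by (simp add: mult.commute) blast
qed

text \<open>If a bounded piece of \<open>S\<close> had positive measure, its translates by the
  distinct vectors \<open>inverse (Suc k) *\<^sub>R e\<close> would be infinitely many disjoint sets
  of equal measure inside one ball.\<close>

lemma negligible_line_section_singleton:
  fixes S :: "'a::euclidean_space set"
  assumes S: "S \<in> sets lebesgue" and single: "\<And>z s. z \<in> S \<Longrightarrow> s \<noteq> 0 \<Longrightarrow> z + s *\<^sub>R e \<notin> S"
  shows "negligible S"
proof -
  have "negligible (S \<inter> cball 0 (real n))" for n
  proof -
    define A where "A = S \<inter> cball 0 (real n)"
    define T where "T k = (+) (inverse (real (Suc k)) *\<^sub>R e) ` A" for k
    have lA: "A \<in> lmeasurable" unfolding A_def
      by (rule bounded_set_imp_lmeasurable) (auto intro!: sets.Int S bounded_subset[OF bounded_cball])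
    have mT: "T k \<in> lmeasurable" "measure lebesgue (T k) = measure lebesgue A" for k
      by (simp_all add: T_def measurable_translation lA measure_translation)
    have disj: "disjoint_family_on T {..<N}" for N
      unfolding disjoint_family_on_def
    proof (intro ballI impI)
      fix j k assume "j \<noteq> (k::nat)"
      show "T j \<inter> T k = {}"
      proof (rule ccontr)
        assume "T j \<inter> T k \<noteq> {}"
        then obtain x y where xy: "x \<in> S" "y \<in> S"
          "inverse (real (Suc j)) *\<^sub>R e + x = inverse (real (Suc k)) *\<^sub>R e + y"
          by (auto simp: T_def A_def)
        then have "y = x + (inverse (real (Suc j)) - inverse (real (Suc k))) *\<^sub>R e"
          by (simp add: algebra_simps)
        moreover have "inverse (real (Suc j)) - inverse (real (Suc k)) \<noteq> 0"
          using \<open>j \<noteq> k\<close> by simp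
        ultimately show False using single xy by blast
      qed
    qed
    have sub: "T k \<subseteq> cball 0 (real n + norm e)" for k
    proof
      fix x assume "x \<in> T k"
      then obtain y where y: "x = inverse (real (Suc k)) *\<^sub>R e + y" "norm y \<le> real n"
        by (auto simp: T_def A_def)
      have "norm x \<le> norm (inverse (real (Suc k)) *\<^sub>R e) + norm y"
        unfolding y(1) by (rule norm_triangle_ineq)
      also have "norm (inverse (real (Suc k)) *\<^sub>R e) \<le> 1 * norm e"
        unfolding norm_scaleR by (intro mult_right_mono) (auto simp: inverse_le_1_iff)
      finally show "x \<in> cball 0 (real n + norm e)" using y by auto
    qed
    have "real N * measure lebesgue A \<le> measure lebesgue (cball (0::'a) (real n + norm e))" for N
    proof -
      have "real N * measure lebesgue A = (\<Sum>k<N. measure lebesgue (T k))" by (simp add: mT)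
      also have "\<dots> = measure lebesgue (\<Union>k<N. T k)"
        by (rule measure_finite_Union[symmetric])
          (use disj fmeasurableD[OF mT(1)] fmeasurableD2[OF mT(1)] in \<open>auto simp del:
              emeasure_completion\<close>)
      also have "\<dots> \<le> measure lebesgue (cball (0::'a) (real n + norm e))"
        by (rule measure_mono_fmeasurable) (use sub mT in \<open>auto intro!: fmeasurableD
            fmeasurable.finite_UN\<close>)
      finally show ?thesis .
    qed
    then have "\<not> 0 < measure lebesgue A"
      using reals_Archimedean3[of "measure lebesgue A"] by (auto simp: not_le[symmetric])
    then have "measure lebesgue A = 0" using measure_nonneg[of lebesgue A] by linarith
    then have "negligible A" using negligible_iff_measure0[OF lA] by simp
    then show ?thesis by (simp add: A_def)
  qed
  then have "negligible (\<Union>n. S \<inter> cball 0 (real n))"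
    unfolding negligible_iff_null_sets by (intro null_sets_UN) auto
  moreover have "S = (\<Union>n. S \<inter> cball 0 (real n))"
    using real_arch_simple by auto
  ultimately show ?thesis by metis
qed

text \<open>Meant for functions with an explicit remainder: \<open>pos_sq\<close>, and
  \<open>potential\<close>, whose remainder involves the non-differentiable
  \<open>B\<close>.\<close>

lemma DERIV_if_error_bound:
  fixes f :: "real \<Rightarrow> real"
  assumes bound: "\<And>y. \<bar>f y - f x - D * (y - x)\<bar> \<le> \<bar>y - x\<bar> * e y" and e: "(e \<longlongrightarrow> 0) (at x)"
  shows "(f has_real_derivative D) (at x)"
proof -
  have "((\<lambda>y. (f y - f x) / (y - x) - D) \<longlongrightarrow> 0) (at x)"
  proof (rule Lim_null_comparison[OF _ e])
    have "norm ((f y - f x) / (y - x) - D) \<le> e y" if "y \<noteq> x" for y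
    proof -
      have "(f y - f x) / (y - x) - D = (f y - f x - D * (y - x)) / (y - x)"
        using that by (simp add: field_simps)
      then show ?thesis using bound[of y] that by (simp add: pos_divide_le_eq mult.commute)
    qed
    then show "\<forall>\<^sub>F y in at x. norm ((f y - f x) / (y - x) - D) \<le> e y"
      by (auto simp: eventually_at_filter)
  qed
  then show ?thesis unfolding has_field_derivative_iff by (rule LIM_zero_cancel)
qed

text \<open>Squaring makes the positive part C^1 while it stays positive exactly on the positive
  half-line. Bumps and slab weights are built from it, since the test fields of
  \<open>BV_loc\<close> are merely C^1.\<close>

definition pos_sq :: "real \<Rightarrow> real" where "pos_sq y = (max 0 y)\<^sup>2"

lemma pos_sq_pos_iff: "0 < pos_sq y \<longleftrightarrow> 0 < y"
  by (auto simp: pos_sq_def max_def)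

lemma pos_sq_nonneg: "0 \<le> pos_sq y"
  by (simp add: pos_sq_def)

lemma DERIV_pos_sq: "(pos_sq has_real_derivative 2 * max 0 x) (at x)"
proof (rule DERIV_if_error_bound[where e="\<lambda>y. \<bar>y - x\<bar>"])
  show "((\<lambda>y. \<bar>y - x\<bar>) \<longlongrightarrow> 0) (at x)"
    by (auto intro!: tendsto_eq_intros)
  show "\<bar>pos_sq y - pos_sq x - 2 * max 0 x * (y - x)\<bar> \<le> \<bar>y - x\<bar> * \<bar>y - x\<bar>" for y
  proof -
    have "0 \<le> pos_sq y - pos_sq x - 2 * max 0 x * (y - x)
        \<and> pos_sq y - pos_sq x - 2 * max 0 x * (y - x) \<le> (y - x) * (y - x)"
    proof (cases "0 \<le> x"; cases "0 \<le> y")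
      assume "0 \<le> x" "0 \<le> y"
      then show ?thesis using zero_le_square[of "y - x"]
        by (simp add: pos_sq_def power2_eq_square algebra_simps)
    next
      assume "0 \<le> x" "\<not> 0 \<le> y"
      then have "x * y \<le> 0" by (simp add: mult_nonneg_nonpos)
      moreover have "pos_sq y - pos_sq x - 2 * max 0 x * (y - x) = x * x - 2 * (x * y)"
        using \<open>0 \<le> x\<close> \<open>\<not> 0 \<le> y\<close> by (simp add: pos_sq_def power2_eq_square algebra_simps)
      moreover have "(y - x) * (y - x) = x * x - 2 * (x * y) + y * y" by (simp add: algebra_simps)
      ultimately show ?thesis using zero_le_square[of x] zero_le_square[of y] by linarith
    next
      assume "\<not> 0 \<le> x" "0 \<le> y"
      then have "x * y \<le> 0" by (simp add: mult_nonpos_nonneg)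
      moreover have "pos_sq y - pos_sq x - 2 * max 0 x * (y - x) = y * y"
        using \<open>\<not> 0 \<le> x\<close> \<open>0 \<le> y\<close> by (simp add: pos_sq_def power2_eq_square)
      moreover have "(y - x) * (y - x) = x * x - 2 * (x * y) + y * y" by (simp add: algebra_simps)
      ultimately show ?thesis using zero_le_square[of x] zero_le_square[of y] by linarith
    next
      assume "\<not> 0 \<le> x" "\<not> 0 \<le> y"
      then show ?thesis using zero_le_square[of "y - x"] by (simp add: pos_sq_def)
    qed
    then show ?thesis by (simp add: abs_mult_self_eq)
  qed
qed

lemma continuous_on_max_zero: "continuous_on S (\<lambda>x::real. 2 * max 0 x)"
  by (intro continuous_intros)

text \<open>A \<open>C\<^sup>1\<close> positive extension of \<open>1 + t\<close> to negative times.\<close>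

definition time_shift :: "real \<Rightarrow> real" where "time_shift t = 1 + t + pos_sq (- t)"
definition time_shift' :: "real \<Rightarrow> real" where "time_shift' t = 1 - 2 * max 0 (- t)"

lemma time_shift_nonneg_arg: "0 \<le> t \<Longrightarrow> time_shift t = 1 + t"
  by (simp add: time_shift_def pos_sq_def)

lemma time_shift'_nonneg_arg: "0 \<le> t \<Longrightarrow> time_shift' t = 1"
  by (simp add: time_shift'_def)

lemma time_shift_pos: "0 < time_shift t"
proof (cases "0 \<le> t")
  case False
  have "0 < 1 + t + t * t"
    using zero_le_square[of "t + 1/2"] by (simp add: algebra_simps)
  then show ?thesis using False by (simp add: time_shift_def pos_sq_def power2_eq_square)
qed (simp add: time_shift_nonneg_arg)

lemma DERIV_time_shift: "(time_shift has_real_derivative time_shift' t) (at t)"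
  unfolding time_shift_def[abs_def] time_shift'_def
  by (auto intro!: derivative_eq_intros DERIV_chain2[OF DERIV_pos_sq])

lemma continuous_on_time_shift': "continuous_on S time_shift'"
  unfolding time_shift'_def[abs_def] by (intro continuous_intros)

section \<open>Fluxes that behave like an even power\<close>

text \<open>The model is \<open>y ^ (p + 1)\<close> with p odd, and \<open>h\<close> is its
  derivative. The lower bound makes the inverse of \<open>h\<close> Hoelder with exponent 1/p; the
  upper bound, which degenerates at 0 for p > 1, makes that exponent sharp there.\<close>

locale power_like_flux =
  fixes g h :: "real \<Rightarrow> real" and r a A :: real and p :: nat
  assumes r: "r > 0" and a: "a > 0" and p: "p > 0"
    and g_deriv: "\<And>y. (g has_real_derivative h y) (at y)"
    and h_cont: "continuous_on {-r..r} h"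
    and h_0: "h 0 = 0" and g_0: "g 0 = 0"
    and h_lower: "\<And>x y. -r \<le> x \<Longrightarrow> x \<le> y \<Longrightarrow> y \<le> r \<Longrightarrow> a * (y - x) ^ p \<le> h y - h x"
    and h_upper: "\<And>x y. -r \<le> x \<Longrightarrow> x \<le> y \<Longrightarrow> y \<le> r \<Longrightarrow>
      h y - h x \<le> A * (max \<bar>x\<bar> \<bar>y\<bar>) ^ (p - 1) * (y - x)"
begin

text \<open>Speeds outside the range of \<open>h\<close> on \<open>{-r..r}\<close> are clipped, so
  that the inverse \<open>B\<close> is total and a fan continues by the constant states
  \<open>- r\<close> and \<open>r\<close>; this keeps the solution bounded.\<close>

definition clip :: "real \<Rightarrow> real" where "clip \<xi> = max (h (- r)) (min (h r) \<xi>)"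
definition B :: "real \<Rightarrow> real" where "B \<xi> = (THE y. y \<in> {-r..r} \<and> h y = clip \<xi>)"

lemma h_strict_mono:
  assumes "-r \<le> x" "x < y" "y \<le> r" shows "h x < h y"
proof -
  have "0 < a * (y - x) ^ p" using a assms by simp
  then show ?thesis using h_lower[of x y] assms by linarith
qed

lemma h_mono: "-r \<le> x \<Longrightarrow> x \<le> y \<Longrightarrow> y \<le> r \<Longrightarrow> h x \<le> h y"
  using h_strict_mono[of x y] by (cases "x = y") auto

lemma h_minus_r_neg: "h (- r) < 0" and h_r_pos: "0 < h r"
  using h_strict_mono[of "-r" 0] h_strict_mono[of 0 r] r h_0 by auto

lemma clip_mem: "clip \<xi> \<in> {h (- r)..h r}"
  using h_minus_r_neg h_r_pos by (auto simp: clip_def)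

lemma clip_mono: "\<xi> \<le> \<xi>' \<Longrightarrow> clip \<xi> \<le> clip \<xi>'"
  by (auto simp: clip_def)

lemma clip_diff_le: "\<xi> \<le> \<xi>' \<Longrightarrow> clip \<xi>' - clip \<xi> \<le> \<xi>' - \<xi>"
  by (auto simp: clip_def max_def min_def)

lemma clip_eq: "h (- r) \<le> \<xi> \<Longrightarrow> \<xi> \<le> h r \<Longrightarrow> clip \<xi> = \<xi>"
  by (auto simp: clip_def)

lemma continuous_on_clip: "continuous_on S clip"
  unfolding clip_def[abs_def] by (intro continuous_intros)

lemma B_mem_and_h_B: "B \<xi> \<in> {-r..r} \<and> h (B \<xi>) = clip \<xi>"
  unfolding B_def
proof (rule theI')
  have "\<exists>y\<ge>-r. y \<le> r \<and> h y = clip \<xi>"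
    using clip_mem[of \<xi>] r by (intro IVT' h_cont) auto
  moreover have "x = y" if "x \<in> {-r..r}" "y \<in> {-r..r}" "h x = h y" for x y
    using that h_strict_mono[of x y] h_strict_mono[of y x] by (cases x y rule: linorder_cases) auto
  ultimately show "\<exists>!y. y \<in> {-r..r} \<and> h y = clip \<xi>" by (metis atLeastAtMost_iff)
qed

lemma B_mem: "B \<xi> \<in> {-r..r}" and h_B: "h (B \<xi>) = clip \<xi>"
  using B_mem_and_h_B by auto

lemma B_bounds: "-r \<le> B \<xi>" "B \<xi> \<le> r" "\<bar>B \<xi>\<bar> \<le> r"
  using B_mem[of \<xi>] by auto

lemma B_mono: "\<xi> \<le> \<xi>' \<Longrightarrow> B \<xi> \<le> B \<xi>'"
  using h_strict_mono[of "B \<xi>'" "B \<xi>"] B_bounds h_B[of \<xi>] h_B[of \<xi>'] clip_mono[of \<xi> \<xi>']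
  by (metis linorder_not_le)

lemma B_clip: "B (clip \<xi>) = B \<xi>"
proof -
  have "clip (clip \<xi>) = clip \<xi>" using clip_mem[of \<xi>] by (intro clip_eq) auto
  then show ?thesis by (simp add: B_def)
qed

text \<open>This is \<open>h_lower\<close> read backwards at \<open>B \<xi>\<close> and
  \<open>B \<xi>'\<close>, combined with the fact that \<open>clip\<close> does not increase
  distances.\<close>

lemma B_hoelder: "\<bar>B \<xi> - B \<xi>'\<bar> \<le> (1 / a) powr (1 / p) * \<bar>\<xi> - \<xi>'\<bar> powr (1 / p)"
proof -
  have *: "\<bar>B \<xi>' - B \<xi>\<bar> \<le> (1 / a) powr (1 / p) * \<bar>\<xi> - \<xi>'\<bar> powr (1 / p)" if "\<xi> \<le> \<xi>'" for \<xi> \<xi>'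
  proof (cases "B \<xi>' = B \<xi>")
    case False
    then have lt: "B \<xi> < B \<xi>'" using B_mono[OF that] by auto
    have "a * (B \<xi>' - B \<xi>) ^ p \<le> h (B \<xi>') - h (B \<xi>)"
      using lt by (intro h_lower B_bounds) auto
    also have "\<dots> \<le> \<xi>' - \<xi>" using clip_diff_le[OF that] by (simp add: h_B)
    finally have "(B \<xi>' - B \<xi>) ^ p \<le> 1 / a * (\<xi>' - \<xi>)" using a by (simp add: field_simps)
    then have "((B \<xi>' - B \<xi>) ^ p) powr (1 / p) \<le> (1 / a * (\<xi>' - \<xi>)) powr (1 / p)"
      using lt by (intro powr_mono2) auto
    moreover have "((B \<xi>' - B \<xi>) ^ p) powr (1 / p) = B \<xi>' - B \<xi>"
      using lt p by (simp add: powr_realpow[symmetric] powr_powr)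
    moreover have "(1 / a * (\<xi>' - \<xi>)) powr (1 / p) = (1 / a) powr (1 / p) * (\<xi>' - \<xi>) powr (1 / p)"
      by (rule powr_mult)
    moreover have "\<bar>B \<xi>' - B \<xi>\<bar> = B \<xi>' - B \<xi>" "\<bar>\<xi> - \<xi>'\<bar> = \<xi>' - \<xi>" using lt that by auto
    ultimately show ?thesis by (simp only:)
  qed auto
  show ?thesis
    using *[of \<xi> \<xi>'] *[of \<xi>' \<xi>] by (cases "\<xi> \<le> \<xi>'") (auto simp: abs_minus_commute)
qed

lemma continuous_on_B: "continuous_on S B"
proof -
  have "isCont B \<xi>" for \<xi>
  proof -
    have "((\<lambda>x. B x - B \<xi>) \<longlongrightarrow> 0) (at \<xi>)"
    proof (rule Lim_null_comparison)
      show "\<forall>\<^sub>F x in at \<xi>. norm (B x - B \<xi>) \<le> (1 / a) powr (1 / p) * \<bar>x - \<xi>\<bar> powr (1 / p)"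
        using B_hoelder by (intro always_eventually) auto
      show "((\<lambda>x. (1 / a) powr (1 / p) * \<bar>x - \<xi>\<bar> powr (1 / p)) \<longlongrightarrow> 0) (at \<xi>)"
        using p by (auto intro!: tendsto_eq_intros)
    qed
    then show ?thesis unfolding isCont_def by (rule LIM_zero_cancel)
  qed
  then show ?thesis by (simp add: continuous_at_imp_continuous_on)
qed

lemma B_0: "B 0 = 0"
proof -
  have c: "clip 0 = 0" using h_minus_r_neg h_r_pos by (intro clip_eq) auto
  show ?thesis
    using h_strict_mono[of 0 "B 0"] h_strict_mono[of "B 0" 0] B_bounds[of 0] h_B[of 0] c h_0 r
    by (cases "B 0" "0::real" rule: linorder_cases) auto
qed

lemma B_pos: "0 < \<xi> \<Longrightarrow> 0 < B \<xi>" and B_neg: "\<xi> < 0 \<Longrightarrow> B \<xi> < 0"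
proof -
  have *: "clip \<xi> = 0 \<Longrightarrow> \<xi> = 0" for \<xi>
    using h_minus_r_neg h_r_pos by (auto simp: clip_def max_def min_def split: if_splits)
  have **: "B \<xi> = 0 \<Longrightarrow> \<xi> = 0" for \<xi> using *[of \<xi>] h_B[of \<xi>] h_0 by auto
  show "0 < \<xi> \<Longrightarrow> 0 < B \<xi>" using B_mono[of 0 \<xi>] B_0 **[of \<xi>] by force
  show "\<xi> < 0 \<Longrightarrow> B \<xi> < 0" using B_mono[of \<xi> 0] B_0 **[of \<xi>] by force
qed

text \<open>For \<open>\<eta>\<close> and \<open>q\<close> of class \<open>C\<^sup>1\<close> this is equivalent to \<open>\<bar>\<eta>'\<bar> \<le> 1\<close> and \<open>q' = \<eta>' g'\<close> on \<open>[-r, r]\<close>.\<close>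

definition entropy_pair :: "(real \<Rightarrow> real) \<Rightarrow> (real \<Rightarrow> real) \<Rightarrow> bool" where
  "entropy_pair \<eta> q \<longleftrightarrow> continuous_on UNIV \<eta> \<and> continuous_on UNIV q \<and>
     (\<forall>\<xi> D x y. -r \<le> x \<longrightarrow> x \<le> y \<longrightarrow> y \<le> r \<longrightarrow> (\<forall>m\<in>{x..y}. \<bar>\<xi> - h m\<bar> \<le> D) \<longrightarrow>
        \<bar>\<xi> * (\<eta> y - \<eta> x) - (q y - q x)\<bar> \<le> D * (y - x))"

definition kruzhkov_flux :: "real \<Rightarrow> real \<Rightarrow> real" where
  "kruzhkov_flux k u = sgn (u - k) * (g u - g k)"

lemma g_mvt_bound:
  assumes "x \<le> y" "\<forall>m\<in>{x..y}. \<bar>\<xi> - h m\<bar> \<le> D"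
  shows "\<bar>\<xi> * (y - x) - (g y - g x)\<bar> \<le> D * (y - x)"
proof (cases "x = y")
  case False
  then obtain m where m: "x < m" "m < y" "g y - g x = (y - x) * h m"
    using MVT2[of x y g h] g_deriv assms(1) by auto
  have "\<xi> * (y - x) - (g y - g x) = (\<xi> - h m) * (y - x)" using m(3) by (simp add: algebra_simps)
  moreover have "\<bar>\<xi> - h m\<bar> \<le> D" using assms(2) m by auto
  ultimately show ?thesis using assms(1) by (simp add: abs_mult mult_right_mono)
qed auto

lemma continuous_on_g: "continuous_on S g"
  by (meson g_deriv DERIV_isCont continuous_at_imp_continuous_on)

lemma entropy_pair_id: "entropy_pair (\<lambda>u. u) g"
  unfolding entropy_pair_def using g_mvt_bound continuous_on_g by (auto intro: continuous_intros)

lemma continuous_on_kruzhkov_flux: "continuous_on UNIV (kruzhkov_flux k)"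
proof -
  \<comment> \<open>Without the sign function, continuity at \<open>k\<close> becomes
    visible.\<close>
  have eq: "kruzhkov_flux k = (\<lambda>u. g (max u k) - g (min u k))"
    by (auto simp: kruzhkov_flux_def fun_eq_iff max_def min_def sgn_if)
  show ?thesis unfolding eq
    by (intro continuous_intros continuous_on_compose2[OF continuous_on_g[of UNIV]]) auto
qed

text \<open>The entropy has a corner at \<open>k\<close>, which is why pairs are defined through
  increments: an interval around \<open>k\<close> is split there, and on each half the pair agrees
  with that of \<open>entropy_pair_id\<close> up to sign and constants.\<close>

lemma entropy_pair_kruzhkov: "entropy_pair (\<lambda>u. \<bar>u - k\<bar>) (kruzhkov_flux k)"
  unfolding entropy_pair_def
proof (intro conjI allI impI)
  fix \<xi> D x y :: real
  assume xy: "-r \<le> x" "x \<le> y" "y \<le> r" and D: "\<forall>m\<in>{x..y}. \<bar>\<xi> - h m\<bar> \<le> D"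
  consider "k \<le> x" | "y \<le> k" | "x < k" "k < y" by linarith
  then show "\<bar>\<xi> * (\<bar>y - k\<bar> - \<bar>x - k\<bar>) - (kruzhkov_flux k y - kruzhkov_flux k x)\<bar> \<le> D * (y - x)"
  proof cases
    case 1
    then have "\<xi> * (\<bar>y - k\<bar> - \<bar>x - k\<bar>) - (kruzhkov_flux k y - kruzhkov_flux k x)
        = \<xi> * (y - x) - (g y - g x)"
      using xy by (auto simp: kruzhkov_flux_def sgn_if algebra_simps)
    then show ?thesis using g_mvt_bound[OF xy(2) D] by simp
  next
    case 2
    then have "\<xi> * (\<bar>y - k\<bar> - \<bar>x - k\<bar>) - (kruzhkov_flux k y - kruzhkov_flux k x)
        = - (\<xi> * (y - x) - (g y - g x))"
      using xy by (auto simp: kruzhkov_flux_def sgn_if algebra_simps)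
    then show ?thesis using g_mvt_bound[OF xy(2) D] by simp
  next
    case 3
    have "\<xi> * (\<bar>y - k\<bar> - \<bar>x - k\<bar>) - (kruzhkov_flux k y - kruzhkov_flux k x)
        = (\<xi> * (y - k) - (g y - g k)) - (\<xi> * (k - x) - (g k - g x))"
      using 3 by (simp add: kruzhkov_flux_def sgn_if algebra_simps)
    moreover have "\<bar>\<xi> * (y - k) - (g y - g k)\<bar> \<le> D * (y - k)"
      "\<bar>\<xi> * (k - x) - (g k - g x)\<bar> \<le> D * (k - x)"
      using 3 D by (intro g_mvt_bound; simp)+
    ultimately have "\<bar>\<xi> * (\<bar>y - k\<bar> - \<bar>x - k\<bar>) - (kruzhkov_flux k y - kruzhkov_flux k x)\<bar> \<le> D * (y
        - k) + D * (k - x)"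
      by linarith
    then show ?thesis by (simp add: algebra_simps)
  qed
qed (auto intro!: continuous_intros continuous_on_kruzhkov_flux)

text \<open>For the pair of \<open>entropy_pair_id\<close> this is the Legendre transform of
  \<open>g\<close> restricted to \<open>{-r..r}\<close>; for a general pair it is a primitive of the
  composition of \<open>\<eta>\<close> with \<open>B\<close>.\<close>

definition potential :: "(real \<Rightarrow> real) \<Rightarrow> (real \<Rightarrow> real) \<Rightarrow> real \<Rightarrow> real" where
  "potential \<eta> q \<xi> = \<xi> * \<eta> (B \<xi>) - q (B \<xi>)"

text \<open>Strictness excludes \<open>h r < \<xi>\<close> and \<open>\<xi>' < h (- r)\<close>, so
  clipping can only raise \<open>\<xi>\<close> and only lower \<open>\<xi>'\<close>.\<close>

lemma between_clips:
  assumes "B \<xi> < B \<xi>'" "m \<in> {B \<xi>..B \<xi>'}"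
  shows "\<xi> \<le> h m \<and> h m \<le> \<xi>'"
proof -
  have "h (B \<xi>) \<le> h m" "h m \<le> h (B \<xi>')"
    using assms B_bounds(1)[of \<xi>] B_bounds(2)[of \<xi>'] by (intro h_mono; simp)+
  moreover have "h (B \<xi>) < h (B \<xi>')" by (intro h_strict_mono B_bounds assms)
  ultimately show ?thesis
    by (auto simp: h_B clip_def max_def min_def split: if_splits)
qed

text \<open>Formally q' = h \<eta>' and h(B(\<xi>)) = \<xi>, so the contributions of the increment
  of \<open>B\<close> cancel to first order. The remainder is the product of the increments of \<xi>
  and of \<open>B\<close>, for which continuity of \<open>B\<close> suffices.\<close>

lemma DERIV_potential:
  assumes "entropy_pair \<eta> q"
  shows "(potential \<eta> q has_real_derivative \<eta> (B \<xi>)) (at \<xi>)"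
proof (rule DERIV_if_error_bound[where e="\<lambda>\<xi>'. \<bar>B \<xi>' - B \<xi>\<bar>"])
  have "(B \<longlongrightarrow> B \<xi>) (at \<xi>)"
    using continuous_on_B[of UNIV] by (simp add: continuous_on_eq_continuous_at isCont_def)
  then show "((\<lambda>\<xi>'. \<bar>B \<xi>' - B \<xi>\<bar>) \<longlongrightarrow> 0) (at \<xi>)" by (auto intro!: tendsto_eq_intros)
  fix \<xi>'
  have eq: "potential \<eta> q \<xi>' - potential \<eta> q \<xi> - \<eta> (B \<xi>) * (\<xi>' - \<xi>)
      = \<xi>' * (\<eta> (B \<xi>') - \<eta> (B \<xi>)) - (q (B \<xi>') - q (B \<xi>))"
    by (simp add: potential_def algebra_simps)
  have pair: "\<bar>c * (\<eta> y - \<eta> x) - (q y - q x)\<bar> \<le> D * (y - x)"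
    if "-r \<le> x" "x \<le> y" "y \<le> r" "\<forall>m\<in>{x..y}. \<bar>c - h m\<bar> \<le> D" for c D x y
    using assms that unfolding entropy_pair_def by blast
  consider "B \<xi> = B \<xi>'" | "B \<xi> < B \<xi>'" | "B \<xi>' < B \<xi>" by linarith
  then show "\<bar>potential \<eta> q \<xi>' - potential \<eta> q \<xi> - \<eta> (B \<xi>) * (\<xi>' - \<xi>)\<bar> \<le> \<bar>\<xi>' - \<xi>\<bar> * \<bar>B \<xi>' - B \<xi>\<bar>"
  proof cases
    case 1
    then show ?thesis unfolding eq by simp
  next
    case 2
    have "\<forall>m\<in>{B \<xi>..B \<xi>'}. \<bar>\<xi>' - h m\<bar> \<le> \<bar>\<xi>' - \<xi>\<bar>"
      using between_clips[OF 2] by force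
    from pair[OF B_bounds(1) _ B_bounds(2) this] 2 show ?thesis unfolding eq by simp
  next
    case 3
    have "\<forall>m\<in>{B \<xi>'..B \<xi>}. \<bar>\<xi>' - h m\<bar> \<le> \<bar>\<xi>' - \<xi>\<bar>"
      using between_clips[OF 3] by force
    from pair[OF B_bounds(1) _ B_bounds(2) this] 3
    have "\<bar>\<xi>' * (\<eta> (B \<xi>) - \<eta> (B \<xi>')) - (q (B \<xi>) - q (B \<xi>'))\<bar> \<le> \<bar>\<xi>' - \<xi>\<bar> * \<bar>B \<xi>' - B \<xi>\<bar>" by simp
    then show ?thesis unfolding eq by (simp add: abs_le_iff algebra_simps)
  qed
qed

lemma convex_on_g: "convex_on {-r..r} g"
  by (rule convex_on_realI[where f'=h]) (use g_deriv h_mono in auto)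

text \<open>The entropy condition for a shock between the states \<open>x\<close> and
  \<open>y\<close>, multiplied by \<open>x - y\<close> to become symmetric in them. There is
  equality unless \<open>k\<close> lies strictly between the states; in that case it says that
  \<open>g k\<close> lies below the chord.\<close>

lemma kruzhkov_pair_dissipation:
  assumes "x \<in> {-r..r}" "y \<in> {-r..r}"
  shows "(\<bar>x - k\<bar> - \<bar>y - k\<bar>) * (g x - g y) \<le> (kruzhkov_flux k x - kruzhkov_flux k y) * (x - y)"
proof -
  have *: "(\<bar>x - k\<bar> - \<bar>y - k\<bar>) * (g x - g y) \<le> (kruzhkov_flux k x - kruzhkov_flux k y) * (x - y)"
    if "x \<in> {-r..r}" "y \<in> {-r..r}" "y \<le> x" for x y
  proof -
    consider "k \<le> y" | "x \<le> k" | "y < k" "k < x" by linarith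
    then show ?thesis
    proof cases
      case 1
      then show ?thesis using that
        by (auto simp: kruzhkov_flux_def sgn_if algebra_simps)
    next
      case 2
      then show ?thesis using that
        by (auto simp: kruzhkov_flux_def sgn_if algebra_simps)
    next
      case 3
      define t where "t = (k - y) / (x - y)"
      have tk: "t * (x - y) = k - y" using 3 by (simp add: t_def)
      have "(1 - t) * y + t * x = y + t * (x - y)" by (simp add: algebra_simps)
      then have t: "0 \<le> t" "t \<le> 1" "(1 - t) * y + t * x = k"
        using 3 tk by (auto simp: t_def)
      have "g ((1 - t) *\<^sub>R y + t *\<^sub>R x) \<le> (1 - t) * g y + t * g x"
        by (rule convex_onD[OF convex_on_g]) (use t that in auto)
      then have "g k \<le> (1 - t) * g y + t * g x" using t(3) by simp
      then have "g k * (x - y) \<le> ((1 - t) * g y + t * g x) * (x - y)"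
        using that by (intro mult_right_mono) auto
      also have "\<dots> = g y * (x - y) + (t * (x - y)) * (g x - g y)" by (simp add: algebra_simps)
      also have "\<dots> = (x - k) * g y + (k - y) * g x"
        unfolding tk by (simp add: algebra_simps)
      finally show ?thesis using 3 by (simp add: kruzhkov_flux_def sgn_if algebra_simps)
    qed
  qed
  show ?thesis using *[of x y] *[of y x] assms by (cases "y \<le> x") (auto simp: algebra_simps)
qed

end

section \<open>A train of rarefaction fans\<close>

lemma C1_deriv_cong:
  assumes "C1_deriv f f'" "\<And>z. f z = g z" "\<And>z h. f' z h = g' z h"
  shows "C1_deriv g g'"
proof -
  have "f = g" "f' = g'" using assms(2,3) by (simp_all add: fun_eq_iff)
  then show ?thesis using assms(1) by simp
qed

text \<open>Both sides are twice the covariance of \<open>a\<close> and \<open>b\<close> under the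
  weights \<open>p\<close>. The form with pairs is the one in which fans can be compared two at a
  time.\<close>

lemma sum_weighted_differences:
  fixes p a b :: "'i \<Rightarrow> real"
  assumes "(\<Sum>i\<in>I. p i) = 1"
  shows "(\<Sum>i\<in>I. \<Sum>j\<in>I. p i * p j * ((a i - a j) * (b i - b j)))
    = 2 * (\<Sum>i\<in>I. p i * (a i * (b i - (\<Sum>j\<in>I. p j * b j))))"
proof -
  define m where "m = (\<Sum>j\<in>I. p j * b j)"
  have "p i * p j * ((a i - a j) * (b i - b j)) = (p i * a i * b i) * p j - (p i * a i) * (p j * b j)
      - (p i * b i) * (p j * a j) + p i * (p j * a j * b j)" for i j
    by (simp add: algebra_simps)
  then have "(\<Sum>i\<in>I. \<Sum>j\<in>I. p i * p j * ((a i - a j) * (b i - b j)))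
    = (\<Sum>i\<in>I. p i * a i * b i) * (\<Sum>j\<in>I. p j) - (\<Sum>i\<in>I. p i * a i) * m
      - m * (\<Sum>i\<in>I. p i * a i) + (\<Sum>j\<in>I. p j) * (\<Sum>i\<in>I. p i * a i * b i)"
    by (simp add: sum.distrib sum_subtractf sum_product m_def)
  also have "\<dots> = 2 * ((\<Sum>i\<in>I. p i * a i * b i) - m * (\<Sum>i\<in>I. p i * a i))"
    using assms by (simp add: algebra_simps)
  also have "(\<Sum>i\<in>I. p i * a i * b i) - m * (\<Sum>i\<in>I. p i * a i) = (\<Sum>i\<in>I. p i * (a i * (b i - m)))"
    by (simp add: sum_distrib_left sum_subtractf[symmetric] algebra_simps)
  finally show ?thesis by (simp add: m_def)
qed

lemma weighted_dissipation:
  fixes p \<eta> q G y :: "'i \<Rightarrow> real"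
  assumes p: "(\<Sum>i\<in>I. p i) = 1" "\<And>i. i \<in> I \<Longrightarrow> 0 \<le> p i"
    and pair: "\<And>i j. i \<in> I \<Longrightarrow> j \<in> I \<Longrightarrow> (\<eta> i - \<eta> j) * (G i - G j) \<le> (q i - q j) * (y i - y j)"
  shows "(\<Sum>i\<in>I. p i * (\<eta> i * (G i - (\<Sum>j\<in>I. p j * G j)))) \<le> (\<Sum>i\<in>I. p i * (q i * (y i - (\<Sum>j\<in>I. p j *
      y j))))"
proof -
  have "(\<Sum>i\<in>I. \<Sum>j\<in>I. p i * p j * ((\<eta> i - \<eta> j) * (G i - G j)))
      \<le> (\<Sum>i\<in>I. \<Sum>j\<in>I. p i * p j * ((q i - q j) * (y i - y j)))"
    by (intro sum_mono mult_left_mono pair mult_nonneg_nonneg p)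
  then show ?thesis by (simp add: sum_weighted_differences[OF p(1)])
qed

text \<open>Multiplying numerator and denominator by the exponential of \<open>real i * V n\<close>
  turns the exponentials into i-th powers of numbers that are below 1 except for the index
  \<open>n\<close>.\<close>

lemma softmin_tendsto:
  fixes V F :: "'i \<Rightarrow> real"
  assumes I: "finite I" "n \<in> I" and min: "\<And>j. j \<in> I \<Longrightarrow> j \<noteq> n \<Longrightarrow> V n < V j"
  shows "(\<lambda>i. \<Sum>j\<in>I. exp (- real i * V j) / (\<Sum>l\<in>I. exp (- real i * V l)) * F j) \<longlonglongrightarrow> F n"
proof -
  have lim: "(\<lambda>i. exp (V n - V j) ^ i) \<longlonglongrightarrow> (if j = n then 1 else 0)" if "j \<in> I" for j
    using min[OF that] by (auto intro!: LIMSEQ_power_zero)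
  have "(\<lambda>i. (\<Sum>j\<in>I. exp (V n - V j) ^ i * F j) / (\<Sum>j\<in>I. exp (V n - V j) ^ i))
      \<longlonglongrightarrow> (\<Sum>j\<in>I. (if j = n then 1 else 0) * F j) / (\<Sum>j\<in>I. if j = n then 1 else 0)"
    using I by (intro tendsto_divide tendsto_sum tendsto_mult lim tendsto_const) auto
  moreover have "(\<Sum>j\<in>I. (if j = n then 1 else 0) * F j) / (\<Sum>j\<in>I. if j = n then 1 else 0) = F n"
    using I by (simp add: if_distrib[of "\<lambda>x. x * _"] cong: if_cong)
  moreover have "(\<Sum>j\<in>I. exp (V n - V j) ^ i * F j) / (\<Sum>j\<in>I. exp (V n - V j) ^ i)
     = (\<Sum>j\<in>I. exp (- real i * V j) / (\<Sum>l\<in>I. exp (- real i * V l)) * F j)" for i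
  proof -
    have e: "exp (V n - V j) ^ i = exp (real i * V n) * exp (- real i * V j)" for j
      by (simp add: exp_of_nat_mult[symmetric] exp_add[symmetric] algebra_simps)
    have "(\<Sum>j\<in>I. exp (V n - V j) ^ i * F j) / (\<Sum>j\<in>I. exp (V n - V j) ^ i)
      = (exp (real i * V n) * (\<Sum>j\<in>I. exp (- real i * V j) * F j)) / (exp (real i * V n) * (\<Sum>j\<in>I.
          exp (- real i * V j)))"
      by (simp only: e sum_distrib_left mult.assoc)
    also have "\<dots> = (\<Sum>j\<in>I. exp (- real i * V j) * F j) / (\<Sum>j\<in>I. exp (- real i * V j))" by simp
    finally show ?thesis by (simp add: sum_divide_distrib)
  qed
  ultimately show ?thesis by simp
qed

locale fan_train = power_like_flux +
  fixes w :: "'a::euclidean_space" and lam :: real and c :: "nat \<Rightarrow> real"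
  assumes norm_w: "norm w = 1" and c_mono: "\<And>n. c n < c (Suc n)" and c_lim: "c \<longlonglongrightarrow> 0"
begin

text \<open>For nonnegative times, \<open>phase\<close> is the position along \<open>w\<close> in
  the frame moving with velocity \<open>lam\<close>, \<open>sim n\<close> is the similarity variable
  of a fan issued from \<open>c n\<close> at time -1, and \<open>V n\<close> is the primitive of
  that fan, to be minimised over \<open>n\<close>.\<close>

definition phase :: "'a \<times> real \<Rightarrow> real" where "phase z = w \<bullet> fst z - lam * snd z"
definition T :: "'a \<times> real \<Rightarrow> real" where "T z = time_shift (snd z)"
definition sim :: "nat \<Rightarrow> 'a \<times> real \<Rightarrow> real" where "sim n z = (phase z - c n) / T z"
definition fan :: "nat \<Rightarrow> 'a \<times> real \<Rightarrow> real" where "fan n z = B (sim n z)"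
definition pot :: "(real \<Rightarrow> real) \<Rightarrow> (real \<Rightarrow> real) \<Rightarrow> nat \<Rightarrow> 'a \<times> real \<Rightarrow> real" where
  "pot \<eta> q n z = T z * potential \<eta> q (sim n z)"
definition V :: "nat \<Rightarrow> 'a \<times> real \<Rightarrow> real" where "V = pot (\<lambda>u. u) g"

text \<open>The directions \<open>\<partial>\<^sub>x\<close> and \<open>\<partial>\<^sub>t\<close> of the frame in which the fans are centred at fixed points.\<close>

definition ex :: "'a \<times> real" where "ex = (w, 0)"
definition et :: "'a \<times> real" where "et = (lam *\<^sub>R w, 1)"

lemma w_inner_w: "w \<bullet> w = 1"
  using norm_w by (simp add: norm_eq_1)

lemma frame [simp]: "phase ex = 1" "phase et = 0" "snd ex = 0" "snd et = 1"
  by (simp_all add: phase_def ex_def et_def w_inner_w)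

lemma T_pos: "0 < T z" by (simp add: T_def time_shift_pos)

lemma bounded_linear_phase: "bounded_linear phase"
  unfolding phase_def[abs_def]
  by (intro bounded_linear_sub bounded_linear_compose[OF bounded_linear_inner_right bounded_linear_fst]
      bounded_linear_compose[OF bounded_linear_mult_right bounded_linear_snd])

lemma phase_add: "phase (z + s *\<^sub>R v) = phase z + s * phase v"
  using linear_add[of phase] linear_scale[of phase] bounded_linear_phase
  by (simp add: bounded_linear.linear)

lemma T_add: "snd v = 0 \<Longrightarrow> T (z + s *\<^sub>R v) = T z"
  by (simp add: T_def)

lemma has_derivative_T: "(T has_derivative (\<lambda>h. time_shift' (snd z) * snd h)) (at z)"
  using has_derivative_compose[OF bounded_linear_imp_has_derivative[OF bounded_linear_snd]
      DERIV_time_shift[unfolded has_field_derivative_def], of z UNIV]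
  by (simp add: T_def[abs_def])

lemma continuous_on_T: "continuous_on S T"
  using has_derivative_T by (meson has_derivative_continuous continuous_at_imp_continuous_on)

lemma continuous_on_sim: "continuous_on S (sim n)"
proof -
  have "T z \<noteq> 0" for z using T_pos[of z] by simp
  then show ?thesis unfolding sim_def[abs_def]
    by (intro continuous_intros continuous_on_T linear_continuous_on bounded_linear_phase) auto
qed

lemma continuous_on_fan: "continuous_on S (fan n)"
  unfolding fan_def[abs_def]
  by (rule continuous_on_compose2[OF continuous_on_B[of UNIV] continuous_on_sim]) auto

lemma fan_mem: "fan n z \<in> {-r..r}"
  unfolding fan_def by (rule B_mem)

text \<open>For P depending on \<xi> = (x - c) / T, the T-derivative of T P(\<xi>) is P - \<xi> P',
  which for \<open>potential\<close> equals \<open>- q\<close>. Wherever \<open>time_shift'\<close>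
  is 1, a fan therefore transports every entropy without production.\<close>

lemma C1_pot:
  assumes e: "entropy_pair \<eta> q"
  shows "C1_deriv (pot \<eta> q n)
    (\<lambda>z h. phase h * \<eta> (fan n z) - time_shift' (snd z) * snd h * q (fan n z))"
  unfolding C1_deriv_def
proof (intro conjI allI)
  fix z :: "'a \<times> real"
  have T0: "T z \<noteq> 0" using T_pos[of z] by simp
  have dphase: "((\<lambda>z. phase z - c n) has_derivative phase) (at z)"
    using has_derivative_diff[OF bounded_linear_imp_has_derivative[OF bounded_linear_phase, of "at
        z"] has_derivative_const[of "c n"]]
    by simp
  have "(sim n has_derivative (\<lambda>h. (phase h * T z - (phase z - c n) * (time_shift' (snd z) * snd
      h)) / (T z * T z))) (at z)"
    unfolding sim_def[abs_def] by (rule has_derivative_divide'[OF dphase has_derivative_T T0])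
  from has_derivative_compose[OF this DERIV_potential[OF e, of "sim n z", unfolded
      has_field_derivative_def]]
  have "((\<lambda>z. potential \<eta> q (sim n z)) has_derivative
     (\<lambda>h. \<eta> (fan n z) * ((phase h * T z - (phase z - c n) * (time_shift' (snd z) * snd h)) / (T z
         * T z)))) (at z)"
    by (simp add: fan_def)
  from has_derivative_mult[OF has_derivative_T this]
  have "(pot \<eta> q n has_derivative (\<lambda>h. T z * (\<eta> (fan n z) * ((phase h * T z - (phase z - c n) *
      (time_shift' (snd z) * snd h)) / (T z * T z)))
     + time_shift' (snd z) * snd h * potential \<eta> q (sim n z))) (at z)"
    by (simp add: pot_def[abs_def])
  moreover have "T z * (\<eta> (fan n z) * ((phase h * T z - (phase z - c n) * (time_shift' (snd z) *
      snd h)) / (T z * T z)))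
     + time_shift' (snd z) * snd h * potential \<eta> q (sim n z)
     = phase h * \<eta> (fan n z) - time_shift' (snd z) * snd h * q (fan n z)" for h
  proof -
    have "phase z - c n = sim n z * T z" using T0 by (simp add: sim_def)
    then show ?thesis using T0 by (simp add: potential_def fan_def field_simps)
  qed
  ultimately show "(pot \<eta> q n has_derivative
      (\<lambda>h. phase h * \<eta> (fan n z) - time_shift' (snd z) * snd h * q (fan n z))) (at z)"
    by simp
next
  fix h :: "'a \<times> real"
  have "continuous_on UNIV \<eta>" "continuous_on UNIV q" using e by (auto simp: entropy_pair_def)
  then have "continuous_on UNIV (\<lambda>z. \<eta> (fan n z))" "continuous_on UNIV (\<lambda>z. q (fan n z))"
    by (auto intro: continuous_on_compose2[OF _ continuous_on_fan])
  moreover have "continuous_on UNIV (\<lambda>z::'a \<times> real. time_shift' (snd z))"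
    by (rule continuous_on_compose2[OF continuous_on_time_shift'[of UNIV]]) (auto intro:
        continuous_intros)
  ultimately show "continuous_on UNIV (\<lambda>z. phase h * \<eta> (fan n z) - time_shift' (snd z) * snd h * q
      (fan n z))"
    by (intro continuous_intros)
qed

lemma C1_V: "C1_deriv (V n) (\<lambda>z h. phase h * fan n z - time_shift' (snd z) * snd h * g (fan n z))"
  unfolding V_def by (rule C1_pot[OF entropy_pair_id])

section \<open>The softened minimum and its entropy production\<close>

definition Z :: "real \<Rightarrow> nat \<Rightarrow> 'a \<times> real \<Rightarrow> real" where
  "Z \<beta> N z = (\<Sum>j\<le>N. exp (- \<beta> * V j z))"
definition wgt :: "real \<Rightarrow> nat \<Rightarrow> nat \<Rightarrow> 'a \<times> real \<Rightarrow> real" where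
  "wgt \<beta> N n z = exp (- \<beta> * V n z) / Z \<beta> N z"
text \<open>The derivative of a Gibbs weight: its logarithmic derivative is \<open>- \<beta>\<close>
  times the deviation of the derivative of \<open>V n\<close> from the weighted mean. These
  deviations are the origin of the covariances.\<close>

definition wgt' :: "real \<Rightarrow> nat \<Rightarrow> nat \<Rightarrow> 'a \<times> real \<Rightarrow> 'a \<times> real \<Rightarrow> real" where
  "wgt' \<beta> N n z v = - \<beta> * wgt \<beta> N n z *
     ((phase v * fan n z - time_shift' (snd z) * snd v * g (fan n z))
      - (\<Sum>j\<le>N. wgt \<beta> N j z * (phase v * fan j z - time_shift' (snd z) * snd v * g (fan j z))))"

lemma Z_pos: "0 < Z \<beta> N z"
  unfolding Z_def by (rule sum_pos) auto

lemma wgt_nonneg: "0 \<le> wgt \<beta> N n z"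
  using Z_pos[of \<beta> N z] by (simp add: wgt_def)

lemma sum_wgt: "(\<Sum>n\<le>N. wgt \<beta> N n z) = 1"
  using Z_pos[of \<beta> N z] by (simp add: wgt_def Z_def sum_divide_distrib[symmetric])

lemma C1_wgt: "C1_deriv (wgt \<beta> N n) (wgt' \<beta> N n)"
proof -
  define D where "D = (\<lambda>j z v. phase v * fan j z - time_shift' (snd z) * snd v * g (fan j z))"
  have e: "C1_deriv (\<lambda>z. exp (- \<beta> * V j z)) (\<lambda>z h. (- \<beta> * exp (- \<beta> * V j z)) * D j z h)" for j
    unfolding D_def
    by (rule C1_deriv_compose_real[OF C1_V, where k="\<lambda>x. exp (- \<beta> * x)" and k'="\<lambda>x. - \<beta> * exp (- \<beta>
        * x)"])
      (auto intro!: derivative_eq_intros continuous_intros)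
  have z: "C1_deriv (Z \<beta> N) (\<lambda>z h. \<Sum>j\<le>N. (- \<beta> * exp (- \<beta> * V j z)) * D j z h)"
    unfolding Z_def[abs_def] by (rule C1_deriv_sum[OF e])
  have Z0: "Z \<beta> N z \<noteq> 0" for z using Z_pos[of \<beta> N z] by simp
  have zi: "C1_deriv (\<lambda>z. inverse (Z \<beta> N z))
      (\<lambda>z h. - (inverse (Z \<beta> N z) * inverse (Z \<beta> N z)) * (\<Sum>j\<le>N. (- \<beta> * exp (- \<beta> * V j z)) * D j z h))"
    by (rule C1_deriv_compose_real[OF z, where k=inverse and k'="\<lambda>x. - (inverse x * inverse x)"])
      (use Z0 in \<open>auto intro!: derivative_eq_intros continuous_intros\<close>)
  show ?thesis
  proof (rule C1_deriv_cong[OF C1_deriv_mult[OF e[of n] zi]])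
    show "exp (- \<beta> * V n z) * inverse (Z \<beta> N z) = wgt \<beta> N n z" for z
      by (simp add: wgt_def field_simps)
    fix z h :: "'a \<times> real"
    have "(\<Sum>j\<le>N. - \<beta> * exp (- \<beta> * V j z) * D j z h) = (- \<beta> * Z \<beta> N z) * (\<Sum>j\<le>N. wgt \<beta> N j z * D j z h)"
      using Z0[of z] by (simp add: sum_distrib_left wgt_def mult.assoc)
    moreover have "exp (- \<beta> * V n z) = Z \<beta> N z * wgt \<beta> N n z" using Z0[of z] by (simp add: wgt_def)
    ultimately show "exp (- \<beta> * V n z) * (- (inverse (Z \<beta> N z) * inverse (Z \<beta> N z)) *
        (\<Sum>j\<le>N. - \<beta> * exp (- \<beta> * V j z) * D j z h)) +
       - \<beta> * exp (- \<beta> * V n z) * D n z h * inverse (Z \<beta> N z) = wgt' \<beta> N n z h"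
      using Z0[of z] unfolding wgt'_def D_def
      by (simp add: field_simps)
  qed
qed

text \<open>The n-th fan is tested with \<open>wgt \<beta> N n z * \<phi> z\<close>, for which
  entropy and flux integrals cancel by symmetry of mixed derivatives. The terms in which weights are
  differentiated add up to \<open>\<beta>\<close> times the covariance of entropy and
  \<open>g\<close> minus that of entropy flux and state, and this is never positive.\<close>

lemma softmin_kruzhkov:
  assumes phi: "C1_deriv \<phi> \<phi>'" "bounded_support \<phi>" "\<And>z. 0 \<le> \<phi> z"
    and past: "\<And>z h. snd z \<le> 0 \<Longrightarrow> \<phi> z = 0 \<and> \<phi>' z h = 0" and \<beta>: "0 \<le> \<beta>"
  shows "0 \<le> (\<integral>z. (\<Sum>n\<le>N. wgt \<beta> N n z *
     (\<bar>fan n z - k\<bar> * \<phi>' z et + kruzhkov_flux k (fan n z) * \<phi>' z ex)) \<partial>lebesgue)"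
proof -
  define \<eta> where "\<eta> n z = \<bar>fan n z - k\<bar>" for n z
  define q where "q n z = kruzhkov_flux k (fan n z)" for n z
  have ce: "continuous_on UNIV (\<eta> n)" "continuous_on UNIV (q n)" for n
    unfolding \<eta>_def[abs_def] q_def[abs_def]
    by (auto intro!: continuous_intros continuous_on_fan
        continuous_on_compose2[OF continuous_on_kruzhkov_flux continuous_on_fan])
  define G where "G n z h = wgt \<beta> N n z * \<phi>' z h + wgt' \<beta> N n z h * \<phi> z" for n z h
  have G: "C1_deriv (\<lambda>z. wgt \<beta> N n z * \<phi> z) (G n)" "bounded_support (\<lambda>z. wgt \<beta> N n z * \<phi> z)" for n
    unfolding G_def[abs_def] by (intro C1_deriv_mult C1_wgt phi bounded_support_mult)+
  have intG: "integrable lebesgue (\<lambda>z. f z * G n z h)" if "continuous_on UNIV f" for f n h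
    by (intro integrable_L1_loc_mult_continuous continuous_L1_loc that C1_deriv_continuous[OF G(1)]
        bounded_support_deriv[OF G])
  have zero: "(\<integral>z. \<eta> n z * G n z et + q n z * G n z ex \<partial>lebesgue) = 0" for n
  proof -
    have "(\<integral>z. \<eta> n z * G n z et \<partial>lebesgue) = (\<integral>z. - (q n z * G n z ex) \<partial>lebesgue)"
    proof -
      \<comment> \<open>Where the test function is alive, time is positive and
        \<open>time_shift'\<close> equals 1.\<close>
      have "G n z ex = 0" if "snd z \<le> 0" for z using past[OF that] by (simp add: G_def)
      then have "- time_shift' (snd z) * q n z * G n z ex = - (q n z * G n z ex)" for z
        by (cases "snd z \<le> 0") (auto simp: time_shift'_nonneg_arg)
      note * = this
      have "(\<integral>z. \<eta> n z * G n z et \<partial>lebesgue) = (\<integral>z. - time_shift' (snd z) * q n z * G n z ex \<partial>lebesgue)"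
        using integral_mixed_derivatives_swap[OF C1_pot[OF entropy_pair_kruzhkov[of k], of n] G,
            of ex n et]
        by (simp add: \<eta>_def q_def)
      then show ?thesis by (simp only: *)
    qed
    then show ?thesis using intG[OF ce(1)] intG[OF ce(2)] by simp
  qed
  define X where "X z = (\<Sum>n\<le>N. \<eta> n z * G n z et + q n z * G n z ex)" for z
  define Y where "Y z = (\<Sum>n\<le>N. wgt \<beta> N n z * (\<eta> n z * \<phi>' z et + q n z * \<phi>' z ex))" for z
  have intX: "integrable lebesgue X" unfolding X_def[abs_def] using intG ce by auto
  have int0: "(\<integral>z. X z \<partial>lebesgue) = 0"
    unfolding X_def using zero intG ce by (subst Bochner_Integration.integral_sum) auto
  have intY: "integrable lebesgue Y"
  proof -
    have "integrable lebesgue (\<lambda>z. (wgt \<beta> N n z * f z) * \<phi>' z h)" if "continuous_on UNIV f" for f n h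
      by (intro integrable_L1_loc_mult_continuous continuous_L1_loc continuous_on_mult that
          C1_deriv_imp_continuous[OF C1_wgt] C1_deriv_continuous[OF phi(1)]
              bounded_support_deriv[OF phi(1,2)])
    from this[OF ce(1)] this[OF ce(2)] show ?thesis
      unfolding Y_def[abs_def] by (auto simp: distrib_left mult.assoc)
  qed
  have XY: "X z \<le> Y z" for z
  proof -
    have "X z = Y z + (\<Sum>n\<le>N. \<eta> n z * wgt' \<beta> N n z et + q n z * wgt' \<beta> N n z ex) * \<phi> z"
      unfolding X_def Y_def G_def sum_distrib_right sum.distrib[symmetric]
      by (intro sum.cong) (simp_all add: algebra_simps)
    moreover have "(\<Sum>n\<le>N. \<eta> n z * wgt' \<beta> N n z et + q n z * wgt' \<beta> N n z ex) \<le> 0" if "0 < snd z"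
    proof -
      have "(\<Sum>n\<le>N. \<eta> n z * wgt' \<beta> N n z et + q n z * wgt' \<beta> N n z ex)
        = \<beta> * ((\<Sum>n\<le>N. wgt \<beta> N n z * (\<eta> n z * (g (fan n z) - (\<Sum>j\<le>N. wgt \<beta> N j z * g (fan j z)))))
           - (\<Sum>n\<le>N. wgt \<beta> N n z * (q n z * (fan n z - (\<Sum>j\<le>N. wgt \<beta> N j z * fan j z)))))"
        using that
        by (simp add: wgt'_def time_shift'_nonneg_arg sum_distrib_left sum_subtractf[symmetric]
            sum_negf algebra_simps)
      moreover have "(\<Sum>n\<le>N. wgt \<beta> N n z * (\<eta> n z * (g (fan n z) - (\<Sum>j\<le>N. wgt \<beta> N j z * g (fan j z)))))
           \<le> (\<Sum>n\<le>N. wgt \<beta> N n z * (q n z * (fan n z - (\<Sum>j\<le>N. wgt \<beta> N j z * fan j z))))"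
        unfolding \<eta>_def q_def
        by (rule weighted_dissipation[OF sum_wgt wgt_nonneg kruzhkov_pair_dissipation[OF fan_mem
            fan_mem]])
      ultimately show ?thesis using \<beta> by (simp add: mult_nonneg_nonpos)
    qed
    ultimately show ?thesis
      using past[of z] phi(3)[of z] by (cases "0 < snd z") (auto simp: mult_nonpos_nonneg)
  qed
  have "0 \<le> (\<integral>z. Y z \<partial>lebesgue)"
    using integral_mono[OF intX intY XY] int0 by simp
  then show ?thesis by (simp add: Y_def \<eta>_def q_def)
qed

end

section \<open>Position of the shocks between the centres\<close>

context fan_train
begin

lemma V_eq: "V n z = T z * potential (\<lambda>u. u) g (sim n z)"
  by (simp add: V_def pot_def)

lemma continuous_on_potential: "continuous_on S (potential (\<lambda>u. u) g)"
  using DERIV_isCont[OF DERIV_potential[OF entropy_pair_id]] by (intro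
      continuous_at_imp_continuous_on) blast

lemma potential_strict_inc:
  assumes "0 \<le> \<xi>" "\<xi> < \<xi>'"
  shows "potential (\<lambda>u. u) g \<xi> < potential (\<lambda>u. u) g \<xi>'"
proof (rule DERIV_pos_imp_increasing_open[OF assms(2) _ continuous_on_potential])
  show "\<exists>y. (potential (\<lambda>u. u) g has_real_derivative y) (at x) \<and> 0 < y" if "\<xi> < x" for x
    using DERIV_potential[OF entropy_pair_id, of x] B_pos[of x] assms(1) that by auto
qed

lemma potential_strict_dec:
  assumes "\<xi>' \<le> 0" "\<xi> < \<xi>'"
  shows "potential (\<lambda>u. u) g \<xi>' < potential (\<lambda>u. u) g \<xi>"
proof (rule DERIV_neg_imp_decreasing_open[OF assms(2) _ continuous_on_potential])
  show "\<exists>y. (potential (\<lambda>u. u) g has_real_derivative y) (at x) \<and> y < 0" if "x < \<xi>'" for x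
    using DERIV_potential[OF entropy_pair_id, of x] B_neg[of x] assms(1) that by auto
qed

text \<open>Only neighbouring primitives are compared; that this locates the minimum over all
  indices rests on \<open>left_of_shock_Suc\<close>.\<close>

definition left_of_shock :: "nat \<Rightarrow> 'a \<times> real \<Rightarrow> bool" where
  "left_of_shock j z \<longleftrightarrow> V j z \<le> V (Suc j) z"

lemma V_less_left:
  assumes "phase z \<le> c j" shows "V j z < V (Suc j) z"
proof -
  have "sim j z \<le> 0" using assms T_pos[of z] by (simp add: sim_def divide_nonpos_pos)
  moreover have "sim (Suc j) z < sim j z"
    using c_mono[of j] T_pos[of z] by (simp add: sim_def divide_strict_right_mono)
  ultimately show ?thesis using potential_strict_dec T_pos[of z] by (simp add: V_eq)
qed

lemma V_less_right:
  assumes "c (Suc j) \<le> phase z" shows "V (Suc j) z < V j z"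
proof -
  have "0 \<le> sim (Suc j) z" using assms T_pos[of z] by (simp add: sim_def)
  moreover have "sim (Suc j) z < sim j z"
    using c_mono[of j] T_pos[of z] by (simp add: sim_def divide_strict_right_mono)
  ultimately show ?thesis using potential_strict_inc T_pos[of z] by (simp add: V_eq)
qed

text \<open>In the gap the similarity variable of the left fan runs upwards from 0 and that of the
  right fan upwards to 0, along opposite monotone branches of the potential. Hence a shock meets the
  gap in at most one phase per time.\<close>

lemma V_strict_between:
  assumes "c j \<le> phase z" "phase z < phase z'" "phase z' \<le> c (Suc j)" "T z = T z'"
  shows "V j z < V j z'" "V (Suc j) z' < V (Suc j) z"
proof -
  have "0 \<le> sim j z" "sim j z < sim j z'" "sim (Suc j) z' \<le> 0" "sim (Suc j) z < sim (Suc j) z'"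
    using assms T_pos[of z'] by (auto simp: sim_def divide_strict_right_mono divide_nonpos_pos)
  then show "V j z < V j z'" "V (Suc j) z' < V (Suc j) z"
    using potential_strict_inc[of "sim j z" "sim j z'"] potential_strict_dec[of "sim (Suc j) z'"
        "sim (Suc j) z"]
      T_pos[of z'] assms(4) by (auto simp: V_eq)
qed

lemma left_of_shock_if: "phase z \<le> c j \<Longrightarrow> left_of_shock j z"
  using V_less_left[of z j] by (simp add: left_of_shock_def)

lemma left_of_shock_imp: "left_of_shock j z \<Longrightarrow> phase z < c (Suc j)"
  using V_less_right[of j z] by (auto simp: left_of_shock_def not_less[symmetric])

text \<open>The centre \<open>c (Suc j)\<close> separates consecutive shocks. So the predicate is
  monotone in \<open>j\<close>, and off the shocks the minimising index is the first one at which it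
  holds.\<close>

lemma left_of_shock_Suc: "left_of_shock j z \<Longrightarrow> left_of_shock (Suc j) z"
  using left_of_shock_imp left_of_shock_if by (meson less_imp_le)

lemma left_of_shock_mono: "left_of_shock j z \<Longrightarrow> j \<le> k \<Longrightarrow> left_of_shock k z"
  by (induction k rule: nat_induct) (auto simp: le_Suc_eq left_of_shock_Suc)

lemma left_of_shock_downward:
  assumes "left_of_shock j z'" "phase z \<le> phase z'" "T z = T z'"
  shows "left_of_shock j z"
proof (cases "phase z \<le> c j \<or> phase z = phase z'")
  case True
  then show ?thesis
  proof
    assume "phase z = phase z'"
    then show ?thesis using assms by (simp add: left_of_shock_def V_eq sim_def)
  qed (rule left_of_shock_if)
next
  case False
  then show ?thesis
    using V_strict_between[of j z z'] left_of_shock_imp[OF assms(1)] assms by (auto simp: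
        left_of_shock_def)
qed

definition shock :: "nat \<Rightarrow> ('a \<times> real) set" where "shock j = {z. V j z = V (Suc j) z}"

lemma continuous_on_V: "continuous_on S (V n)"
  using C1_deriv_imp_continuous[OF C1_V] continuous_on_subset by blast

lemma closed_shock: "closed (shock j)"
  unfolding shock_def by (intro closed_Collect_eq continuous_on_V)

lemma shock_unique:
  assumes "z \<in> shock j" "z' \<in> shock j" "T z = T z'" shows "phase z = phase z'"
proof -
  have *: False if "z \<in> shock j" "z' \<in> shock j" "T z = T z'" "phase z < phase z'" for z z'
    using that V_less_left[of z j] V_less_right[of j z'] V_strict_between[of j z z']
    by (cases "c j \<le> phase z"; cases "phase z' \<le> c (Suc j)") (auto simp: shock_def)
  show ?thesis using *[of z z'] *[of z' z] assms by (cases "phase z" "phase z'" rule: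
      linorder_cases) auto
qed

lemma negligible_shock: "negligible (shock j)"
proof (rule negligible_line_section_singleton[where e=ex])
  show "shock j \<in> sets lebesgue" using closed_shock by auto
  fix z s assume "z \<in> shock j" "s \<noteq> (0::real)"
  then show "z + s *\<^sub>R ex \<notin> shock j"
    using shock_unique[of z j "z + s *\<^sub>R ex"] by (auto simp: phase_add T_add)
qed

text \<open>The centre of the active fan is a telescoping sum over the shocks already passed. In
  this form measurability, monotonicity and limits are obtained term by term, with the summable gaps
  as majorant.\<close>

definition step :: "nat \<Rightarrow> 'a \<times> real \<Rightarrow> real" where
  "step j z = (if left_of_shock j z then 0 else c (Suc j) - c j)"
definition centre_upto :: "nat \<Rightarrow> 'a \<times> real \<Rightarrow> real" where
  "centre_upto N z = c 0 + (\<Sum>j<N. step j z)"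

text \<open>The centre of the fan which contains \<open>z\<close>; it is \<open>0 = lim c\<close> to the right of all shocks.\<close>

definition centre :: "'a \<times> real \<Rightarrow> real" where
  "centre z = c 0 + (\<Sum>j. step j z)"
definition train_upto :: "nat \<Rightarrow> 'a \<times> real \<Rightarrow> real" where
  "train_upto N z = B ((phase z - centre_upto N z) / T z)"
definition train :: "'a \<times> real \<Rightarrow> real" where
  "train z = B ((phase z - centre z) / T z)"

lemma step_bounds: "0 \<le> step j z" "step j z \<le> c (Suc j) - c j"
  using c_mono[of j] by (auto simp: step_def)

lemma summable_gaps: "summable (\<lambda>j. c (Suc j) - c j)"
  by (rule telescope_summable[OF c_lim])

lemma summable_step: "summable (\<lambda>j. step j z)"
  by (rule summable_comparison_test'[OF summable_gaps, of 0]) (use step_bounds in auto)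

lemma centre_upto_tendsto: "(\<lambda>N. centre_upto N z) \<longlonglongrightarrow> centre z"
  unfolding centre_upto_def centre_def by (intro tendsto_add tendsto_const summable_LIMSEQ
      summable_step)

lemma train_upto_tendsto: "(\<lambda>N. train_upto N z) \<longlonglongrightarrow> train z"
proof -
  have "isCont B x" for x using continuous_on_B[of UNIV] by (simp add: continuous_on_eq_continuous_at)
  then show ?thesis
    unfolding train_upto_def train_def using T_pos[of z]
    by (intro isCont_tendsto_compose[of _ B] tendsto_divide tendsto_diff tendsto_const
        centre_upto_tendsto) auto
qed

lemma centre_eq_if:
  assumes "\<And>j. j < n \<Longrightarrow> \<not> left_of_shock j z" "\<And>j. n \<le> j \<Longrightarrow> j < N \<Longrightarrow> left_of_shock j z" "n \<le> N"
  shows "centre_upto N z = c n"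
proof -
  have "(\<Sum>j<N. step j z) = (\<Sum>j<n. step j z)"
    using assms by (intro sum.mono_neutral_right) (auto simp: step_def)
  also have "\<dots> = (\<Sum>j<n. c (Suc j) - c j)" using assms by (intro sum.cong) (auto simp: step_def)
  also have "\<dots> = c n - c 0" by (rule sum_lessThan_telescope)
  finally show ?thesis by (simp add: centre_upto_def)
qed

lemma argmin_V:
  assumes "\<And>j. z \<notin> shock j"
  obtains n where "n \<le> N" "centre_upto N z = c n" "\<And>j. j \<le> N \<Longrightarrow> j \<noteq> n \<Longrightarrow> V n z < V j z"
proof -
  \<comment> \<open>The alternative \<open>n = N\<close> covers points to the right of the first
    \<open>N\<close> shocks.\<close>
  define n where "n = (LEAST n. n = N \<or> left_of_shock n z)"
  have nP: "n = N \<or> left_of_shock n z" unfolding n_def by (rule LeastI[of _ N]) simp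
  have nN: "n \<le> N" unfolding n_def by (rule Least_le) simp
  have below: "\<not> left_of_shock j z" if "j < n" for j
    using not_less_Least[of j "\<lambda>n. n = N \<or> left_of_shock n z"] that by (simp add: n_def)
  have above: "left_of_shock j z" if "n \<le> j" "j < N" for j
    using nP left_of_shock_mono[of n z j] that by auto
  have "V n z < V j z" if "j < n" for j
    using that
  proof (induction rule: strict_inc_induct)
    case (base i)
    then show ?case using below[of i] by (auto simp: left_of_shock_def)
  next
    case (step i)
    then show ?case using below[of i] by (auto simp: left_of_shock_def)
  qed
  moreover have "j \<le> N \<Longrightarrow> n < j \<Longrightarrow> V n z < V j z" for j
  proof (induction j)
    case (Suc j)
    have "V j z < V (Suc j) z" using above[of j] Suc.prems assms[of j]
      by (auto simp: left_of_shock_def shock_def)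
    then show ?case using Suc by (cases "n = j") auto
  qed simp
  ultimately show ?thesis
    using that[OF nN centre_eq_if[OF below above nN]] by (metis nat_neq_iff)
qed

lemma closed_left_of_shock: "closed {z. left_of_shock j z}"
  unfolding left_of_shock_def by (intro closed_Collect_le continuous_on_V)

lemma borel_measurable_step [measurable]: "step j \<in> borel_measurable borel"
proof -
  have "{z. left_of_shock j z} \<in> sets borel" using closed_left_of_shock by (rule borel_closed)
  then show ?thesis unfolding step_def[abs_def] by (intro measurable_If) auto
qed

lemma borel_measurable_phase [measurable]: "phase \<in> borel_measurable borel"
  by (intro borel_measurable_continuous_onI linear_continuous_on bounded_linear_phase)

lemma borel_measurable_T [measurable]: "T \<in> borel_measurable borel"
  by (intro borel_measurable_continuous_onI continuous_on_T)

lemma borel_measurable_B [measurable]: "B \<in> borel_measurable borel"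
  by (intro borel_measurable_continuous_onI continuous_on_B)

lemma borel_measurable_train_upto: "train_upto N \<in> borel_measurable borel"
  unfolding train_upto_def[abs_def] centre_upto_def[abs_def] by measurable

lemma borel_measurable_centre [measurable]: "centre \<in> borel_measurable borel"
  unfolding centre_def[abs_def] by measurable

lemma borel_measurable_train: "train \<in> borel_measurable borel"
  unfolding train_def[abs_def] by measurable

lemma train_mem: "train z \<in> {-r..r}" "train_upto N z \<in> {-r..r}"
  unfolding train_def train_upto_def by (rule B_mem)+

lemma kruzhkov_bounds:
  obtains C where "C > 0" "\<And>u. u \<in> {-r..r} \<Longrightarrow> \<bar>\<bar>u - k\<bar>\<bar> \<le> C" "\<And>u. u \<in> {-r..r} \<Longrightarrow> \<bar>kruzhkov_flux k u\<bar> \<le> C"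
proof -
  have "bounded ((\<lambda>u. \<bar>u - k\<bar>) ` {-r..r} \<union> kruzhkov_flux k ` {-r..r})"
    unfolding bounded_Un
    by (intro conjI compact_imp_bounded compact_continuous_image continuous_intros
        continuous_on_subset[OF continuous_on_kruzhkov_flux]) auto
  then show ?thesis unfolding bounded_pos by (auto intro: that)
qed

section \<open>From the softened minimum to the train of fans\<close>

definition production ::
    "('a \<times> real \<Rightarrow> 'a \<times> real \<Rightarrow> real) \<Rightarrow> real \<Rightarrow> real \<Rightarrow> 'a \<times> real \<Rightarrow> real" where
  "production \<phi>' k u z = \<bar>u - k\<bar> * \<phi>' z et + kruzhkov_flux k u * \<phi>' z ex"

context
  fixes \<phi> :: "'a \<times> real \<Rightarrow> real" and \<phi>' and k :: real
  assumes phi: "C1_deriv \<phi> \<phi>'" "bounded_support \<phi>" "\<And>z. 0 \<le> \<phi> z"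
    and past: "\<And>z v. snd z \<le> 0 \<Longrightarrow> \<phi> z = 0 \<and> \<phi>' z v = 0"
begin

lemma borel_measurable_production:
  assumes "u \<in> borel_measurable borel"
  shows "(\<lambda>z. production \<phi>' k (u z) z) \<in> borel_measurable lebesgue"
proof -
  have [measurable]: "(\<lambda>z. \<phi>' z v) \<in> borel_measurable borel" for v
    by (intro borel_measurable_continuous_onI C1_deriv_continuous[OF phi(1)])
  have [measurable]: "kruzhkov_flux k \<in> borel_measurable borel"
    by (intro borel_measurable_continuous_onI continuous_on_kruzhkov_flux)
  note assms[measurable]
  have "(\<lambda>z. production \<phi>' k (u z) z) \<in> borel_measurable borel" unfolding production_def by measurable
  then show ?thesis by (intro measurable_completion) simp
qed

lemma production_dominated:
  obtains W where "integrable lebesgue W" "\<And>u z. u \<in> {-r..r} \<Longrightarrow> \<bar>production \<phi>' k u z\<bar> \<le> W z" "\<And>z. 0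
      \<le> W z"
proof -
  obtain C where C: "C > 0" "\<And>u. u \<in> {-r..r} \<Longrightarrow> \<bar>\<bar>u - k\<bar>\<bar> \<le> C" "\<And>u. u \<in> {-r..r} \<Longrightarrow> \<bar>kruzhkov_flux k
      u\<bar> \<le> C"
    by (rule kruzhkov_bounds[of k]) blast
  define W where "W z = C * \<bar>\<phi>' z et\<bar> + C * \<bar>\<phi>' z ex\<bar>" for z
  have "integrable lebesgue (\<lambda>z. 1 * \<phi>' z v)" for v
    by (intro integrable_L1_loc_mult_continuous continuous_L1_loc C1_deriv_continuous[OF phi(1)]
        bounded_support_deriv[OF phi(1,2)] continuous_intros)
  then have "integrable lebesgue W" unfolding W_def[abs_def] by simp
  moreover have "\<bar>production \<phi>' k u z\<bar> \<le> W z" if "u \<in> {-r..r}" for u z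
  proof -
    have "\<bar>production \<phi>' k u z\<bar> \<le> \<bar>\<bar>u - k\<bar>\<bar> * \<bar>\<phi>' z et\<bar> + \<bar>kruzhkov_flux k u\<bar> * \<bar>\<phi>' z ex\<bar>"
      unfolding production_def by (metis abs_triangle_ineq abs_mult)
    also have "\<dots> \<le> W z" unfolding W_def using C that by (intro add_mono mult_right_mono) auto
    finally show ?thesis .
  qed
  moreover have "0 \<le> W z" for z using C(1) by (simp add: W_def)
  ultimately show ?thesis by (rule that)
qed

text \<open>\<open>\<beta>\<close> tends to infinity through the integers: off the null set of
  shocks the weights concentrate on the minimising fan. As the weights sum to 1, a bound valid for
  every single state dominates all \<open>Y i\<close>.\<close>

lemma kruzhkov_train_upto: "0 \<le> (\<integral>z. production \<phi>' k (train_upto N z) z \<partial>lebesgue)"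
proof -
  obtain W where W: "integrable lebesgue W" "\<And>u z. u \<in> {-r..r} \<Longrightarrow> \<bar>production \<phi>' k u z\<bar> \<le> W z" "\<And>z.
      0 \<le> W z"
    by (rule production_dominated) blast
  define Y where "Y i z = (\<Sum>n\<le>N. wgt (real i) N n z * production \<phi>' k (fan n z) z)" for i :: nat and z
  have "(\<lambda>i. \<integral>z. Y i z \<partial>lebesgue) \<longlonglongrightarrow> (\<integral>z. production \<phi>' k (train_upto N z) z \<partial>lebesgue)"
  proof (rule integral_dominated_convergence[OF _ _ W(1)])
    show "(\<lambda>z. production \<phi>' k (train_upto N z) z) \<in> borel_measurable lebesgue"
      by (rule borel_measurable_production[OF borel_measurable_train_upto])
    show "Y i \<in> borel_measurable lebesgue" for i
      unfolding Y_def[abs_def]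
      by (intro borel_measurable_sum borel_measurable_times borel_measurable_production
          borel_measurable_continuous_onI continuous_on_fan continuous_on_UNIV_borel_lebesgue
          C1_deriv_imp_continuous[OF C1_wgt])
    show "AE z in lebesgue. (\<lambda>i. Y i z) \<longlonglongrightarrow> production \<phi>' k (train_upto N z) z"
    proof (rule AE_I'[where N="\<Union>j. shock j"])
      show "(\<Union>j. shock j) \<in> null_sets lebesgue"
        using negligible_shock by (intro null_sets_UN) (simp add: negligible_iff_null_sets)
      show "{z \<in> space lebesgue. \<not> (\<lambda>i. Y i z) \<longlonglongrightarrow> production \<phi>' k (train_upto N z) z} \<subseteq> (\<Union>j. shock j)"
      proof (clarify, rule ccontr)
        fix x t assume n: "\<not> (\<lambda>i. Y i (x, t)) \<longlonglongrightarrow> production \<phi>' k (train_upto N (x, t)) (x, t)"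
          and "(x, t) \<notin> (\<Union>j. shock j)"
        then have ns: "(x, t) \<notin> shock j" for j by auto
        obtain n where n': "n \<le> N" "centre_upto N (x, t) = c n"
          "\<And>j. j \<le> N \<Longrightarrow> j \<noteq> n \<Longrightarrow> V n (x, t) < V j (x, t)"
          using argmin_V[OF ns, where N=N] by metis
        have "(\<lambda>i. Y i (x, t)) \<longlonglongrightarrow> production \<phi>' k (fan n (x, t)) (x, t)"
          unfolding Y_def wgt_def Z_def by (rule softmin_tendsto) (use n' in auto)
        moreover have "train_upto N (x, t) = fan n (x, t)"
          by (simp add: train_upto_def fan_def sim_def n'(2))
        ultimately show False using n by simp
      qed
    qed
    show "AE z in lebesgue. norm (Y i z) \<le> W z" for i
    proof (intro AE_I2)
      fix z
      have "norm (Y i z) \<le> (\<Sum>n\<le>N. \<bar>wgt (real i) N n z * production \<phi>' k (fan n z) z\<bar>)"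
        unfolding Y_def real_norm_def by (rule sum_abs)
      also have "\<dots> \<le> (\<Sum>n\<le>N. wgt (real i) N n z * W z)"
        unfolding abs_mult abs_of_nonneg[OF wgt_nonneg]
        by (intro sum_mono mult_left_mono wgt_nonneg W(2) fan_mem)
      also have "\<dots> = W z" by (simp add: sum_distrib_right[symmetric] sum_wgt)
      finally show "norm (Y i z) \<le> W z" .
    qed
  qed
  moreover have "0 \<le> (\<integral>z. Y i z \<partial>lebesgue)" for i
    unfolding Y_def production_def by (rule softmin_kruzhkov[OF phi past]) auto
  ultimately show ?thesis by (meson LIMSEQ_le_const)
qed

lemma kruzhkov_train: "0 \<le> (\<integral>z. production \<phi>' k (train z) z \<partial>lebesgue)"
proof -
  obtain W where W: "integrable lebesgue W" "\<And>u z. u \<in> {-r..r} \<Longrightarrow> \<bar>production \<phi>' k u z\<bar> \<le> W z" "\<And>z.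
      0 \<le> W z"
    by (rule production_dominated) blast
  have "(\<lambda>N. \<integral>z. production \<phi>' k (train_upto N z) z \<partial>lebesgue) \<longlonglongrightarrow> (\<integral>z. production \<phi>' k (train z) z
      \<partial>lebesgue)"
  proof (rule integral_dominated_convergence[OF _ _ W(1)])
    show "(\<lambda>z. production \<phi>' k (train z) z) \<in> borel_measurable lebesgue"
      by (rule borel_measurable_production[OF borel_measurable_train])
    show "(\<lambda>z. production \<phi>' k (train_upto N z) z) \<in> borel_measurable lebesgue" for N
      by (rule borel_measurable_production[OF borel_measurable_train_upto])
    show "AE z in lebesgue. (\<lambda>N. production \<phi>' k (train_upto N z) z) \<longlonglongrightarrow> production \<phi>' k (train z) z"
    proof (intro AE_I2)
      fix z
      have "isCont (kruzhkov_flux k) u" for u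
        using continuous_on_kruzhkov_flux by (simp add: continuous_on_eq_continuous_at)
      then show "(\<lambda>N. production \<phi>' k (train_upto N z) z) \<longlonglongrightarrow> production \<phi>' k (train z) z"
        unfolding production_def
        by (intro tendsto_intros train_upto_tendsto isCont_tendsto_compose[of _ "kruzhkov_flux k"])
    qed
    show "AE z in lebesgue. norm (production \<phi>' k (train_upto N z) z) \<le> W z" for N
      using W(2)[OF train_mem(2)] by (intro AE_I2) simp
  qed
  then show ?thesis using kruzhkov_train_upto by (meson LIMSEQ_le_const)
qed

end

end

section \<open>The planar entropy solution\<close>

text \<open>The flux of plane waves around the state \<open>ubar\<close>, seen from the frame moving
  with \<open>lam\<close>. Subtracting \<open>lam * y\<close> makes the characteristic speed of the
  base state 0, in accordance with \<open>h_0\<close>.\<close>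

locale planar_train = fan_train g h r a A p w lam c
  for g h r a A p and w :: "'a::euclidean_space" and lam c +
  fixes F :: "real \<Rightarrow> 'a" and ubar :: real
  assumes F_cont: "continuous_on UNIV F"
    and g_eq: "\<And>y. g y = w \<bullet> (F (ubar + y) - F ubar) - lam * y"
begin

definition U :: "'a \<Rightarrow> real \<Rightarrow> real" where "U X t = ubar + train (X, t)"

lemma train_cong:
  assumes "phase z = phase z'" "T z = T z'" shows "train z = train z'"
proof -
  have "left_of_shock j z = left_of_shock j z'" for j
    using assms by (simp add: left_of_shock_def V_eq sim_def)
  then have "step j z = step j z'" for j by (simp add: step_def)
  then show ?thesis using assms by (simp add: train_def centre_def)
qed

lemma train_abs_le: "\<bar>train z\<bar> \<le> r"
  using train_mem(1)[of z] by auto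

lemma U_bounded: "\<bar>U X t\<bar> \<le> \<bar>ubar\<bar> + r"
  using train_abs_le[of "(X, t)"] by (simp add: U_def)

text \<open>Off the shocks each jump is locally constant, but not uniformly in \<open>j\<close>,
  because the centres accumulate at 0. Tannery's theorem with the gaps as majorant exchanges the
  limit with the series.\<close>

lemma train_tendsto:
  assumes z: "\<And>j. z \<notin> shock j" and X: "X \<longlonglongrightarrow> z"
  shows "(\<lambda>i. train (X i)) \<longlonglongrightarrow> train z"
proof -
  have V: "(\<lambda>i. V j (X i)) \<longlonglongrightarrow> V j z" for j
  proof -
    have "isCont (V j) z"
      using continuous_on_V[of UNIV j] by (cases z) (simp add: continuous_on_eq_continuous_at)
    then show ?thesis by (rule isCont_tendsto_compose[OF _ X])
  qed
  have step: "(\<lambda>i. step j (X i)) \<longlonglongrightarrow> step j z" for j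
  proof (rule tendsto_eventually)
    show "\<forall>\<^sub>F i in sequentially. step j (X i) = step j z"
    proof (cases "left_of_shock j z")
      case True
      then have "V j z < V (Suc j) z" using z[of j] by (auto simp: left_of_shock_def shock_def)
      from order_tendstoD(2)[OF tendsto_diff[OF V[of j] V[of "Suc j"]], of 0] this
      have "\<forall>\<^sub>F i in sequentially. V j (X i) - V (Suc j) (X i) < 0" by simp
      then show ?thesis by eventually_elim (use True in \<open>auto simp: step_def left_of_shock_def\<close>)
    next
      case False
      then have "V (Suc j) z < V j z" by (auto simp: left_of_shock_def)
      from order_tendstoD(1)[OF tendsto_diff[OF V[of j] V[of "Suc j"]], of 0] this
      have "\<forall>\<^sub>F i in sequentially. 0 < V j (X i) - V (Suc j) (X i)" by simp
      then show ?thesis by eventually_elim (use False in \<open>auto simp: step_def left_of_shock_def\<close>)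
    qed
  qed
  have "(\<lambda>i. \<Sum>j. step j (X i)) \<longlonglongrightarrow> (\<Sum>j. step j z)"
    by (rule conjunct2[OF conjunct2[OF tannerys_theorem[OF step _ summable_gaps]]])
      (use step_bounds in \<open>auto intro!: always_eventually\<close>)
  then have c: "(\<lambda>i. centre (X i)) \<longlonglongrightarrow> centre z"
    unfolding centre_def by (intro tendsto_intros)
  have "isCont phase z" "isCont T z" "isCont B x" for x
    using linear_continuous_on[OF bounded_linear_phase, of UNIV] continuous_on_T[of UNIV]
        continuous_on_B[of UNIV]
    by (cases z; simp add: continuous_on_eq_continuous_at)+
  then show ?thesis
    unfolding train_def using T_pos[of z]
    by (intro isCont_tendsto_compose[of _ B] tendsto_divide tendsto_diff c
        isCont_tendsto_compose[OF _ X]) auto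
qed

lemma borel_measurable_train_time: "(\<lambda>X. train (X, t)) \<in> borel_measurable borel"
proof -
  have "(\<lambda>X::'a. (X, t)) \<in> borel_measurable borel"
    by (intro borel_measurable_continuous_onI continuous_intros)
  from measurable_compose[OF this borel_measurable_train] show ?thesis .
qed

lemma borel_measurable_U: "(\<lambda>X. U X t) \<in> borel_measurable lebesgue"
proof -
  have "(\<lambda>X. U X t) \<in> borel_measurable borel"
    unfolding U_def by (intro borel_measurable_add borel_measurable_const borel_measurable_train_time)
  then show ?thesis by (intro measurable_completion) simp
qed

text \<open>Dominated convergence along sequences of times. Only the shocks at the limiting time
  have to be avoided, and the slice of each is null because a line parallel to \<open>w\<close>
  meets it at most once.\<close>

lemma U_continuous_in_L1_loc: "continuous_in_L1_loc U"
  unfolding continuous_in_L1_loc_def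
proof (intro conjI allI impI)
  show "(\<lambda>X. U X t) \<in> L1_loc" for t
    by (rule L1_loc_bounded[OF borel_measurable_U]) (use U_bounded in blast)
  fix K :: "'a set" and t0 :: real
  assume K: "compact K"
  show "((\<lambda>t. LINT X:K|lebesgue. \<bar>U X t - U X t0\<bar>) \<longlongrightarrow> 0) (at t0 within {0..})"
    unfolding tendsto_at_iff_sequentially comp_def
  proof (intro allI impI)
    fix x assume x: "x \<longlonglongrightarrow> t0"
    have Kl: "K \<in> sets lebesgue" by (intro sets_completionI_sets) (simp add: borel_compact K)
    have "(\<lambda>i. \<integral>X. indicator K X *\<^sub>R \<bar>U X (x i) - U X t0\<bar> \<partial>lebesgue) \<longlonglongrightarrow> (\<integral>X. 0 \<partial>(lebesgue :: 'a
        measure))"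
    proof (rule integral_dominated_convergence[where w="\<lambda>X. indicator K X *\<^sub>R (2 * r)"])
      have "integrable lborel (\<lambda>X. indicator K X *\<^sub>R (2 * r))" using K by (intro
          borel_integrable_compact) auto
      then show "integrable lebesgue (\<lambda>X. indicator K X *\<^sub>R (2 * r))"
        using integrable_completion[of "\<lambda>X. indicator K X *\<^sub>R (2 * r)" lborel]
            borel_measurable_integrable by blast
      show "(\<lambda>X. indicator K X *\<^sub>R \<bar>U X (x i) - U X t0\<bar>) \<in> borel_measurable lebesgue" for i
        by (intro borel_measurable_scaleR borel_measurable_indicator Kl borel_measurable_abs
            borel_measurable_diff borel_measurable_U)
      show "AE X in lebesgue. norm (indicator K X *\<^sub>R \<bar>U X (x i) - U X t0\<bar>) \<le> indicator K X *\<^sub>R (2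
          * r)" for i
      proof (intro AE_I2)
        fix X show "norm (indicator K X *\<^sub>R \<bar>U X (x i) - U X t0\<bar>) \<le> indicator K X *\<^sub>R (2 * r)"
          using train_abs_le[of "(X, x i)"] train_abs_le[of "(X, t0)"]
          by (cases "X \<in> K") (simp_all add: U_def abs_le_iff)
      qed
      show "AE X in lebesgue. (\<lambda>i. indicator K X *\<^sub>R \<bar>U X (x i) - U X t0\<bar>) \<longlonglongrightarrow> 0"
      proof (rule AE_I'[where N="\<Union>j. (\<lambda>X. (X, t0)) -` shock j"])
        have "negligible ((\<lambda>X. (X, t0)) -` shock j)" for j
        proof (rule negligible_line_section_singleton[where e=w])
          have "closed ((\<lambda>X. (X, t0)) -` shock j)"
            by (rule continuous_closed_vimage[OF closed_shock]) (auto intro!: continuous_intros)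
          then show "(\<lambda>X. (X, t0)) -` shock j \<in> sets lebesgue" by auto
          fix X and s :: real assume "X \<in> (\<lambda>X. (X, t0)) -` shock j" "s \<noteq> 0"
          then show "X + s *\<^sub>R w \<notin> (\<lambda>X. (X, t0)) -` shock j"
            using shock_unique[of "(X, t0)" j "(X + s *\<^sub>R w, t0)"]
            by (auto simp: phase_def T_def inner_add_right w_inner_w)
        qed
        then show "(\<Union>j. (\<lambda>X. (X, t0)) -` shock j) \<in> null_sets lebesgue"
          by (intro null_sets_UN) (simp add: negligible_iff_null_sets)
        show "{X \<in> space lebesgue. \<not> (\<lambda>i. indicator K X *\<^sub>R \<bar>U X (x i) - U X t0\<bar>) \<longlonglongrightarrow> 0}
          \<subseteq> (\<Union>j. (\<lambda>X. (X, t0)) -` shock j)"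
        proof (clarify, rule ccontr)
          fix X assume n: "\<not> (\<lambda>i. indicator K X *\<^sub>R \<bar>U X (x i) - U X t0\<bar>) \<longlonglongrightarrow> 0"
            and "X \<notin> (\<Union>j. (\<lambda>X. (X, t0)) -` shock j)"
          then have "(X, t0) \<notin> shock j" for j by auto
          from train_tendsto[OF this tendsto_Pair[OF tendsto_const x]]
          have "(\<lambda>i. indicator K X *\<^sub>R \<bar>U X (x i) - U X t0\<bar>) \<longlonglongrightarrow> indicator K X *\<^sub>R \<bar>U X t0 - U X t0\<bar>"
            unfolding U_def by (intro tendsto_intros)
          then show False using n by simp
        qed
      qed
    qed simp
    then show "(\<lambda>i. LINT X:K|lebesgue. \<bar>U X (x i) - U X t0\<bar>) \<longlonglongrightarrow> 0"
      by (simp add: set_lebesgue_integral_def)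
  qed
qed

text \<open>The flux is split along \<open>w\<close> and orthogonally to it. The first part gives
  the scalar inequality of the train; the second integrates to 0, since the solution is constant in
  the directions orthogonal to \<open>w\<close>.\<close>

lemma U_kruzhkov_inequality: "kruzhkov_inequality F U k"
  unfolding kruzhkov_inequality_def
proof (intro allI impI, elim conjE)
  fix \<phi> :: "'a \<times> real \<Rightarrow> real"
  assume "C_infinity \<phi>" and cs: "compactly_supported_in (UNIV \<times> {0<..}) \<phi>" and nonneg: "\<forall>z. 0 \<le> \<phi> z"
  define \<phi>' where "\<phi>' z = frechet_derivative \<phi> (at z)" for z
  have phi: "C1_deriv \<phi> \<phi>'"
    unfolding \<phi>'_def[abs_def]
    by (rule C_k_1_imp_C1_deriv[OF spec[OF \<open>C_infinity \<phi>\<close>[unfolded C_infinity_def]]])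
  note supp = compactly_supported_C1[OF phi cs]
  have bs: "bounded_support \<phi>" by (rule supp(1))
  have past: "\<phi> z = 0 \<and> \<phi>' z v = 0" if "snd z \<le> 0" for z v
    using supp(2,3)[of z] that by (cases z) auto
  note lin = C1_deriv_linear[OF phi]
  define k' where "k' = k - ubar"
  define G where "G z = sgn (ubar + train z - k) *\<^sub>R (F (ubar + train z) - F k)" for z
  define perp :: "'a \<Rightarrow> 'a \<times> real" where "perp i = (i - (i \<bullet> w) *\<^sub>R w, 0)" for i
  have G_w: "G z \<bullet> w = kruzhkov_flux k' (train z) + lam * \<bar>train z - k'\<bar>" for z
  proof -
    define d where "d = w \<bullet> (F (ubar + train z) - F k)"
    have e: "ubar + train z - k = train z - k'" by (simp add: k'_def)
    have "g (train z) - g k' = d - lam * (train z - k')"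
      unfolding g_eq k'_def d_def by (simp add: inner_diff_right right_diff_distrib)
    then have d: "d = (g (train z) - g k') + lam * (train z - k')" by linarith
    have "G z \<bullet> w = sgn (train z - k') * d"
      by (simp only: G_def e inner_scaleR_left d_def inner_commute[of w])
    also have "\<dots> = kruzhkov_flux k' (train z) + lam * ((train z - k') * sgn (train z - k'))"
      unfolding d kruzhkov_flux_def by (simp only: distrib_left ac_simps)
    finally show ?thesis by (simp only: abs_sgn)
  qed
  have split: "\<bar>ubar + train z - k\<bar> * \<phi>' z (0, 1) + \<phi>' z (G z, 0)
    = production \<phi>' k' (train z) z + (\<Sum>i\<in>Basis. (G z \<bullet> i) * \<phi>' z (perp i))" for z
  proof -
    \<comment> \<open>The term with \<open>lam\<close> that arises here cancels the one in
      \<open>G_w\<close>.\<close>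
    have "(0, 1) = et - lam *\<^sub>R ex" by (simp add: et_def ex_def)
    then have 1: "\<phi>' z (0, 1) = \<phi>' z et - lam * \<phi>' z ex"
      using linear_diff[OF lin] linear_scale[OF lin] by simp
    have "(\<Sum>i\<in>Basis. (G z \<bullet> i) *\<^sub>R perp i) = (\<Sum>i\<in>Basis. ((G z \<bullet> i) *\<^sub>R i, 0)) - (\<Sum>i\<in>Basis. (((G z
        \<bullet> i) * (i \<bullet> w)) *\<^sub>R w, 0))"
      by (simp add: perp_def sum_subtractf[symmetric] scaleR_right_diff_distrib)
    also have "\<dots> = (G z, 0) - (G z \<bullet> w) *\<^sub>R ex"
    proof -
      have "(\<Sum>i\<in>Basis. ((G z \<bullet> i) *\<^sub>R i, 0::real)) = (G z, 0)"
        by (simp add: prod_eq_iff fst_sum snd_sum euclidean_representation)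
      moreover have "(\<Sum>i\<in>Basis. (((G z \<bullet> i) * (i \<bullet> w)) *\<^sub>R w, 0::real)) = (G z \<bullet> w) *\<^sub>R ex"
        by (simp add: prod_eq_iff fst_sum snd_sum ex_def scaleR_sum_left[symmetric]
            euclidean_inner[of "G z" w] inner_commute[of w])
      ultimately show ?thesis by simp
    qed
    finally have "(G z, 0) = (G z \<bullet> w) *\<^sub>R ex + (\<Sum>i\<in>Basis. (G z \<bullet> i) *\<^sub>R perp i)" by simp
    then have "\<phi>' z (G z, 0) = (G z \<bullet> w) * \<phi>' z ex + (\<Sum>i\<in>Basis. (G z \<bullet> i) * \<phi>' z (perp i))"
      by (simp add: linear_add[OF lin] linear_scale[OF lin] linear_sum[OF lin])
    then show ?thesis
      unfolding G_w 1 production_def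
      by (simp add: k'_def algebra_simps)
  qed
  obtain W where W: "integrable lebesgue W" "\<And>u z. u \<in> {-r..r} \<Longrightarrow> \<bar>production \<phi>' k' u z\<bar> \<le> W z"
      "\<And>z. 0 \<le> W z"
    using production_dominated[OF phi bs nonneg[rule_format] past, of k'] by metis
  have int1: "integrable lebesgue (\<lambda>z. production \<phi>' k' (train z) z)"
    using W(2)[OF train_mem(1)] W(3)
    by (intro Bochner_Integration.integrable_bound[OF W(1)] AE_I2
       borel_measurable_production[OF phi bs nonneg[rule_format] past borel_measurable_train]) auto
  have "bounded ((\<lambda>u. F u - F k) ` {ubar - r..ubar + r})"
    by (intro compact_imp_bounded compact_continuous_image continuous_intros
        continuous_on_subset[OF F_cont]) auto
  then obtain C where C: "\<And>u. u \<in> {ubar - r..ubar + r} \<Longrightarrow> norm (F u - F k) \<le> C"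
    unfolding bounded_iff by blast
  have G_L1: "(\<lambda>z. G z \<bullet> i) \<in> L1_loc" if "i \<in> Basis" for i
  proof (rule L1_loc_bounded)
    note borel_measurable_train[measurable]
    have [measurable]: "F \<in> borel_measurable borel" by (rule borel_measurable_continuous_onI[OF F_cont])
    have "(\<lambda>z. G z \<bullet> i) \<in> borel_measurable borel" unfolding G_def by measurable
    then show "(\<lambda>z. G z \<bullet> i) \<in> borel_measurable lebesgue" by (intro measurable_completion) simp
    have "\<bar>G z \<bullet> i\<bar> \<le> C" for z
    proof -
      have "\<bar>G z \<bullet> i\<bar> \<le> norm (G z)" using Basis_le_norm[OF that] .
      also have "\<dots> \<le> norm (F (ubar + train z) - F k)" by (simp add: G_def sgn_if)
      also have "\<dots> \<le> C" using train_mem(1)[of z] by (intro C) auto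
      finally show ?thesis .
    qed
    then show "\<exists>B. \<forall>z. norm z \<le> R \<longrightarrow> \<bar>G z \<bullet> i\<bar> \<le> B" for R by blast
  qed
  have int2: "integrable lebesgue (\<lambda>z. (G z \<bullet> i) * \<phi>' z (perp i))" if "i \<in> Basis" for i
    by (intro integrable_L1_loc_mult_continuous G_L1 that C1_deriv_continuous[OF phi]
        bounded_support_deriv[OF phi bs])
  have zero: "(\<integral>z. (G z \<bullet> i) * \<phi>' z (perp i) \<partial>lebesgue) = 0" if "i \<in> Basis" for i
  proof (rule integral_deriv_invariant[OF G_L1[OF that] _ phi bs])
    fix z s
    have "phase (perp i) = 0" "snd (perp i) = 0"
      by (simp_all add: phase_def perp_def inner_diff_right w_inner_w inner_commute)
    then have "train (z + s *\<^sub>R perp i) = train z"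
      by (intro train_cong) (simp_all add: phase_add T_add)
    then show "G (z + s *\<^sub>R perp i) \<bullet> i = G z \<bullet> i" by (simp add: G_def)
  qed
  have "0 \<le> (\<integral>z. production \<phi>' k' (train z) z \<partial>lebesgue)"
    by (rule kruzhkov_train[OF phi bs nonneg[rule_format] past])
  also have "\<dots> = (\<integral>z. production \<phi>' k' (train z) z + (\<Sum>i\<in>Basis. (G z \<bullet> i) * \<phi>' z (perp i)) \<partial>lebesgue)"
    using int1 int2 zero by simp
  also have "\<dots> = (\<integral>z. \<bar>ubar + train z - k\<bar> * \<phi>' z (0, 1) + \<phi>' z (G z, 0) \<partial>lebesgue)"
    by (simp only: split)
  also have "\<dots> = (LINT z:UNIV \<times> {0<..}|lebesgue. \<bar>ubar + train z - k\<bar> * \<phi>' z (0, 1) + \<phi>' z (G z, 0))"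
    unfolding set_lebesgue_integral_def
    by (rule Bochner_Integration.integral_cong[OF refl]) (use past in \<open>force simp: indicator_def\<close>)
  finally show "0 \<le> (LINT z:UNIV \<times> {0<..}|lebesgue. let u = U (fst z) (snd z) in
      \<bar>u - k\<bar> * frechet_derivative \<phi> (at z) (0, 1) + frechet_derivative \<phi> (at z) (sgn (u - k) *\<^sub>R
          (F u - F k), 0))"
    by (simp add: U_def G_def \<phi>'_def Let_def)
qed

lemma U_entropy_solution: "entropy_solution F (\<lambda>X. U X 0) U"
  unfolding entropy_solution_def
proof (intro conjI allI U_continuous_in_L1_loc U_kruzhkov_inequality)
  have "(\<lambda>z. U (fst z) (snd z)) \<in> borel_measurable lebesgue"
    by (intro measurable_completion) (use borel_measurable_train in \<open>auto simp: U_def\<close>)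
  then show "(\<lambda>z. U (fst z) (snd z)) \<in> borel_measurable (lebesgue_on (UNIV \<times> {0<..}))"
    by (rule measurable_restrict_space1)
  show "\<exists>C. AE z in lebesgue_on (UNIV \<times> {0<..}). \<bar>U (fst z) (snd z)\<bar> \<le> C"
    using U_bounded by (intro exI AE_I2)
qed auto

lemma U_L_infinity: "(\<lambda>X. U X t) \<in> L_infinity"
  unfolding L_infinity_def using borel_measurable_U U_bounded by (auto intro!: AE_I2)

end

section \<open>Functions of locally bounded variation\<close>

lemma bounded_support_mono:
  "bounded_support f \<Longrightarrow> (\<And>z. g z \<noteq> 0 \<Longrightarrow> f z \<noteq> 0) \<Longrightarrow> bounded_support g"
  unfolding bounded_support_def by blast

lemma C1_deriv_inner_self:
  "C1_deriv (\<lambda>z::'a::euclidean_space. z \<bullet> z) (\<lambda>z v. 2 * (z \<bullet> v))"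
  unfolding C1_deriv_def
  by (auto intro!: derivative_eq_intros continuous_intros simp: inner_commute)

lemma C1_deriv_pos_sq:
  assumes "C1_deriv f f'"
  shows "C1_deriv (\<lambda>z. pos_sq (f z)) (\<lambda>z v. 2 * max 0 (f z) * f' z v)"
  by (rule C1_deriv_compose_real[OF assms DERIV_pos_sq continuous_on_max_zero])

lemma C1_bump:
  "\<exists>(\<kappa> :: 'a::euclidean_space \<Rightarrow> real) \<kappa>'. C1_deriv \<kappa> \<kappa>' \<and> bounded_support \<kappa> \<and> (\<forall>z. 0 \<le> \<kappa> z)
     \<and> (\<forall>z. norm z \<le> R \<longrightarrow> 1 \<le> \<kappa> z)"
proof (intro exI conjI allI impI)
  show "C1_deriv (\<lambda>z::'a. pos_sq (R\<^sup>2 + 1 - z \<bullet> z)) (\<lambda>z v. 2 * max 0 (R\<^sup>2 + 1 - z \<bullet> z) * (0 - 2 *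
      (z \<bullet> v)))"
    by (intro C1_deriv_pos_sq C1_deriv_diff C1_deriv_const C1_deriv_inner_self)
  show "bounded_support (\<lambda>z::'a. pos_sq (R\<^sup>2 + 1 - z \<bullet> z))"
    unfolding bounded_support_def
  proof (intro exI[of _ "sqrt (R\<^sup>2 + 1)"] allI impI)
    fix z :: 'a assume "pos_sq (R\<^sup>2 + 1 - z \<bullet> z) \<noteq> 0"
    then have "z \<bullet> z \<le> R\<^sup>2 + 1" by (auto simp: pos_sq_def max_def split: if_splits)
    then show "norm z \<le> sqrt (R\<^sup>2 + 1)" by (simp add: norm_eq_sqrt_inner)
  qed
  show "0 \<le> pos_sq (R\<^sup>2 + 1 - z \<bullet> z)" for z :: 'a by (rule pos_sq_nonneg)
  fix z :: 'a assume "norm z \<le> R"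
  then have "z \<bullet> z \<le> R\<^sup>2"
    unfolding power2_norm_eq_inner[symmetric] by (intro power_mono) auto
  then have "1 \<le> max 0 (R\<^sup>2 + 1 - z \<bullet> z)" by simp
  then show "1 \<le> pos_sq (R\<^sup>2 + 1 - z \<bullet> z)" unfolding pos_sq_def by (rule one_le_power)
qed

lemma divergence_C1: "C1_deriv \<phi> \<phi>' \<Longrightarrow> divergence \<phi> X = (\<Sum>i\<in>Basis. \<phi>' X i \<bullet> i)"
  by (simp add: divergence_def C1_deriv_frechet)

text \<open>Two-sided, unlike the bound in \<open>BV_loc\<close>, so that bounds for two functions
  also control their difference.\<close>

definition divergence_bound :: "'a::euclidean_space set \<Rightarrow> ('a \<Rightarrow> real) \<Rightarrow> real \<Rightarrow> bool" where
  "divergence_bound \<Omega> u C \<longleftrightarrow> (\<forall>\<phi> \<phi>'. C1_deriv \<phi> \<phi>' \<longrightarrow> compactly_supported_in \<Omega> \<phi> \<longrightarrow>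
     (\<forall>x. norm (\<phi> x) \<le> 1) \<longrightarrow> \<bar>\<integral>X. u X * (\<Sum>i\<in>Basis. \<phi>' X i \<bullet> i) \<partial>lebesgue\<bar> \<le> C)"

text \<open>A test function is dominated by a fixed bump \<open>\<kappa>\<close>, and \<open>u\<close> decreases the integral of the
  derivative of \<open>\<kappa> \<plusminus> \<phi> \<ge> 0\<close>.\<close>

lemma monotone_divergence_bound:
  fixes u :: "'a::euclidean_space \<Rightarrow> real"
  assumes u: "u \<in> L1_loc" and \<Omega>: "bounded \<Omega>"
    and mono: "\<And>i. i \<in> Basis \<Longrightarrow> (\<forall>z s. 0 \<le> s \<longrightarrow> u z \<le> u (z + s *\<^sub>R i)) \<or> (\<forall>z s. 0 \<le> s \<longrightarrow> u (z + s *\<^sub>R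
        i) \<le> u z)"
  shows "\<exists>C. divergence_bound \<Omega> u C"
proof -
  obtain R where R: "\<And>z. z \<in> \<Omega> \<Longrightarrow> norm z \<le> R" using \<Omega> unfolding bounded_iff by auto
  obtain \<kappa> :: "'a \<Rightarrow> real" and \<kappa>' where chi: "C1_deriv \<kappa> \<kappa>'" "bounded_support \<kappa>" "\<And>z. 0 \<le> \<kappa> z" "\<And>z.
      norm z \<le> R \<Longrightarrow> 1 \<le> \<kappa> z"
    using C1_bump[of R] by blast
  define C where "C = (\<Sum>i\<in>(Basis::'a set). \<bar>\<integral>X. u X * \<kappa>' X i \<partial>lebesgue\<bar>)"
  have "\<bar>\<integral>X. u X * (\<Sum>i\<in>Basis. \<phi>' X i \<bullet> i) \<partial>lebesgue\<bar> \<le> C"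
    if phi: "C1_deriv \<phi> \<phi>'" "compactly_supported_in \<Omega> \<phi>" "\<And>x. norm (\<phi> x) \<le> 1" for \<phi> \<phi>'
  proof -
    note supp = compactly_supported_C1[OF phi(1,2)]
    have comp: "C1_deriv (\<lambda>X. \<phi> X \<bullet> i) (\<lambda>X v. \<phi>' X v \<bullet> i)" for i
      by (rule C1_deriv_inner_right[OF phi(1)])
    have bs: "bounded_support (\<lambda>X. \<phi> X \<bullet> i)" for i
      by (rule bounded_support_mono[OF supp(1)]) auto
    have int: "integrable lebesgue (\<lambda>X. u X * (\<phi>' X i \<bullet> i))" for i
      by (intro integrable_L1_loc_mult_continuous u C1_deriv_continuous[OF comp]
          bounded_support_deriv[OF comp bs])
    have intc: "integrable lebesgue (\<lambda>X. u X * \<kappa>' X i)" for i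
      by (intro integrable_L1_loc_mult_continuous u C1_deriv_continuous[OF chi(1)]
          bounded_support_deriv[OF chi(1,2)])
    have one: "\<bar>\<integral>X. u X * (\<phi>' X i \<bullet> i) \<partial>lebesgue\<bar> \<le> \<bar>\<integral>X. u X * \<kappa>' X i \<partial>lebesgue\<bar>" if i: "i \<in>
        Basis" for i
    proof -
      have dom: "\<bar>\<phi> X \<bullet> i\<bar> \<le> \<kappa> X" for X
      proof (cases "X \<in> \<Omega>")
        case True
        have "\<bar>\<phi> X \<bullet> i\<bar> \<le> 1" using Basis_le_norm[OF i, of "\<phi> X"] phi(3)[of X] by linarith
        then show ?thesis using chi(4)[OF R[OF True]] by linarith
      qed (use supp chi in auto)
      have bsp: "bounded_support (\<lambda>X. \<kappa> X + \<phi> X \<bullet> i)" "bounded_support (\<lambda>X. \<kappa> X - \<phi> X \<bullet> i)"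
      proof -
        have "\<kappa> X \<noteq> 0" if "\<kappa> X + \<phi> X \<bullet> i \<noteq> 0 \<or> \<kappa> X - \<phi> X \<bullet> i \<noteq> 0" for X
          using dom[of X] that by auto
        then show "bounded_support (\<lambda>X. \<kappa> X + \<phi> X \<bullet> i)" "bounded_support (\<lambda>X. \<kappa> X - \<phi> X \<bullet> i)"
          by (auto intro: bounded_support_mono[OF chi(2)])
      qed
      have nn: "0 \<le> \<kappa> X + \<phi> X \<bullet> i" "0 \<le> \<kappa> X - \<phi> X \<bullet> i" for X using dom[of X] by auto
      have sum: "(\<integral>X. u X * (\<kappa>' X i + \<phi>' X i \<bullet> i) \<partial>lebesgue) = (\<integral>X. u X * \<kappa>' X i \<partial>lebesgue) + (\<integral>X.
          u X * (\<phi>' X i \<bullet> i) \<partial>lebesgue)"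
        "(\<integral>X. u X * (\<kappa>' X i - \<phi>' X i \<bullet> i) \<partial>lebesgue) = (\<integral>X. u X * \<kappa>' X i \<partial>lebesgue) - (\<integral>X. u X *
            (\<phi>' X i \<bullet> i) \<partial>lebesgue)"
        using int[of i] intc[of i] by (simp_all add: distrib_left right_diff_distrib)
      have key: "(\<integral>X. v X * (\<kappa>' X i + \<phi>' X i \<bullet> i) \<partial>lebesgue) \<le> 0" "(\<integral>X. v X * (\<kappa>' X i - \<phi>' X i \<bullet>
          i) \<partial>lebesgue) \<le> 0"
        if "v \<in> L1_loc" "\<forall>z s. 0 \<le> s \<longrightarrow> v z \<le> v (z + s *\<^sub>R i)" for v
        using that
        by (auto intro!: integral_deriv_nondecreasing[OF _ _ C1_deriv_add[OF chi(1) comp] bsp(1) nn(1)]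
          integral_deriv_nondecreasing[OF _ _ C1_deriv_diff[OF chi(1) comp] bsp(2) nn(2)])
      from mono[OF i] show ?thesis
      proof
        assume "\<forall>z s. 0 \<le> s \<longrightarrow> u z \<le> u (z + s *\<^sub>R i)"
        from key[OF u this] show ?thesis unfolding sum by linarith
      next
        assume "\<forall>z s. 0 \<le> s \<longrightarrow> u (z + s *\<^sub>R i) \<le> u z"
        then have m: "\<forall>z s. 0 \<le> s \<longrightarrow> - u z \<le> - u (z + s *\<^sub>R i)" by simp
        have "(\<lambda>z. - u z) \<in> L1_loc" using u unfolding L1_loc_def set_integrable_def by simp
        from key[OF this m] show ?thesis using sum by simp
      qed
    qed
    have "(\<integral>X. u X * (\<Sum>i\<in>Basis. \<phi>' X i \<bullet> i) \<partial>lebesgue) = (\<Sum>i\<in>Basis. \<integral>X. u X * (\<phi>' X i \<bullet> i) \<partial>lebesgue)"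
      using int by (simp add: sum_distrib_left)
    also have "\<bar>\<dots>\<bar> \<le> C" unfolding C_def by (rule order_trans[OF sum_abs sum_mono[OF one]])
    finally show ?thesis .
  qed
  then have "divergence_bound \<Omega> u C" unfolding divergence_bound_def by blast
  then show ?thesis ..
qed

lemma set_integral_divergence:
  fixes u :: "'a::euclidean_space \<Rightarrow> real"
  assumes "C1_deriv \<phi> \<phi>'" "compactly_supported_in \<Omega> \<phi>"
  shows "(LINT X:\<Omega>|lebesgue. u X * divergence \<phi> X) = (\<integral>X. u X * (\<Sum>i\<in>Basis. \<phi>' X i \<bullet> i) \<partial>lebesgue)"
  unfolding set_lebesgue_integral_def divergence_C1[OF assms(1)]
  by (rule Bochner_Integration.integral_cong[OF refl])
    (use compactly_supported_C1(3)[OF assms] in \<open>auto simp: indicator_def\<close>)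

lemma BV_loc_diff_monotone:
  fixes u v :: "'a::euclidean_space \<Rightarrow> real"
  assumes u: "u \<in> L1_loc" and v: "v \<in> L1_loc"
    and mono_u: "\<And>i. i \<in> Basis \<Longrightarrow> (\<forall>z s. 0 \<le> s \<longrightarrow> u z \<le> u (z + s *\<^sub>R i)) \<or> (\<forall>z s. 0 \<le> s \<longrightarrow> u (z + s
        *\<^sub>R i) \<le> u z)"
    and mono_v: "\<And>i. i \<in> Basis \<Longrightarrow> (\<forall>z s. 0 \<le> s \<longrightarrow> v z \<le> v (z + s *\<^sub>R i)) \<or> (\<forall>z s. 0 \<le> s \<longrightarrow> v (z + s
        *\<^sub>R i) \<le> v z)"
  shows "(\<lambda>X. u X - v X) \<in> BV_loc"
  unfolding BV_loc_def mem_Collect_eq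
proof (intro conjI allI impI)
  show "(\<lambda>X. u X - v X) \<in> L1_loc"
    using u v unfolding L1_loc_def set_integrable_def by (simp add: right_diff_distrib)
  fix \<Omega> :: "'a set" assume \<Omega>: "open \<Omega> \<and> bounded \<Omega>"
  obtain C where C: "divergence_bound \<Omega> u C"
    using monotone_divergence_bound[OF u _ mono_u] \<Omega> by blast
  obtain D where D: "divergence_bound \<Omega> v D"
    using monotone_divergence_bound[OF v _ mono_v] \<Omega> by blast
  show "bdd_above {LINT x:\<Omega>|lebesgue. (u x - v x) * divergence \<phi> x |\<phi>.
      C_k 1 \<phi> \<and> compactly_supported_in \<Omega> \<phi> \<and> (\<forall>x. norm (\<phi> x) \<le> 1)}"
  proof (rule bdd_aboveI[of _ "C + D"], clarify)
    fix \<phi> :: "'a \<Rightarrow> 'a"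
    assume k: "C_k 1 \<phi>" and cs: "compactly_supported_in \<Omega> \<phi>" and n: "\<forall>x. norm (\<phi> x) \<le> 1"
    define \<phi>' where "\<phi>' z = frechet_derivative \<phi> (at z)" for z
    have phi: "C1_deriv \<phi> \<phi>'" unfolding \<phi>'_def[abs_def] by (rule C_k_1_imp_C1_deriv[OF k])
    have comp: "C1_deriv (\<lambda>X. \<phi> X \<bullet> i) (\<lambda>X v. \<phi>' X v \<bullet> i)" for i
      by (rule C1_deriv_inner_right[OF phi])
    have bs: "bounded_support (\<lambda>X. \<phi> X \<bullet> i)" for i
      by (rule bounded_support_mono[OF compactly_supported_C1(1)[OF phi cs]]) auto
    have int: "integrable lebesgue (\<lambda>X. f X * (\<Sum>i\<in>Basis. \<phi>' X i \<bullet> i))" if "f \<in> L1_loc" for f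
      unfolding sum_distrib_left
      by (intro Bochner_Integration.integrable_sum integrable_L1_loc_mult_continuous that
          C1_deriv_continuous[OF comp] bounded_support_deriv[OF comp bs])
    have "(LINT x:\<Omega>|lebesgue. (u x - v x) * divergence \<phi> x)
      = (\<integral>X. u X * (\<Sum>i\<in>Basis. \<phi>' X i \<bullet> i) \<partial>lebesgue) - (\<integral>X. v X * (\<Sum>i\<in>Basis. \<phi>' X i \<bullet> i) \<partial>lebesgue)"
      unfolding set_integral_divergence[OF phi cs]
      using int[OF u] int[OF v] by (simp add: left_diff_distrib)
    then show "(LINT x:\<Omega>|lebesgue. (u x - v x) * divergence \<phi> x) \<le> C + D"
      using C[unfolded divergence_bound_def, rule_format, OF phi cs n[rule_format]]
        D[unfolded divergence_bound_def, rule_format, OF phi cs n[rule_format]] by linarith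
  qed
qed

section \<open>The speed as a function of bounded variation\<close>

context planar_train
begin

lemma centre_mono:
  assumes "phase z \<le> phase z'" "T z = T z'" shows "centre z \<le> centre z'"
  unfolding centre_def
proof (intro add_left_mono suminf_le summable_step)
  show "step j z \<le> step j z'" for j
    using left_of_shock_downward[OF _ assms, of j] c_mono[of j] by (auto simp: step_def)
qed

definition speed :: "'a \<times> real \<Rightarrow> real" where
  "speed z = clip ((phase z - centre z) / T z)"

text \<open>Oleinik's one-sided bound: the centre does not decrease with the phase and
  \<open>clip\<close> does not increase distances, so the speed rises no faster than
  \<open>phase / T\<close>. It is thereby a difference of two monotone functions.\<close>

lemma phase_minus_speed_mono:
  assumes "phase z \<le> phase z'" "T z = T z'"
  shows "phase z / T z - speed z \<le> phase z' / T z' - speed z'"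
proof -
  have "speed z' \<le> clip ((phase z' - centre z) / T z)"
    unfolding speed_def using centre_mono[OF assms] T_pos[of z'] assms
    by (intro clip_mono) (auto simp: divide_right_mono)
  moreover have "clip ((phase z' - centre z) / T z) - speed z \<le> (phase z' - centre z) / T z -
      (phase z - centre z) / T z"
    unfolding speed_def using T_pos[of z'] assms by (intro clip_diff_le) (auto simp: divide_right_mono)
  ultimately show ?thesis using assms(2) by (simp add: diff_divide_distrib)
qed

text \<open>The inner function is \<open>speed\<close>, the outer one \<open>ubar + B\<close>. What
  is monotone in the phase is monotone along every coordinate axis, in the sense given by the sign
  of \<open>w \<bullet> i\<close>, so the criterion for differences of monotone functions
  applies.\<close>

lemma U_in_BV_pow_loc: "(\<lambda>X. U X t) \<in> BV_pow_loc (1 / p)"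
proof -
  define f where "f X = phase (X, t) / T (X, t)" for X
  define k where "k X = f X - speed (X, t)" for X
  have step: "phase (X + s *\<^sub>R i, t) = phase (X, t) + s * (w \<bullet> i)" for X s i
    by (simp add: phase_def inner_add_right)
  have mono: "(\<forall>z s. 0 \<le> s \<longrightarrow> q z \<le> q (z + s *\<^sub>R i)) \<or> (\<forall>z s. 0 \<le> s \<longrightarrow> q (z + s *\<^sub>R i) \<le> q z)"
    if "\<And>X Y. phase (X, t) \<le> phase (Y, t) \<Longrightarrow> q X \<le> q Y" for q :: "'a \<Rightarrow> real" and i
  proof (cases "0 \<le> w \<bullet> i")
    case True then show ?thesis by (intro disjI1 allI impI that) (simp add: step)
  next
    case False then show ?thesis by (intro disjI2 allI impI that) (simp add: step mult_nonneg_nonpos)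
  qed
  have T: "T (X, t) = T (Y, t)" for X Y by (simp add: T_def)
  have mf: "f X \<le> f Y" if "phase (X, t) \<le> phase (Y, t)" for X Y
    using that T_pos[of "(Y, t)"] by (simp add: f_def T[of X Y] divide_right_mono)
  have mk: "k X \<le> k Y" if "phase (X, t) \<le> phase (Y, t)" for X Y
    unfolding k_def f_def by (rule phase_minus_speed_mono[OF that T])
  have cf: "continuous_on UNIV f"
  proof -
    have "f = (\<lambda>X. (w \<bullet> X - lam * t) / time_shift t)" by (simp add: f_def phase_def T_def fun_eq_iff)
    then show ?thesis using time_shift_pos[of t] by (auto intro!: continuous_intros)
  qed
  have sp: "\<bar>speed z\<bar> \<le> \<bar>h (- r)\<bar> + \<bar>h r\<bar>" for z
    using clip_mem[of "(phase z - centre z) / T z"] by (auto simp: speed_def)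
  have "(\<lambda>X. speed (X, t)) \<in> borel_measurable borel"
  proof -
    have [measurable]: "clip \<in> borel_measurable borel" by (intro borel_measurable_continuous_onI
        continuous_on_clip)
    have "(\<lambda>X::'a. (X, t)) \<in> borel_measurable borel"
      by (intro borel_measurable_continuous_onI continuous_intros)
    moreover have "speed \<in> borel_measurable borel" unfolding speed_def[abs_def] by measurable
    ultimately show ?thesis by (rule measurable_compose)
  qed
  then have "(\<lambda>X. speed (X, t)) \<in> borel_measurable lebesgue" by (intro measurable_completion) simp
  then have "(\<lambda>X. speed (X, t)) \<in> L1_loc" by (rule L1_loc_bounded) (use sp in blast)
  with continuous_L1_loc[OF cf] have kL: "k \<in> L1_loc"
    unfolding L1_loc_def set_integrable_def k_def[abs_def] by (simp add: right_diff_distrib)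
  have "(\<lambda>X. f X - k X) \<in> BV_loc"
    by (rule BV_loc_diff_monotone[OF continuous_L1_loc[OF cf] kL mono[OF mf] mono[OF mk]])
  then have bv: "(\<lambda>X. speed (X, t)) \<in> BV_loc" by (simp add: k_def)
  have lip: "(\<lambda>\<xi>. ubar + B \<xi>) \<in> Lip_pow (1 / p)"
    unfolding Lip_pow_def using B_hoelder by auto
  have "U X t = ubar + B (speed (X, t))" for X
    by (simp add: U_def train_def speed_def B_clip)
  then show ?thesis unfolding BV_pow_loc_def by (intro CollectI bexI[OF _ lip] bexI[OF _ bv] AE_I2)
qed

end

section \<open>Variation of BV functions under translations\<close>

lemma C1_deriv_real_polynomial_function:
  assumes "real_polynomial_function (f :: 'a::euclidean_space \<Rightarrow> real)"
  shows "\<exists>f'. C1_deriv f f'"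
  using assms
proof induction
  case (linear f)
  then show ?case by (intro exI[of _ "\<lambda>z. f"] C1_deriv_bounded_linear)
next
  case (const c)
  show ?case by (rule exI, rule C1_deriv_const)
next
  case (add f g)
  then obtain f' g' where "C1_deriv f f'" "C1_deriv g g'" by blast
  then show ?case by (intro exI, rule C1_deriv_add)
next
  case (mult f g)
  then obtain f' g' where "C1_deriv f f'" "C1_deriv g g'" by blast
  then show ?case by (intro exI, rule C1_deriv_mult)
qed

text \<open>\<open>sgn (G z)\<close> is an almost everywhere limit of continuous functions; these
  are clipped and replaced on a ball by polynomials, which are C^1, and dominated convergence
  applies. Thus an L^1 norm is recovered from admissible test functions.\<close>

lemma sign_approximation:
  fixes G M :: "'a::euclidean_space \<Rightarrow> real"
  assumes G: "G \<in> L1_loc" and M: "C1_deriv M M'" "\<And>z. 0 \<le> M z" "\<And>z. M z \<noteq> 0 \<Longrightarrow> norm z \<le> R"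
    and d: "0 < d"
  shows "\<exists>\<theta>. C_k 1 \<theta> \<and> (\<forall>z. \<bar>\<theta> z\<bar> \<le> 1) \<and> (\<forall>z. M z = 0 \<longrightarrow> \<theta> z = 0) \<and>
     (\<integral>z. indicator {z. M z \<noteq> 0} z * \<bar>G z\<bar> \<partial>lebesgue) - d < (\<integral>z. G z * \<theta> z \<partial>lebesgue)"
proof -
  have "(\<lambda>z. sgn (G z)) \<in> borel_measurable lebesgue"
    by (rule measurable_compose[OF L1_loc_measurable[OF G]]) simp
  then have "(\<lambda>z. sgn (G z)) measurable_on UNIV"
    by (rule lebesgue_measurable_imp_measurable_on) simp
  then have "\<exists>N f. negligible N \<and> (\<forall>n. continuous_on UNIV (f n)) \<and> (\<forall>z. z \<notin> N \<longrightarrow> (\<lambda>n. f n z) \<longlonglongrightarrow> sgn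
      (G z))"
    unfolding measurable_on_def by (simp only: UNIV_I if_True)
  then obtain N f where Nf: "negligible N \<and> (\<forall>n. continuous_on UNIV (f n)) \<and> (\<forall>z. z \<notin> N \<longrightarrow> (\<lambda>n. f n
      z) \<longlonglongrightarrow> sgn (G z))"
    by (elim exE)
  have N: "negligible N" and f: "continuous_on UNIV (f n)" and lim: "z \<notin> N \<Longrightarrow> (\<lambda>n. f n z) \<longlonglongrightarrow> sgn (G
      z)" for n z
    using Nf by simp_all
  define fc where "fc n z = max (- 1) (min 1 (f n z))" for n :: nat and z
  define e where "e n = inverse (real (Suc n))" for n
  have e: "0 < e n" for n by (simp add: e_def)
  have e0: "e \<longlonglongrightarrow> 0" unfolding e_def by (rule LIMSEQ_inverse_real_of_nat)
  have "\<exists>q. real_polynomial_function q \<and> (\<forall>z\<in>cball 0 R. \<bar>fc n z - q z\<bar> < e n)" for n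
  proof -
    have "continuous_on (cball 0 R) (fc n)"
      unfolding fc_def by (intro continuous_intros continuous_on_subset[OF f]) auto
    then show ?thesis
    proof (rule Stone_Weierstrass_real_polynomial_function[OF compact_cball _ e[of n]])
      fix q assume "real_polynomial_function q" "\<And>z. z \<in> cball 0 R \<Longrightarrow> \<bar>fc n z - q z\<bar> < e n"
      then show ?thesis by (intro exI[of _ q] conjI ballI)
    qed
  qed
  then have "\<exists>q. \<forall>n. real_polynomial_function (q n) \<and> (\<forall>z\<in>cball 0 R. \<bar>fc n z - q n z\<bar> < e n)"
    by (intro choice allI)
  then obtain q where q_all: "\<forall>n. real_polynomial_function (q n) \<and> (\<forall>z\<in>cball 0 R. \<bar>fc n z - q n z\<bar>
      < e n)"
    by (elim exE)
  have q: "real_polynomial_function (q n)" "z \<in> cball 0 R \<Longrightarrow> \<bar>fc n z - q n z\<bar> < e n" for n z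
    using q_all by simp_all
  have "\<exists>q'. \<forall>n. C1_deriv (q n) (q' n)"
    by (intro choice allI C1_deriv_real_polynomial_function q(1))
  then obtain q' where q': "\<forall>n. C1_deriv (q n) (q' n)" by (elim exE)
  \<comment> \<open>The quotient of \<open>M\<close> tends to 1 where \<open>M\<close> is positive
    and vanishes elsewhere; the factor \<open>inverse (1 + e n)\<close> restores the bound 1 after
    the polynomial approximation.\<close>
  define \<theta> where "\<theta> n z = M z * inverse (M z + e n) * (inverse (1 + e n) * q n z)" for n z
  have pos: "0 < M z + e n" for z n using M(2)[of z] e[of n] by linarith
  have nz: "M z + e n \<noteq> 0" for z n using pos[of z n] by simp
  have "\<exists>\<theta>'. C1_deriv (\<theta> n) \<theta>'" for n
  proof -
    have "C1_deriv (\<lambda>z. M z + e n) (\<lambda>z v. M' z v + 0)" by (intro C1_deriv_add M(1) C1_deriv_const)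
    then have "C1_deriv (\<lambda>z. inverse (M z + e n)) (\<lambda>z v. - (inverse (M z + e n) * inverse (M z + e
        n)) * (M' z v + 0))"
      by (rule C1_deriv_compose_real[where k=inverse and k'="\<lambda>x. - (inverse x * inverse x)"])
        (use nz in \<open>auto intro!: derivative_eq_intros continuous_intros\<close>)
    note * = C1_deriv_mult[OF C1_deriv_mult[OF M(1) this] C1_deriv_mult[OF C1_deriv_const[of
        "inverse (1 + e n)"] q'[rule_format, of n]]]
    show ?thesis unfolding \<theta>_def[abs_def] by (rule exI, rule *)
  qed
  then have "\<exists>\<theta>'. \<forall>n. C1_deriv (\<theta> n) (\<theta>' n)" by (intro choice allI)
  then obtain \<theta>' where "\<forall>n. C1_deriv (\<theta> n) (\<theta>' n)" by (elim exE)
  then have \<theta>': "C1_deriv (\<theta> n) (\<theta>' n)" for n by simp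
  have le1: "\<bar>\<theta> n z\<bar> \<le> 1" for n z
  proof (cases "M z = 0")
    case False
    then have "\<bar>fc n z - q n z\<bar> < e n" using q(2) M(3) by auto
    moreover have "\<bar>fc n z\<bar> \<le> 1" by (auto simp: fc_def)
    ultimately have "\<bar>q n z\<bar> \<le> 1 + e n" by linarith
    then have 1: "\<bar>inverse (1 + e n) * q n z\<bar> \<le> 1" using e[of n] by (simp add: abs_mult field_simps)
    have 2: "\<bar>M z * inverse (M z + e n)\<bar> \<le> 1" using pos[of z n] M(2)[of z] e[of n] by (simp add:
        abs_mult field_simps)
    show ?thesis unfolding \<theta>_def abs_mult[of "M z * _"] using mult_mono[OF 2 1] by simp
  qed (simp add: \<theta>_def)
  have "(\<lambda>n. \<integral>z. G z * \<theta> n z \<partial>lebesgue) \<longlonglongrightarrow> (\<integral>z. indicator {z. M z \<noteq> 0} z * \<bar>G z\<bar> \<partial>lebesgue)"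
  proof (rule integral_dominated_convergence[where w="\<lambda>z. \<bar>indicator (cball 0 R) z *\<^sub>R G z\<bar>"])
    have "integrable lebesgue (\<lambda>z. indicator (cball 0 R) z *\<^sub>R G z)"
      using G by (auto simp: L1_loc_def set_integrable_def)
    then show "integrable lebesgue (\<lambda>z. \<bar>indicator (cball 0 R) z *\<^sub>R G z\<bar>)" by simp
    have "open {z. M z \<noteq> 0}"
      by (intro open_Collect_neq C1_deriv_imp_continuous[OF M(1)] continuous_intros)
    then have "{z. M z \<noteq> 0} \<in> sets lebesgue" by auto
    then show "(\<lambda>z. indicator {z. M z \<noteq> 0} z * \<bar>G z\<bar>) \<in> borel_measurable lebesgue"
      by (intro borel_measurable_times borel_measurable_indicator borel_measurable_abs
          L1_loc_measurable[OF G])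
    show "(\<lambda>z. G z * \<theta> n z) \<in> borel_measurable lebesgue" for n
      by (intro borel_measurable_times L1_loc_measurable[OF G] continuous_on_UNIV_borel_lebesgue
          C1_deriv_imp_continuous[OF \<theta>'])
    show "AE z in lebesgue. (\<lambda>n. G z * \<theta> n z) \<longlonglongrightarrow> indicator {z. M z \<noteq> 0} z * \<bar>G z\<bar>"
    proof (rule AE_I'[where N=N])
      show "N \<in> null_sets lebesgue" using N by (simp add: negligible_iff_null_sets)
      have "(\<lambda>n. G z * \<theta> n z) \<longlonglongrightarrow> indicator {z. M z \<noteq> 0} z * \<bar>G z\<bar>" if z: "z \<notin> N" for z
      proof (cases "M z = 0")
        case True then show ?thesis by (simp add: \<theta>_def)
      next
        case False
        have "(\<lambda>n. fc n z) \<longlonglongrightarrow> max (- 1) (min 1 (sgn (G z)))"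
          unfolding fc_def by (intro tendsto_intros lim z)
        then have fl: "(\<lambda>n. fc n z) \<longlonglongrightarrow> sgn (G z)" by (simp add: sgn_if)
        have "(\<lambda>n. fc n z - q n z) \<longlonglongrightarrow> 0"
          by (rule Lim_null_comparison[OF _ e0], rule always_eventually)
            (use q(2)[of z] M(3)[OF False] in \<open>auto intro: less_imp_le\<close>)
        from tendsto_diff[OF fl this] have ql: "(\<lambda>n. q n z) \<longlonglongrightarrow> sgn (G z)" by simp
        have "(\<lambda>n. G z * \<theta> n z) \<longlonglongrightarrow> G z * (M z * inverse (M z + 0) * (inverse (1 + 0) * sgn (G z)))"
          unfolding \<theta>_def using False by (intro tendsto_intros e0 ql) auto
        then show ?thesis using False by (simp add: abs_sgn)
      qed
      then show "{z \<in> space lebesgue. \<not> (\<lambda>n. G z * \<theta> n z) \<longlonglongrightarrow> indicator {z. M z \<noteq> 0} z * \<bar>G z\<bar>} \<subseteq> N"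
        by blast
    qed
    show "AE z in lebesgue. norm (G z * \<theta> n z) \<le> \<bar>indicator (cball 0 R) z *\<^sub>R G z\<bar>" for n
    proof (intro AE_I2)
      fix z
      show "norm (G z * \<theta> n z) \<le> \<bar>indicator (cball 0 R) z *\<^sub>R G z\<bar>"
      proof (cases "M z = 0")
        case True then show ?thesis by (simp add: \<theta>_def)
      next
        case False
        have "\<bar>G z\<bar> * \<bar>\<theta> n z\<bar> \<le> \<bar>G z\<bar> * 1" by (intro mult_left_mono le1) auto
        then show ?thesis using M(3)[OF False] by (simp add: abs_mult)
      qed
    qed
  qed
  from order_tendstoD(1)[OF this, of "(\<integral>z. indicator {z. M z \<noteq> 0} z * \<bar>G z\<bar> \<partial>lebesgue) - d"] d
  obtain n where "(\<integral>z. indicator {z. M z \<noteq> 0} z * \<bar>G z\<bar> \<partial>lebesgue) - d < (\<integral>z. G z * \<theta> n z \<partial>lebesgue)"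
    by (auto dest: eventually_happens)
  moreover have "\<forall>z. M z = 0 \<longrightarrow> \<theta> n z = 0" by (simp add: \<theta>_def)
  ultimately show ?thesis using C1_deriv_imp_C_k_1[OF \<theta>'[of n]] le1[of n] by (intro exI[of _ "\<theta>
      n"] conjI allI) auto
qed

lemma L1_loc_translate:
  assumes "v \<in> L1_loc" shows "(\<lambda>X. v (X + a)) \<in> L1_loc"
  unfolding L1_loc_def mem_Collect_eq
proof (intro allI impI)
  fix K :: "'a set" assume K: "compact K"
  have "compact ((\<lambda>x. a + x) ` K)" using compact_translation[OF K] by simp
  then have "integrable lebesgue (\<lambda>x. indicator ((\<lambda>x. a + x) ` K) x *\<^sub>R v x)"
    using assms by (auto simp: L1_loc_def set_integrable_def)
  from integrable_lebesgue_translation[OF this, of a]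
  have "integrable lebesgue (\<lambda>x. indicator ((\<lambda>x. a + x) ` K) (x + a) *\<^sub>R v (x + a))" by simp
  moreover have "x + a \<in> (\<lambda>x. a + x) ` K \<longleftrightarrow> x \<in> K" for x by (auto simp: add.commute)
  ultimately show "set_integrable lebesgue K (\<lambda>X. v (X + a))"
    by (simp add: set_integrable_def indicator_def)
qed

lemma L1_loc_diff: "u \<in> L1_loc \<Longrightarrow> v \<in> L1_loc \<Longrightarrow> (\<lambda>X. u X - v X) \<in> L1_loc"
  unfolding L1_loc_def set_integrable_def by (simp add: right_diff_distrib)

text \<open>The weighted sum of the left-hand sides is \<open>G 1 - G 0\<close> for
  \<open>G \<tau> = \<Sum>\<^sub>n (1 / d\<^sub>n) \<integral> v(X) \<theta>\<^sub>n(X - \<tau> d\<^sub>n w) dX\<close>, and \<open>- G' \<tau>\<close> is the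
  integral of \<open>v\<close> against the divergence of the field \<open>\<Sum>\<^sub>n \<theta>\<^sub>n(X - \<tau> d\<^sub>n w) w\<close>.\<close>

lemma BV_translation_pairing:
  fixes v :: "'a::euclidean_space \<Rightarrow> real" and \<theta> :: "nat \<Rightarrow> 'a \<Rightarrow> real"
  assumes v: "v \<in> L1_loc" and w: "norm w = 1"
    and bound: "\<And>\<phi>. C_k 1 \<phi> \<Longrightarrow> compactly_supported_in (ball 0 R) \<phi> \<Longrightarrow> (\<And>x. norm (\<phi> x) \<le> 1) \<Longrightarrow>
      (LINT x:ball 0 R|lebesgue. v x * divergence \<phi> x) \<le> C"
    and \<theta>: "\<And>n. n \<in> I \<Longrightarrow> C1_deriv (\<theta> n) (\<theta>' n)" "\<And>n z. n \<in> I \<Longrightarrow> \<bar>\<theta> n z\<bar> \<le> 1"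
    and I: "finite I" and d: "\<And>n. n \<in> I \<Longrightarrow> 0 < d n"
    and supp: "\<And>n z \<tau>. n \<in> I \<Longrightarrow> 0 \<le> \<tau> \<Longrightarrow> \<tau> \<le> 1 \<Longrightarrow> \<theta> n (z - (\<tau> * d n) *\<^sub>R w) \<noteq> 0 \<Longrightarrow> norm z \<le> R'" and "R' < R"
    and disj: "\<And>m n z \<tau>. m \<in> I \<Longrightarrow> n \<in> I \<Longrightarrow> 0 \<le> \<tau> \<Longrightarrow> \<tau> \<le> 1 \<Longrightarrow>
      \<theta> m (z - (\<tau> * d m) *\<^sub>R w) \<noteq> 0 \<Longrightarrow> \<theta> n (z - (\<tau> * d n) *\<^sub>R w) \<noteq> 0 \<Longrightarrow> m = n"
  shows "(\<Sum>n\<in>I. (1 / d n) * (\<integral>X. (v (X + d n *\<^sub>R w) - v X) * \<theta> n X \<partial>lebesgue)) \<le> C"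
proof -
  have bs: "bounded_support (\<theta> n)" if "n \<in> I" for n
    using supp[OF that, of 0] unfolding bounded_support_def by auto
  define E where "E n s = (\<integral>X. v X * \<theta> n (X + s *\<^sub>R w) \<partial>lebesgue)" for n s
  define D where "D n s = (\<integral>X. v X * \<theta>' n (X + s *\<^sub>R w) w \<partial>lebesgue)" for n s
  have dE: "(E n has_real_derivative D n s) (at s)" if "n \<in> I" for n s
    using integral_translate_has_derivative[OF v \<theta>(1)[OF that], of w s] bs[OF that]
    by (simp add: E_def[abs_def] D_def)
  define G where "G \<tau> = (\<Sum>n\<in>I. (1 / d n) * E n (- (\<tau> * d n)))" for \<tau>
  have dG: "(G has_real_derivative (\<Sum>n\<in>I. - D n (- (\<tau> * d n)))) (at \<tau>)" for \<tau>
  proof -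
    have "((\<lambda>\<tau>. (1 / d n) * E n (- (\<tau> * d n))) has_real_derivative - D n (- (\<tau> * d n))) (at \<tau>)" if
        n: "n \<in> I" for n
    proof -
      have "((\<lambda>\<tau>. - (\<tau> * d n)) has_real_derivative - d n) (at \<tau>)" by (auto intro!: derivative_eq_intros)
      from DERIV_cmult[OF DERIV_chain2[OF dE[OF n] this], of "1 / d n"] d[OF n]
      show ?thesis by simp
    qed
    then show ?thesis unfolding G_def[abs_def] by (rule DERIV_sum)
  qed
  have contE: "continuous_on UNIV (\<lambda>X. \<theta> n (X + a))" if "n \<in> I" for n a
    by (rule C1_deriv_imp_continuous[OF C1_deriv_translate[OF \<theta>(1)[OF that]]])
  have bnd: "(\<Sum>n\<in>I. - D n (- (\<tau> * d n))) \<le> C" if \<tau>: "0 \<le> \<tau>" "\<tau> \<le> 1" for \<tau>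
  proof -
    define \<psi> where "\<psi> X = (\<Sum>n\<in>I. \<theta> n (X + - (\<tau> * d n) *\<^sub>R w))" for X
    define \<psi>' where "\<psi>' X u = (\<Sum>n\<in>I. \<theta>' n (X + - (\<tau> * d n) *\<^sub>R w) u)" for X u
    have psi: "C1_deriv \<psi> \<psi>'"
      unfolding \<psi>_def[abs_def] \<psi>'_def[abs_def] by (intro C1_deriv_sum C1_deriv_translate \<theta>(1))
    define \<phi> where "\<phi> X = \<psi> X *\<^sub>R (- w)" for X
    have phi: "C1_deriv \<phi> (\<lambda>X u. \<psi>' X u *\<^sub>R (- w))"
      unfolding \<phi>_def[abs_def] by (rule C1_deriv_scaleR_right[OF psi])
    have psi_ex: "\<exists>n\<in>I. \<theta> n (X + - (\<tau> * d n) *\<^sub>R w) \<noteq> 0" if "\<psi> X \<noteq> 0" for X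
      by (rule ccontr) (use that in \<open>simp add: \<psi>_def\<close>)
    have psi0: "norm X \<le> R'" if "\<psi> X \<noteq> 0" for X
    proof -
      from psi_ex[OF that] obtain n where "n \<in> I" "\<theta> n (X + - (\<tau> * d n) *\<^sub>R w) \<noteq> 0"
        by (elim bexE)
      then show ?thesis using supp[of n \<tau> X] \<tau> by simp
    qed
    have sub: "{X. \<phi> X \<noteq> 0} \<subseteq> cball 0 R'" using psi0 by (auto simp: \<phi>_def)
    have cs: "compactly_supported_in (ball 0 R) \<phi>"
      unfolding compactly_supported_in_def
    proof
      show "compact (closure {X. \<phi> X \<noteq> 0})"
        unfolding compact_closure by (rule bounded_subset[OF bounded_cball sub])
      have "closure {X. \<phi> X \<noteq> 0} \<subseteq> cball 0 R'" by (rule closure_minimal[OF sub]) simp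
      also have "\<dots> \<subseteq> ball 0 R" using \<open>R' < R\<close> by auto
      finally show "closure {X. \<phi> X \<noteq> 0} \<subseteq> ball 0 R" .
    qed
    \<comment> \<open>At most one summand is nonzero at \<open>X\<close>, so the bound 1 passes from
      the summands to the sum.\<close>
    have n1: "norm (\<phi> X) \<le> 1" for X
    proof (cases "\<psi> X = 0")
      case False
      from psi_ex[OF this] obtain m where m: "m \<in> I" "\<theta> m (X + - (\<tau> * d m) *\<^sub>R w) \<noteq> 0"
        by (elim bexE)
      have other: "\<theta> n (X + - (\<tau> * d n) *\<^sub>R w) = 0" if n: "n \<in> I - {m}" for n
      proof (rule ccontr)
        assume "\<theta> n (X + - (\<tau> * d n) *\<^sub>R w) \<noteq> 0"
        then have "m = n" using m n by (intro disj[OF m(1) _ \<tau>, of n X]) simp_all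
        then show False using n by simp
      qed
      have "\<psi> X = \<theta> m (X + - (\<tau> * d m) *\<^sub>R w)"
        unfolding \<psi>_def sum.remove[OF I m(1)] by (simp only: sum.neutral[OF ballI[OF other]]
            add_0_right)
      then have "norm (\<phi> X) = \<bar>\<theta> m (X + - (\<tau> * d m) *\<^sub>R w)\<bar>" using w by (simp add: \<phi>_def)
      then show ?thesis using \<theta>(2)[OF m(1)] by simp
    qed (simp add: \<phi>_def)
    have div: "(\<Sum>i\<in>Basis. (\<psi>' X i *\<^sub>R (- w)) \<bullet> i) = - \<psi>' X w" for X
    proof -
      have "\<psi>' X w = \<psi>' X (\<Sum>i\<in>Basis. (w \<bullet> i) *\<^sub>R i)" by (simp add: euclidean_representation)
      also have "\<dots> = (\<Sum>i\<in>Basis. (w \<bullet> i) * \<psi>' X i)"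
        using C1_deriv_linear[OF psi] by (simp add: linear_sum linear_scale)
      finally show ?thesis by (simp add: sum_negf mult.commute)
    qed
    have intD: "integrable lebesgue (\<lambda>X. v X * \<theta>' n (X + a) w)" if n: "n \<in> I" for n a
      by (rule integrable_L1_loc_mult_continuous[OF v C1_deriv_continuous[OF C1_deriv_translate[OF
          \<theta>(1)[OF n]]]
        bounded_support_deriv[OF C1_deriv_translate[OF \<theta>(1)[OF n]] bounded_support_translate[OF
            bs[OF n]]]])
    have "(\<integral>X. (\<Sum>n\<in>I. v X * \<theta>' n (X + - (\<tau> * d n) *\<^sub>R w) w) \<partial>lebesgue) = (\<Sum>n\<in>I. D n (- (\<tau> * d n)))"
      unfolding D_def by (rule Bochner_Integration.integral_sum) (rule intD)
    then have "(\<Sum>n\<in>I. - D n (- (\<tau> * d n))) = (\<integral>X. v X * (\<Sum>i\<in>Basis. (\<psi>' X i *\<^sub>R (- w)) \<bullet> i) \<partial>lebesgue)"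
      unfolding div unfolding \<psi>'_def sum_distrib_left mult_minus_right sum_negf by simp
    also have "\<dots> = (LINT x:ball 0 R|lebesgue. v x * divergence \<phi> x)"
      by (rule set_integral_divergence[OF phi cs, symmetric])
    also have "\<dots> \<le> C" by (rule bound[OF C1_deriv_imp_C_k_1[OF phi] cs n1])
    finally show ?thesis .
  qed
  \<comment> \<open>A single mean value point stands for the integration of the derivative of
    \<open>G\<close> over the unit interval.\<close>
  obtain \<xi> where \<xi>: "0 < \<xi>" "\<xi> < 1" "G 1 - G 0 = (1 - 0) * (\<Sum>n\<in>I. - D n (- (\<xi> * d n)))"
    using MVT2[of 0 1 G "\<lambda>\<tau>. \<Sum>n\<in>I. - D n (- (\<tau> * d n))"] dG by auto
  have "(\<Sum>n\<in>I. (1 / d n) * (\<integral>X. (v (X + d n *\<^sub>R w) - v X) * \<theta> n X \<partial>lebesgue)) = G 1 - G 0"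
    unfolding G_def sum_subtractf[symmetric]
  proof (rule sum.cong[OF refl])
    fix n assume n: "n \<in> I"
    have c: "continuous_on UNIV (\<theta> n)" using contE[OF n, of 0] by simp
    have i: "integrable lebesgue (\<lambda>X. v' X * \<theta> n X)" if "v' \<in> L1_loc" for v'
      by (rule integrable_L1_loc_mult_continuous[OF that c bs[OF n]])
    have "E n (- (1 * d n)) = (\<integral>X. v (X - - (1 * d n) *\<^sub>R w) * \<theta> n X \<partial>lebesgue)"
      unfolding E_def
      by (rule integral_translate_swap[OF L1_loc_measurable[OF v]
          continuous_on_UNIV_borel_lebesgue[OF c]])
    then have "E n (- (1 * d n)) - E n (- (0 * d n)) = (\<integral>X. (v (X + d n *\<^sub>R w) - v X) * \<theta> n X
        \<partial>lebesgue)"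
      using i[OF v] i[OF L1_loc_translate[OF v]] by (simp add: E_def left_diff_distrib)
    then show "1 / d n * (\<integral>X. (v (X + d n *\<^sub>R w) - v X) * \<theta> n X \<partial>lebesgue)
       = 1 / d n * E n (- (1 * d n)) - 1 / d n * E n (- (0 * d n))"
      by (simp only: right_diff_distrib[symmetric])
  qed
  then show ?thesis using bnd[of \<xi>] \<xi> by simp
qed

text \<open>The translation bound for BV functions, with its own shift \<open>d n\<close> on each
  piece. For each common fraction \<open>\<tau>\<close> of the shifts the moved pieces are disjoint,
  so all of them together are paid by one total variation.\<close>

lemma BV_translation_estimate:
  fixes v :: "'a::euclidean_space \<Rightarrow> real" and M :: "nat \<Rightarrow> 'a \<Rightarrow> real"
  assumes v: "v \<in> L1_loc" and w: "norm w = 1"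
    and bound: "\<And>\<phi>. C_k 1 \<phi> \<Longrightarrow> compactly_supported_in (ball 0 R) \<phi> \<Longrightarrow> (\<And>x. norm (\<phi> x) \<le> 1) \<Longrightarrow>
      (LINT x:ball 0 R|lebesgue. v x * divergence \<phi> x) \<le> C"
    and M: "\<And>n. n \<in> I \<Longrightarrow> C1_deriv (M n) (M' n)" "\<And>n z. n \<in> I \<Longrightarrow> 0 \<le> M n z"
    and I: "finite I" and d: "\<And>n. n \<in> I \<Longrightarrow> 0 < d n"
    and supp: "\<And>n z \<tau>. n \<in> I \<Longrightarrow> 0 \<le> \<tau> \<Longrightarrow> \<tau> \<le> 1 \<Longrightarrow> M n (z - (\<tau> * d n) *\<^sub>R w) \<noteq> 0 \<Longrightarrow> norm z \<le> R'" and "R' < R"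
    and disj: "\<And>m n z \<tau>. m \<in> I \<Longrightarrow> n \<in> I \<Longrightarrow> 0 \<le> \<tau> \<Longrightarrow> \<tau> \<le> 1 \<Longrightarrow>
      M m (z - (\<tau> * d m) *\<^sub>R w) \<noteq> 0 \<Longrightarrow> M n (z - (\<tau> * d n) *\<^sub>R w) \<noteq> 0 \<Longrightarrow> m = n"
  shows "(\<Sum>n\<in>I. (1 / d n) * (\<integral>X. indicator {z. M n z \<noteq> 0} X * \<bar>v (X + d n *\<^sub>R w) - v X\<bar> \<partial>lebesgue)) \<le> C"
proof (rule field_le_epsilon)
  fix e :: real assume e: "0 < e"
  \<comment> \<open>After division by \<open>d n\<close> these errors add up to less than
    \<open>e\<close>.\<close>
  define \<delta> where "\<delta> n = e * d n / (real (card I) + 1)" for n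
  have \<delta>: "0 < \<delta> n" if "n \<in> I" for n using e d[OF that] by (simp add: \<delta>_def)
  define J where "J n = (\<integral>X. indicator {z. M n z \<noteq> 0} X * \<bar>v (X + d n *\<^sub>R w) - v X\<bar> \<partial>lebesgue)" for n
  have "\<exists>\<theta>. C_k 1 \<theta> \<and> (\<forall>z. \<bar>\<theta> z\<bar> \<le> 1) \<and> (\<forall>z. M n z = 0 \<longrightarrow> \<theta> z = 0) \<and>
     J n - \<delta> n < (\<integral>z. (v (z + d n *\<^sub>R w) - v z) * \<theta> z \<partial>lebesgue)" if n: "n \<in> I" for n
    unfolding J_def
  proof (rule sign_approximation[OF _ M(1)[OF n] M(2)[OF n] _ \<delta>[OF n]])
    show "(\<lambda>z. v (z + d n *\<^sub>R w) - v z) \<in> L1_loc" by (intro L1_loc_diff L1_loc_translate v)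
    show "norm z \<le> R'" if "M n z \<noteq> 0" for z using supp[OF n, of 0 z] that by simp
  qed
  then have "\<exists>\<theta>. \<forall>n\<in>I. C_k 1 (\<theta> n) \<and> (\<forall>z. \<bar>\<theta> n z\<bar> \<le> 1) \<and> (\<forall>z. M n z = 0 \<longrightarrow> \<theta> n z = 0) \<and>
     J n - \<delta> n < (\<integral>z. (v (z + d n *\<^sub>R w) - v z) * \<theta> n z \<partial>lebesgue)"
    by (intro bchoice ballI)
  then obtain \<theta> where \<theta>_all: "\<forall>n\<in>I. C_k 1 (\<theta> n) \<and> (\<forall>z. \<bar>\<theta> n z\<bar> \<le> 1) \<and> (\<forall>z. M n z = 0 \<longrightarrow> \<theta> n z = 0) \<and>
     J n - \<delta> n < (\<integral>z. (v (z + d n *\<^sub>R w) - v z) * \<theta> n z \<partial>lebesgue)"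
    by (elim exE)
  have \<theta>: "C1_deriv (\<theta> n) (\<lambda>z. frechet_derivative (\<theta> n) (at z))" "\<bar>\<theta> n z\<bar> \<le> 1"
    "M n z = 0 \<Longrightarrow> \<theta> n z = 0"
    "J n - \<delta> n < (\<integral>z. (v (z + d n *\<^sub>R w) - v z) * \<theta> n z \<partial>lebesgue)" if "n \<in> I" for n z
    using bspec[OF \<theta>_all that] by (auto intro: C_k_1_imp_C1_deriv)
  have "(\<Sum>n\<in>I. (1 / d n) * J n) \<le> (\<Sum>n\<in>I. (1 / d n) * (\<integral>X. (v (X + d n *\<^sub>R w) - v X) * \<theta> n X
      \<partial>lebesgue) + e / (real (card I) + 1))"
  proof (rule sum_mono)
    fix n assume n: "n \<in> I"
    have "(1 / d n) * J n \<le> (1 / d n) * ((\<integral>X. (v (X + d n *\<^sub>R w) - v X) * \<theta> n X \<partial>lebesgue) + \<delta> n)"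
      using \<theta>(4)[OF n] d[OF n] by (intro mult_left_mono) auto
    then show "(1 / d n) * J n \<le> (1 / d n) * (\<integral>X. (v (X + d n *\<^sub>R w) - v X) * \<theta> n X \<partial>lebesgue) + e
        / (real (card I) + 1)"
      using d[OF n] by (simp add: distrib_left \<delta>_def)
  qed
  also have "\<dots> = (\<Sum>n\<in>I. (1 / d n) * (\<integral>X. (v (X + d n *\<^sub>R w) - v X) * \<theta> n X \<partial>lebesgue)) + real
      (card I) * (e / (real (card I) + 1))"
    by (simp add: sum.distrib)
  also have "\<dots> \<le> C + e"
  proof (rule add_mono)
    show "(\<Sum>n\<in>I. (1 / d n) * (\<integral>X. (v (X + d n *\<^sub>R w) - v X) * \<theta> n X \<partial>lebesgue)) \<le> C"
    proof (rule BV_translation_pairing[OF v w bound \<theta>(1,2) I d _ \<open>R' < R\<close>])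
      show "norm z \<le> R'" if "n \<in> I" "0 \<le> \<tau>" "\<tau> \<le> 1" "\<theta> n (z - (\<tau> * d n) *\<^sub>R w) \<noteq> 0" for n z \<tau>
        using supp[OF that(1-3)] \<theta>(3)[OF that(1)] that(4) by blast
      show "m = n" if "m \<in> I" "n \<in> I" "0 \<le> \<tau>" "\<tau> \<le> 1" "\<theta> m (z - (\<tau> * d m) *\<^sub>R w) \<noteq> 0"
        "\<theta> n (z - (\<tau> * d n) *\<^sub>R w) \<noteq> 0" for m n z \<tau>
        using disj[OF that(1-4)] \<theta>(3)[OF that(1)] \<theta>(3)[OF that(2)] that(5,6) by blast
    qed
    show "real (card I) * (e / (real (card I) + 1)) \<le> e" using e by (simp add: field_simps)
  qed
  finally show "(\<Sum>n\<in>I. (1 / d n) * J n) \<le> C + e" .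
qed

text \<open>The unit ball is cut into slices of width \<open>\<eta> / 2\<close> across
  \<open>w\<close>; at most \<open>7 / \<eta>\<close> of them cover it, and each nonempty one can be
  translated along \<open>w\<close> into the slab.\<close>

lemma slab_measure_lower_bound:
  fixes w :: "'a::euclidean_space"
  assumes w: "norm w = 1" and \<eta>: "0 < \<eta>" "\<eta> \<le> 1" and A: "\<bar>\<alpha>\<bar> \<le> A"
  shows "measure lebesgue (ball (0::'a) 1) / 7 * \<eta>
    \<le> measure lebesgue {X. norm X < A + 4 \<and> \<alpha> < w \<bullet> X \<and> w \<bullet> X < \<alpha> + \<eta>}"
proof -
  define Q where "Q = {X. norm X < A + 4 \<and> \<alpha> < w \<bullet> X \<and> w \<bullet> X < \<alpha> + \<eta>}"
  define S where "S j = {X. norm X < 1 \<and> real_of_int j * (\<eta> / 2) \<le> w \<bullet> X \<and> w \<bullet> X < real_of_int (j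
      + 1) * (\<eta> / 2)}" for j
  define J where "J = \<lceil>2 / \<eta>\<rceil>"
  have ww: "w \<bullet> w = 1" using w by (simp add: norm_eq_1)
  have Qb: "Q = ball 0 (A + 4) \<inter> {X. \<alpha> < w \<bullet> X} \<inter> {X. w \<bullet> X < \<alpha> + \<eta>}" by (auto simp: Q_def)
  have "open Q" unfolding Qb by (intro open_Int open_halfspace_gt open_halfspace_lt open_ball)
  moreover have "bounded Q" unfolding Qb by (intro bounded_Int disjI1 bounded_ball)
  ultimately have Qm: "Q \<in> lmeasurable" by (rule lmeasurable_open[rotated])
  have Sb: "S j = ball 0 1 \<inter> {X. real_of_int j * (\<eta> / 2) \<le> w \<bullet> X} \<inter> {X. w \<bullet> X < real_of_int (j +
      1) * (\<eta> / 2)}" for j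
    by (auto simp: S_def)
  have "S j \<in> sets borel" for j
    unfolding Sb by (intro sets.Int borel_closed borel_open closed_halfspace_ge open_halfspace_lt
        open_ball)
  then have Sm: "S j \<in> sets lebesgue" for j by (intro sets_completionI_sets) simp
  have inner_le: "\<bar>w \<bullet> X\<bar> < 1" if "norm X < 1" for X
    using Cauchy_Schwarz_ineq2[of w X] w that by simp
  have mS: "measure lebesgue (S j) \<le> measure lebesgue Q" for j
  proof (cases "S j = {}")
    case False
    then obtain X0 where X0: "X0 \<in> S j" by auto
    \<comment> \<open>This shift places the lower face of the slice \<open>\<eta> / 4\<close> above
      that of the slab, so the translated slice lies in the middle half.\<close>
    define s where "s = \<alpha> + \<eta> / 4 - real_of_int j * (\<eta> / 2)"
    have "real_of_int (j + 1) * (\<eta> / 2) = real_of_int j * (\<eta> / 2) + \<eta> / 2" by (simp add: algebra_simps)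
    note j1 = this
    have "\<bar>real_of_int j * (\<eta> / 2)\<bar> \<le> 3 / 2"
      using X0 inner_le[of X0] \<eta> unfolding S_def mem_Collect_eq j1 by auto
    then have s: "\<bar>s\<bar> \<le> A + 2" using A \<eta> by (simp add: s_def)
    have sub: "(+) (s *\<^sub>R w) ` S j \<subseteq> Q"
    proof (clarsimp simp: Q_def)
      fix X assume X: "X \<in> S j"
      have "norm (s *\<^sub>R w + X) \<le> \<bar>s\<bar> + norm X" using norm_triangle_ineq[of "s *\<^sub>R w" X] w by simp
      then have "norm (s *\<^sub>R w + X) < A + 4" using s X by (simp add: S_def)
      then show "norm (s *\<^sub>R w + X) < A + 4 \<and> \<alpha> < w \<bullet> (s *\<^sub>R w + X) \<and> w \<bullet> (s *\<^sub>R w + X) < \<alpha> + \<eta>"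
        using X \<eta> unfolding S_def mem_Collect_eq j1 by (simp add: inner_add_right ww s_def)
    qed
    have "measure lebesgue (S j) = measure lebesgue ((+) (s *\<^sub>R w) ` S j)" by (simp add:
        measure_translation)
    also have "\<dots> \<le> measure lebesgue Q"
      by (rule measure_mono_fmeasurable[OF sub lebesgue_sets_translation[OF Sm] Qm])
    finally show ?thesis .
  qed simp
  have cov: "ball 0 1 \<subseteq> (\<Union>j\<in>{-J..J}. S j)"
  proof
    fix X :: 'a assume "X \<in> ball 0 1"
    then have X: "norm X < 1" by simp
    define j where "j = \<lfloor>(w \<bullet> X) / (\<eta> / 2)\<rfloor>"
    have j: "real_of_int j \<le> (w \<bullet> X) / (\<eta> / 2)" "(w \<bullet> X) / (\<eta> / 2) < real_of_int j + 1"
      by (simp_all add: j_def)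
    have "X \<in> S j" using X j \<eta>(1) by (simp add: S_def pos_le_divide_eq pos_divide_less_eq)
    moreover have "\<bar>(w \<bullet> X) / (\<eta> / 2)\<bar> \<le> 2 / \<eta>" using inner_le[OF X] \<eta>(1) by (simp add: field_simps)
    then have "\<bar>(w \<bullet> X) / (\<eta> / 2)\<bar> \<le> real_of_int J" unfolding J_def using le_of_int_ceiling[of "2
        / \<eta>"] by linarith
    then have "-J \<le> j" "j \<le> J" using j unfolding j_def by (linarith, linarith)
    ultimately show "X \<in> (\<Union>j\<in>{-J..J}. S j)" by auto
  qed
  have "measure lebesgue (ball (0::'a) 1) \<le> measure lebesgue (\<Union>j\<in>{-J..J}. S j)"
  proof (rule measure_mono_fmeasurable[OF cov])
    show "(\<Union>j\<in>{-J..J}. S j) \<in> lmeasurable"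
      by (rule bounded_set_imp_lmeasurable)
        (auto intro!: sets.finite_UN Sm bounded_UN bounded_subset[OF bounded_ball[of 0 1]] simp: S_def)
  qed auto
  also have "\<dots> \<le> (\<Sum>j\<in>{-J..J}. measure lebesgue (S j))" by (rule measure_UNION_le) (auto intro: Sm)
  also have "\<dots> \<le> (\<Sum>j\<in>{-J..J}. measure lebesgue Q)" by (rule sum_mono[OF mS])
  also have "\<dots> = real (nat (2 * J + 1)) * measure lebesgue Q" by simp
  also have "\<dots> \<le> 7 / \<eta> * measure lebesgue Q"
  proof (rule mult_right_mono)
    \<comment> \<open>\<open>2 * J + 1\<close> is at most \<open>4 / \<eta> + 3\<close>, and the 3
      is at most \<open>3 / \<eta>\<close>.\<close>
    have "real_of_int J \<le> 2 / \<eta> + 1" unfolding J_def by (rule of_int_ceiling_le_add_one)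
    moreover have "1 \<le> 1 / \<eta>" using \<eta> by simp
    moreover have "0 < 2 / \<eta>" using \<eta> by simp
    then have "0 \<le> J" unfolding J_def zero_le_ceiling by linarith
    ultimately show "real (nat (2 * J + 1)) \<le> 7 / \<eta>" by simp
  qed simp
  finally show ?thesis using \<eta>(1) unfolding Q_def[symmetric] by (simp add: field_simps)
qed

section \<open>Oscillation of the solution\<close>

lemma AE_lebesgue_translation:
  assumes "AE x in lebesgue. P x"
  shows "AE x in lebesgue. P (x + a :: 'a::euclidean_space)"
  using AE_distrD[OF measurable_lebesgue_translation[of a], of P, unfolded
      distr_lebesgue_translation, OF assms]
  by (simp add: add.commute)

context planar_train
begin

lemma c_strict_mono: "strict_mono c"
  by (rule strict_monoI_Suc) (rule c_mono)

lemma c_neg: "c n < 0"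
proof -
  have "c (Suc n) \<le> 0"
    using c_strict_mono by (intro incseq_le[OF _ c_lim]) (simp add: strict_mono_mono)
  then show ?thesis using c_mono[of n] by linarith
qed

lemma gap_unique:
  assumes "c m < x" "x < c (Suc m)" "c n < x" "x < c (Suc n)" shows "m = n"
proof -
  have "c m < c (Suc n)" "c n < c (Suc m)" using assms by linarith+
  then have "m < Suc n" "n < Suc m" using strict_mono_less[OF c_strict_mono] by blast+
  then show ?thesis by simp
qed

text \<open>Shocks of smaller index lie left of \<open>c n\<close>, those of larger index right of
  \<open>c (Suc n)\<close>; only the shock \<open>n\<close> is left undecided.\<close>

lemma centre_in_gap:
  assumes "c n < phase z" "phase z < c (Suc n)"
  shows "centre z = (if left_of_shock n z then c n else c (Suc n))"
proof -
  define n' where "n' = (if left_of_shock n z then n else Suc n)"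
  have "centre_upto N z = c n'" if "Suc n \<le> N" for N
  proof (rule centre_eq_if)
    show "\<not> left_of_shock j z" if "j < n'" for j
    proof (cases "j < n")
      case True
      then have "c (Suc j) \<le> c n" using strict_mono_less_eq[OF c_strict_mono] by simp
      then show ?thesis using left_of_shock_imp[of j z] assms by auto
    next
      case False
      then show ?thesis using that by (auto simp: n'_def split: if_splits) (metis less_SucE)
    qed
    show "left_of_shock j z" if "n' \<le> j" for j
    proof (cases "j = n")
      case True
      then show ?thesis using that by (auto simp: n'_def split: if_splits)
    next
      case False
      then have "Suc n \<le> j" using that by (auto simp: n'_def split: if_splits)
      then have "c (Suc n) \<le> c j" using strict_mono_less_eq[OF c_strict_mono] by simp
      then show ?thesis using left_of_shock_if[of z j] assms by auto
    qed
    show "n' \<le> N" using that by (auto simp: n'_def)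
  qed
  then have "\<forall>\<^sub>F N in sequentially. centre_upto N z = c n'"
    unfolding eventually_sequentially by blast
  then have "(\<lambda>N. centre_upto N z) \<longlonglongrightarrow> c n'" by (rule tendsto_eventually)
  from LIMSEQ_unique[OF centre_upto_tendsto this] show ?thesis by (simp add: n'_def)
qed

text \<open>At least one half of every gap lies in a single fan.\<close>

lemma single_fan_in_half_gap:
  obtains b \<alpha> where "c n \<le> \<alpha>" "\<alpha> + 3 / 8 * (c (Suc n) - c n) \<le> c (Suc n)"
    "\<And>x. \<alpha> < x \<Longrightarrow> x < \<alpha> + 3 / 8 * (c (Suc n) - c n) \<Longrightarrow> \<bar>x - b\<bar> \<le> (c (Suc n) - c n) / 2"
    "\<And>X. \<alpha> < phase (X, t) \<Longrightarrow> phase (X, t) < \<alpha> + 3 / 8 * (c (Suc n) - c n) \<Longrightarrow>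
       train (X, t) = B ((phase (X, t) - b) / time_shift t)"
proof -
  define l where "l = c (Suc n) - c n"
  have l: "0 < l" "c (Suc n) = c n + l" using c_mono[of n] by (auto simp: l_def)
  \<comment> \<open>The midpoint of the gap at time \<open>t\<close> decides: if it is left of the
    shock, the left half belongs to the fan of \<open>c n\<close>, otherwise the right half to that
    of \<open>c (Suc n)\<close>. The width 3/8 leaves room for a slab of width 1/8 and a shift by
    1/4 of the gap.\<close>
  define Y where "Y = (c n + l / 2 + lam * t) *\<^sub>R w"
  have Y: "phase (Y, t) = c n + l / 2" by (simp add: phase_def Y_def w_inner_w)
  have T: "T (X, t) = time_shift t" for X by (simp add: T_def)
  show ?thesis
  proof (cases "left_of_shock n (Y, t)")
    case True
    show ?thesis
    proof (rule that[of "c n" "c n"])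
      fix X assume X: "c n < phase (X, t)" "phase (X, t) < c n + 3 / 8 * (c (Suc n) - c n)"
      then have "left_of_shock n (X, t)"
        using l by (intro left_of_shock_downward[OF True]) (auto simp: Y T)
      moreover have "phase (X, t) < c (Suc n)" using X l by simp
      ultimately show "train (X, t) = B ((phase (X, t) - c n) / time_shift t)"
        using centre_in_gap[of n "(X, t)"] X by (simp add: train_def T)
    qed (use l in auto)
  next
    case False
    show ?thesis
    proof (rule that[of "c (Suc n) - 3 / 8 * l" "c (Suc n)"])
      fix X assume "c (Suc n) - 3 / 8 * l < phase (X, t)"
        "phase (X, t) < c (Suc n) - 3 / 8 * l + 3 / 8 * (c (Suc n) - c n)"
      then have X: "c (Suc n) - 3 / 8 * l < phase (X, t)" "phase (X, t) < c (Suc n)" by (auto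
          simp: l_def)
      have "\<not> left_of_shock n (X, t)"
        using left_of_shock_downward[of n "(X, t)" "(Y, t)"] False X l by (auto simp: Y T)
      moreover have "c n < phase (X, t)" using X l by simp
      ultimately show "train (X, t) = B ((phase (X, t) - c (Suc n)) / time_shift t)"
        using centre_in_gap[of n "(X, t)"] X by (simp add: train_def T)
    qed (use l in auto)
  qed
qed

lemma A_pos: "0 < A"
proof -
  have "h r - h 0 \<le> A * (max \<bar>0\<bar> \<bar>r\<bar>) ^ (p - 1) * (r - 0)" using r by (intro h_upper) auto
  then have "0 < A * (r ^ (p - 1) * r)" using h_r_pos h_0 r by (simp add: mult.assoc)
  moreover have "0 < r ^ (p - 1) * r" using r by simp
  ultimately show ?thesis by (rule zero_less_mult_pos2)
qed

definition hoelder_const :: real where "hoelder_const = (1 / a) powr (1 / p)"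
definition osc_const :: real where "osc_const = 1 / (2 * A * hoelder_const ^ (p - 1))"

lemma hoelder_const_pos: "0 < hoelder_const"
  using a by (simp add: hoelder_const_def)

lemma osc_const_pos: "0 < osc_const"
  using A_pos hoelder_const_pos by (simp add: osc_const_def)

lemma B_abs_le: "\<bar>\<xi>\<bar> \<le> m \<Longrightarrow> \<bar>B \<xi>\<bar> \<le> hoelder_const * m powr (1 / p)"
proof -
  assume "\<bar>\<xi>\<bar> \<le> m"
  then have "\<bar>\<xi>\<bar> powr (1 / p) \<le> m powr (1 / p)" by (intro powr_mono2) auto
  then have "hoelder_const * \<bar>\<xi>\<bar> powr (1 / p) \<le> hoelder_const * m powr (1 / p)"
    using hoelder_const_pos by simp
  then show ?thesis using B_hoelder[of \<xi> 0] by (simp add: B_0 hoelder_const_def)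
qed

text \<open>For arguments up to \<open>m\<close> the values of \<open>B\<close> are of order at most
  m^(1/p), where the slope of \<open>h\<close> is at most of order m^(1 - 1/p). An increment
  \<open>m / 2\<close> of \<open>h\<close> therefore forces an increment of order m^(1/p) of
  \<open>B\<close>: the Hoelder exponent is sharp at every scale.\<close>

lemma B_oscillation:
  assumes m: "0 < m" "m \<le> h r" "m \<le> - h (- r)"
    and \<xi>: "\<bar>\<xi>\<bar> \<le> m" "\<bar>\<xi>'\<bar> \<le> m" "\<xi>' - \<xi> = m / 2"
  shows "osc_const * m powr (1 / p) \<le> B \<xi>' - B \<xi>"
proof -
  define H where "H = hoelder_const"
  define q where "q = m powr (1 / p)"
  have Hq: "0 < H" "0 < q" using hoelder_const_pos m by (auto simp: H_def q_def)
  have le: "B \<xi> \<le> B \<xi>'" using \<xi> m by (intro B_mono) auto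
  have "m / 2 = h (B \<xi>') - h (B \<xi>)" using \<xi> m by (simp add: h_B clip_eq abs_le_iff)
  also have "\<dots> \<le> A * (max \<bar>B \<xi>\<bar> \<bar>B \<xi>'\<bar>) ^ (p - 1) * (B \<xi>' - B \<xi>)" by (intro h_upper B_bounds le)
  also have "\<dots> \<le> A * (H * q) ^ (p - 1) * (B \<xi>' - B \<xi>)"
    using A_pos le B_abs_le[OF \<xi>(1)] B_abs_le[OF \<xi>(2)]
    by (intro mult_right_mono mult_left_mono power_mono) (auto simp: H_def q_def)
  finally have 1: "m / 2 \<le> A * (H * q) ^ (p - 1) * (B \<xi>' - B \<xi>)" .
  have "m = q ^ p" using m p by (simp add: q_def powr_realpow[symmetric] powr_powr)
  also have "\<dots> = q ^ (p - 1) * q" using p by (metis power_minus_mult)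
  finally have m': "m = q ^ (p - 1) * q" .
  have "q ^ (p - 1) * (q / 2) \<le> q ^ (p - 1) * (A * H ^ (p - 1) * (B \<xi>' - B \<xi>))"
    using 1 unfolding power_mult_distrib by (subst (asm) m') (simp add: ac_simps)
  then have 2: "q / 2 \<le> A * H ^ (p - 1) * (B \<xi>' - B \<xi>)"
    by (rule mult_left_le_imp_le) (use Hq in simp)
  define K where "K = A * H ^ (p - 1)"
  have K: "0 < K" using A_pos Hq by (simp add: K_def)
  have "q \<le> (B \<xi>' - B \<xi>) * (2 * K)" using 2 unfolding K_def[symmetric] by (simp add: mult.commute)
  then have "q / (2 * K) \<le> B \<xi>' - B \<xi>" using K by (simp add: pos_divide_le_eq)
  then show ?thesis unfolding osc_const_def H_def[symmetric] q_def[symmetric] K_def by (simp add: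
      mult.assoc)
qed

section \<open>Variation forced on an inner function\<close>

definition slab_weight :: "real \<Rightarrow> real \<Rightarrow> real \<Rightarrow> 'a \<Rightarrow> real" where
  "slab_weight R \<beta> \<eta> X = pos_sq (R\<^sup>2 - X \<bullet> X) * (pos_sq (w \<bullet> X - \<beta>) * pos_sq (\<beta> + \<eta> - w \<bullet> X))"

lemma C1_slab_weight: "\<exists>M'. C1_deriv (slab_weight R \<beta> \<eta>) M'"
proof -
  have 1: "C1_deriv (\<lambda>X. pos_sq (R\<^sup>2 - X \<bullet> X)) (\<lambda>X v. 2 * max 0 (R\<^sup>2 - X \<bullet> X) * (0 - 2 * (X \<bullet> v)))"
    by (intro C1_deriv_pos_sq C1_deriv_diff C1_deriv_const C1_deriv_inner_self)
  have 2: "C1_deriv (\<lambda>X. pos_sq (w \<bullet> X - \<beta>)) (\<lambda>X v. 2 * max 0 (w \<bullet> X - \<beta>) * (w \<bullet> v - 0))"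
    by (intro C1_deriv_pos_sq C1_deriv_diff C1_deriv_const C1_deriv_bounded_linear
        bounded_linear_inner_right)
  have 3: "C1_deriv (\<lambda>X. pos_sq (\<beta> + \<eta> - w \<bullet> X)) (\<lambda>X v. 2 * max 0 (\<beta> + \<eta> - w \<bullet> X) * (0 - w \<bullet> v))"
    by (intro C1_deriv_pos_sq C1_deriv_diff C1_deriv_const C1_deriv_bounded_linear
        bounded_linear_inner_right)
  note * = C1_deriv_mult[OF 1 C1_deriv_mult[OF 2 3]]
  show ?thesis unfolding slab_weight_def[abs_def] by (rule exI, rule *)
qed

lemma slab_weight_nonneg: "0 \<le> slab_weight R \<beta> \<eta> X"
  unfolding slab_weight_def by (intro mult_nonneg_nonneg pos_sq_nonneg)

lemma slab_weight_nonzero_iff: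
  assumes "0 < R"
  shows "slab_weight R \<beta> \<eta> X \<noteq> 0 \<longleftrightarrow> norm X < R \<and> \<beta> < w \<bullet> X \<and> w \<bullet> X < \<beta> + \<eta>"
proof -
  have nz: "pos_sq y \<noteq> 0 \<longleftrightarrow> 0 < y" for y using pos_sq_pos_iff[of y] pos_sq_nonneg[of y] by linarith
  have "0 < R\<^sup>2 - X \<bullet> X \<longleftrightarrow> norm X < R"
    using assms by (simp add: norm_lt_square)
  then show ?thesis unfolding slab_weight_def mult_eq_0_iff de_Morgan_disj nz by auto
qed

text \<open>In a late gap of length l, a shift by l/4 changes the state by at least a multiple of
  l^(1/p), hence \<open>v\<close> by a multiple of l^\<theta> with
  \<open>\<theta> = 1 / (p * \<sigma>)\<close>. The slab where this happens has measure of order l,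
  which cancels the division by the shift. So each such gap takes a multiple of l^\<theta> out of
  the finite variation of \<open>v\<close> in a fixed ball.\<close>

lemma U_not_in_BV_pow_loc:
  fixes \<sigma> :: real
  assumes \<sigma>: "0 < \<sigma>" and div: "\<not> summable (\<lambda>n. (c (Suc n) - c n) powr (1 / (real p * \<sigma>)))"
  shows "(\<lambda>X. U X t) \<notin> BV_pow_loc \<sigma>"
proof
  assume "(\<lambda>X. U X t) \<in> BV_pow_loc \<sigma>"
  then obtain L v where L: "L \<in> Lip_pow \<sigma>" and v: "v \<in> BV_loc" and Lv: "AE X in lebesgue. U X t =
      L (v X)"
    unfolding BV_pow_loc_def by blast
  obtain C0 where C0: "\<And>a b. \<bar>L a - L b\<bar> \<le> C0 * \<bar>a - b\<bar> powr \<sigma>" using L unfolding Lip_pow_def by blast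
  define C where "C = max C0 1"
  have C: "0 < C" "\<bar>L a - L b\<bar> \<le> C * \<bar>a - b\<bar> powr \<sigma>" for a b
    using C0[of a b] mult_right_mono[of C0 C "\<bar>a - b\<bar> powr \<sigma>"] by (auto simp: C_def)
  have vL: "v \<in> L1_loc" using v by (simp add: BV_loc_def)
  define \<tau> where "\<tau> = time_shift t"
  have \<tau>: "0 < \<tau>" unfolding \<tau>_def by (rule time_shift_pos)
  define \<theta> where "\<theta> = 1 / (real p * \<sigma>)"

  have "(\<lambda>n. c (Suc n) - c n) \<longlonglongrightarrow> 0" by (rule summable_LIMSEQ_zero[OF summable_gaps])
  \<comment> \<open>Finitely many gaps are dropped. The bound 8 makes slabs of width
    \<open>l i / 8\<close> at most 1 thick and shifts at most 2 long; the other bound keeps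
    similarity variables in the range of \<open>h\<close>, where \<open>clip\<close> is the
    identity.\<close>
  moreover define m0 where "m0 = min 8 (\<tau> * min (h r) (- h (- r)))"
  have "0 < m0" using \<tau> h_r_pos h_minus_r_neg by (simp add: m0_def)
  ultimately have "\<forall>\<^sub>F n in sequentially. c (Suc n) - c n < m0" by (rule order_tendstoD(2))
  then obtain n0 where n0: "\<And>n. n0 \<le> n \<Longrightarrow> c (Suc n) - c n < m0" unfolding eventually_sequentially
      by blast
  define l where "l i = c (Suc (i + n0)) - c (i + n0)" for i
  have l: "0 < l i" "l i \<le> 8" "l i / \<tau> \<le> h r" "l i / \<tau> \<le> - h (- r)" "c (Suc (i + n0)) = c (i + n0)
      + l i" for i
  proof -
    show "0 < l i" "c (Suc (i + n0)) = c (i + n0) + l i" using c_mono[of "i + n0"] by (auto simp: l_def)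
    have "l i < m0" using n0[of "i + n0"] by (simp add: l_def)
    then have "l i \<le> 8" "l i \<le> \<tau> * h r" "l i \<le> \<tau> * (- h (- r))"
      using \<tau> by (auto simp: m0_def min_mult_distrib_left)
    then show "l i \<le> 8" "l i / \<tau> \<le> h r" "l i / \<tau> \<le> - h (- r)"
      using \<tau> by (auto simp: pos_divide_le_eq mult.commute)
  qed

  have "\<forall>i. \<exists>b \<alpha>. c (i + n0) \<le> \<alpha> \<and> \<alpha> + 3 / 8 * l i \<le> c (Suc (i + n0)) \<and>
    (\<forall>x. \<alpha> < x \<longrightarrow> x < \<alpha> + 3 / 8 * l i \<longrightarrow> \<bar>x - b\<bar> \<le> l i / 2) \<and>
    (\<forall>X. \<alpha> < phase (X, t) \<longrightarrow> phase (X, t) < \<alpha> + 3 / 8 * l i \<longrightarrow> train (X, t) = B ((phase (X, t) - b) / \<tau>))"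
    unfolding l_def \<tau>_def by (metis single_fan_in_half_gap)
  then obtain b \<alpha> where ba: "\<And>i. c (i + n0) \<le> \<alpha> i \<and> \<alpha> i + 3 / 8 * l i \<le> c (Suc (i + n0)) \<and>
    (\<forall>x. \<alpha> i < x \<longrightarrow> x < \<alpha> i + 3 / 8 * l i \<longrightarrow> \<bar>x - b i\<bar> \<le> l i / 2) \<and>
    (\<forall>X. \<alpha> i < phase (X, t) \<longrightarrow> phase (X, t) < \<alpha> i + 3 / 8 * l i \<longrightarrow> train (X, t) = B ((phase (X, t) -
        b i) / \<tau>))"
    by metis
  have \<alpha>: "c (i + n0) \<le> \<alpha> i" "\<alpha> i + 3 / 8 * l i \<le> c (Suc (i + n0))"
    and fan: "\<alpha> i < x \<Longrightarrow> x < \<alpha> i + 3 / 8 * l i \<Longrightarrow> \<bar>x - b i\<bar> \<le> l i / 2"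
    "\<alpha> i < phase (X, t) \<Longrightarrow> phase (X, t) < \<alpha> i + 3 / 8 * l i \<Longrightarrow> train (X, t) = B ((phase (X, t) - b
        i) / \<tau>)" for i x X
    using ba[of i] by blast+

  \<comment> \<open>This shift changes the similarity variable by \<open>m / 2\<close> for
    \<open>m = l i / (2 * \<tau>)\<close>, as \<open>B_oscillation\<close> requires.\<close>
  define d where "d i = l i / 4" for i
  have ph: "phase (X, t) = w \<bullet> X - lam * t" for X by (simp add: phase_def)
  have ph_shift: "phase (X + s *\<^sub>R w, t) = phase (X, t) + s" for X s
    by (simp add: ph inner_add_right w_inner_w)

  define K where "K = (osc_const * (1 / (2 * \<tau>)) powr (1 / p) / C) powr (1 / \<sigma>)"
  have K: "0 < K" using osc_const_pos \<tau> C(1) by (simp add: K_def)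
  have osc: "K * l i powr \<theta> \<le> \<bar>v (X + d i *\<^sub>R w) - v X\<bar>"
    if X: "\<alpha> i < phase (X, t)" "phase (X, t) < \<alpha> i + l i / 8"
      and Lv: "U X t = L (v X)" "U (X + d i *\<^sub>R w) t = L (v (X + d i *\<^sub>R w))" for X i
  proof -
    define m where "m = l i / (2 * \<tau>)"
    have m: "0 < m" "m \<le> h r" "m \<le> - h (- r)"
    proof -
      define y where "y = l i / \<tau>"
      have "m = y / 2" "0 < y" "y \<le> h r" "y \<le> - h (- r)"
        using l(1,3,4)[of i] \<tau> by (simp_all add: m_def y_def)
      then show "0 < m" "m \<le> h r" "m \<le> - h (- r)" by simp_all
    qed
    let ?x = "phase (X, t)"
    have X': "\<alpha> i < ?x + d i" "?x + d i < \<alpha> i + 3 / 8 * l i" "?x < \<alpha> i + 3 / 8 * l i"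
      using X l(1)[of i] by (auto simp: d_def)
    have tr: "train (X, t) = B ((?x - b i) / \<tau>)" "train (X + d i *\<^sub>R w, t) = B ((?x + d i - b i) / \<tau>)"
      using fan(2)[of i X] fan(2)[of i "X + d i *\<^sub>R w"] X X' by (simp_all add: ph_shift)
    have small: "\<bar>(y - b i) / \<tau>\<bar> \<le> m" if "\<bar>y - b i\<bar> \<le> l i / 2" for y
      using that \<tau> by (simp add: m_def abs_divide divide_le_eq)
    have "osc_const * m powr (1 / p) \<le> B ((?x + d i - b i) / \<tau>) - B ((?x - b i) / \<tau>)"
    proof (rule B_oscillation[OF m])
      show "\<bar>(?x - b i) / \<tau>\<bar> \<le> m" "\<bar>(?x + d i - b i) / \<tau>\<bar> \<le> m"
        using fan(1) X X' by (intro small; simp)+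
      show "(?x + d i - b i) / \<tau> - (?x - b i) / \<tau> = m / 2"
        by (simp add: m_def d_def diff_divide_distrib[symmetric])
    qed
    also have "\<dots> = L (v (X + d i *\<^sub>R w)) - L (v X)"
      unfolding Lv[symmetric] by (simp add: U_def tr)
    also have "\<dots> \<le> C * \<bar>v (X + d i *\<^sub>R w) - v X\<bar> powr \<sigma>" using C(2)[of "v (X + d i *\<^sub>R w)" "v X"]
        by linarith
    finally have "osc_const * m powr (1 / p) / C \<le> \<bar>v (X + d i *\<^sub>R w) - v X\<bar> powr \<sigma>"
      using C(1) by (simp add: pos_divide_le_eq mult.commute)
    then have "(osc_const * m powr (1 / p) / C) powr (1 / \<sigma>) \<le> (\<bar>v (X + d i *\<^sub>R w) - v X\<bar> powr \<sigma>)
        powr (1 / \<sigma>)"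
      using osc_const_pos C(1) \<sigma> by (intro powr_mono2) auto
    also have "\<dots> = \<bar>v (X + d i *\<^sub>R w) - v X\<bar>" using \<sigma> by (simp add: powr_powr)
    also have "(osc_const * m powr (1 / p) / C) powr (1 / \<sigma>) = K * l i powr \<theta>"
    proof -
      have m1: "m powr (1 / p) = (1 / (2 * \<tau>)) powr (1 / p) * l i powr (1 / p)"
        unfolding powr_mult[symmetric] by (simp add: m_def)
      have "osc_const * m powr (1 / p) / C = (osc_const * (1 / (2 * \<tau>)) powr (1 / p) / C) * l i
          powr (1 / p)"
        unfolding m1 by simp
      then have "(osc_const * m powr (1 / p) / C) powr (1 / \<sigma>) = K * (l i powr (1 / p)) powr (1 / \<sigma>)"
        unfolding K_def by (simp only: powr_mult)
      then show ?thesis by (simp add: powr_powr \<theta>_def)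
    qed
    finally show ?thesis .
  qed

  \<comment> \<open>A common bound for the positions of all slabs at time \<open>t\<close>; the 4 in
    \<open>R0\<close> is the one of \<open>slab_measure_lower_bound\<close>.\<close>
  define A0 where "A0 = \<bar>lam * t\<bar> + \<bar>c 0\<bar>"
  define R0 where "R0 = A0 + 4"
  have R0: "0 < R0" by (simp add: R0_def A0_def)
  define \<beta> where "\<beta> i = lam * t + \<alpha> i" for i
  have \<beta>: "\<bar>\<beta> i\<bar> \<le> A0" for i
  proof -
    have "c 0 \<le> c (i + n0)" using strict_mono_less_eq[OF c_strict_mono] by simp
    moreover have "\<alpha> i \<le> 0" using \<alpha>(2)[of i] c_neg[of "Suc (i + n0)"] l(1)[of i] by linarith
    ultimately have "\<bar>\<alpha> i\<bar> \<le> \<bar>c 0\<bar>" using \<alpha>(1)[of i] by linarith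
    then show ?thesis by (simp add: \<beta>_def A0_def)
  qed
  define M where "M i = slab_weight R0 (\<beta> i) (l i / 8)" for i
  have M0: "M i X \<noteq> 0 \<longleftrightarrow> norm X < R0 \<and> \<beta> i < w \<bullet> X \<and> w \<bullet> X < \<beta> i + l i / 8" for i X
    unfolding M_def by (rule slab_weight_nonzero_iff[OF R0])
  have "\<exists>M'. \<forall>i. C1_deriv (M i) (M' i)" unfolding M_def by (intro choice allI C1_slab_weight)
  then obtain M' where M': "\<forall>i. C1_deriv (M i) (M' i)" by (elim exE)

  define S where "S = {LINT x:ball 0 (R0 + 3)|lebesgue. v x * divergence \<phi> x | \<phi>.
          C_k 1 \<phi> \<and> compactly_supported_in (ball 0 (R0 + 3)) \<phi> \<and> (\<forall>x. norm (\<phi> x) \<le> 1)}"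
  have "bdd_above S" using v unfolding BV_loc_def S_def by simp
  then obtain D where D: "\<And>s. s \<in> S \<Longrightarrow> s \<le> D" unfolding bdd_above_def by blast

  have ballpos: "0 < measure lebesgue (ball (0::'a) 1)" by (simp add: content_ball_pos)
  \<comment> \<open>The final factor 1/2 is the slab width \<open>l i / 8\<close> divided by the
    shift \<open>l i / 4\<close>.\<close>
  define \<kappa> where "\<kappa> = K * (measure lebesgue (ball (0::'a) 1) / 7) / 2"
  have \<kappa>: "0 < \<kappa>" using K ballpos by (simp add: \<kappa>_def)
  have each: "\<kappa> * l i powr \<theta>
      \<le> (1 / d i) * (\<integral>X. indicator {z. M i z \<noteq> 0} X * \<bar>v (X + d i *\<^sub>R w) - v X\<bar> \<partial>lebesgue)" for i
  proof -
    let ?O = "{z. M i z \<noteq> 0}"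
    have contM: "continuous_on UNIV (M i)" using C1_deriv_imp_continuous[OF M'[rule_format]] .
    have "open ?O" by (intro open_Collect_neq contM continuous_intros)
    then have Os: "?O \<in> sets lebesgue" by auto
    have "bounded ?O" using M0 by (intro boundedI[of _ R0]) (auto intro: less_imp_le)
    then have Om: "?O \<in> lmeasurable" using Os by (rule bounded_set_imp_lmeasurable)
    have "?O = {X. norm X < A0 + 4 \<and> \<beta> i < w \<bullet> X \<and> w \<bullet> X < \<beta> i + l i / 8}"
      using M0 by (auto simp: R0_def)
    then have mO: "measure lebesgue (ball (0::'a) 1) / 7 * (l i / 8) \<le> measure lebesgue ?O"
      using slab_measure_lower_bound[OF norm_w _ _ \<beta>, of "l i / 8" i] l(1,2)[of i] by simp
    have "(\<lambda>X. v (X + d i *\<^sub>R w) - v X) \<in> L1_loc" by (intro L1_loc_diff L1_loc_translate vL)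
    then have "integrable lebesgue (\<lambda>X. (v (X + d i *\<^sub>R w) - v X) * indicator ?O X)"
    proof (rule integrable_L1_loc_mult[where B=1])
      show "indicator ?O \<in> borel_measurable lebesgue" using Os by (rule borel_measurable_indicator)
      show "bounded_support (indicator ?O :: 'a \<Rightarrow> real)"
        unfolding bounded_support_def using M0 by (intro exI[of _ R0]) (auto simp: indicator_def)
    qed (auto simp: indicator_def)
    then have "integrable lebesgue (\<lambda>X. \<bar>(v (X + d i *\<^sub>R w) - v X) * indicator ?O X\<bar>)" by (rule
        integrable_abs)
    then have int: "integrable lebesgue (\<lambda>X. indicator ?O X * \<bar>v (X + d i *\<^sub>R w) - v X\<bar>)"
      by (simp add: abs_mult mult.commute)
    have int2: "integrable lebesgue (\<lambda>X. (K * l i powr \<theta>) * indicator ?O X)"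
      by (intro integrable_mult_right integrable_real_indicator Os)
        (use Om in \<open>simp add: fmeasurable_def del: emeasure_completion\<close>)
    have "AE X in lebesgue. (K * l i powr \<theta>) * indicator ?O X \<le> indicator ?O X * \<bar>v (X + d i *\<^sub>R
        w) - v X\<bar>"
      \<comment> \<open>The factorisation is used at \<open>X\<close> and at its translate, each
        time off a null set.\<close>
      using Lv AE_lebesgue_translation[OF Lv, of "d i *\<^sub>R w"]
    proof eventually_elim
      case (elim X)
      show ?case
      proof (cases "M i X = 0")
        case False
        then have "\<alpha> i < phase (X, t)" "phase (X, t) < \<alpha> i + l i / 8"
          using M0[of i X] by (auto simp: ph \<beta>_def)
        from osc[OF this elim] False show ?thesis by simp
      qed simp
    qed
    from integral_mono_AE[OF int2 int this]
    have "(K * l i powr \<theta>) * measure lebesgue ?O \<le> (\<integral>X. indicator ?O X * \<bar>v (X + d i *\<^sub>R w) - v X\<bar>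
        \<partial>lebesgue)"
      by simp
    moreover have "(K * l i powr \<theta>) * (measure lebesgue (ball (0::'a) 1) / 7 * (l i / 8)) \<le> (K * l
        i powr \<theta>) * measure lebesgue ?O"
      using mO K by (intro mult_left_mono) auto
    ultimately have "(1 / d i) * ((K * l i powr \<theta>) * (measure lebesgue (ball (0::'a) 1) / 7 * (l i
        / 8)))
      \<le> (1 / d i) * (\<integral>X. indicator ?O X * \<bar>v (X + d i *\<^sub>R w) - v X\<bar> \<partial>lebesgue)"
      using l(1)[of i] by (intro mult_left_mono) (auto simp: d_def)
    moreover have "(1 / d i) * ((K * l i powr \<theta>) * (measure lebesgue (ball (0::'a) 1) / 7 * (l i /
        8))) = \<kappa> * l i powr \<theta>"
      using l(1)[of i] by (simp add: d_def \<kappa>_def)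
    ultimately show ?thesis by simp
  qed

  have sums: "(\<Sum>i<N. \<kappa> * l i powr \<theta>) \<le> D" for N
  proof -
    have "(\<Sum>i<N. \<kappa> * l i powr \<theta>) \<le> (\<Sum>i<N. (1 / d i) * (\<integral>X. indicator {z. M i z \<noteq> 0} X * \<bar>v (X + d
        i *\<^sub>R w) - v X\<bar> \<partial>lebesgue))"
      by (rule sum_mono[OF each])
    also have "\<dots> \<le> D"
    proof (rule BV_translation_estimate[OF vL norm_w, where R="R0 + 3" and R'="R0 + 2" and M=M and
        M'=M'])
      show "(LINT x:ball 0 (R0 + 3)|lebesgue. v x * divergence \<phi> x) \<le> D"
        if "C_k 1 \<phi>" "compactly_supported_in (ball 0 (R0 + 3)) \<phi>" "\<And>x. norm (\<phi> x) \<le> 1" for \<phi>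
        by (rule D) (use that in \<open>auto simp: S_def\<close>)
      show "C1_deriv (M n) (M' n)" for n using M' by simp
      show "0 \<le> M n z" for n z unfolding M_def by (rule slab_weight_nonneg)
      show "0 < d n" for n using l(1) by (simp add: d_def)
      have ds: "0 \<le> s * d n" "s * d n \<le> l n / 4" if "0 \<le> s" "s \<le> 1" for s n
        using that l(1)[of n] mult_right_mono[of s 1 "d n"] by (auto simp: d_def)
      show "norm z \<le> R0 + 2" if "0 \<le> s" "s \<le> 1" "M n (z - (s * d n) *\<^sub>R w) \<noteq> 0" for n z s
      proof -
        have "norm (z - (s * d n) *\<^sub>R w) < R0" using that(3) M0 by blast
        moreover have "norm z \<le> norm (z - (s * d n) *\<^sub>R w) + norm ((s * d n) *\<^sub>R w)"
          using norm_triangle_ineq[of "z - (s * d n) *\<^sub>R w" "(s * d n) *\<^sub>R w"] by simp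
        moreover have "norm ((s * d n) *\<^sub>R w) = s * d n" using ds(1)[OF that(1,2)] norm_w by simp
        ultimately show ?thesis using ds(2)[OF that(1,2), of n] l(2)[of n] by linarith
      qed
      have gap: "c (n + n0) < phase (z, t) \<and> phase (z, t) < c (Suc (n + n0))"
        if "0 \<le> s" "s \<le> 1" "M n (z - (s * d n) *\<^sub>R w) \<noteq> 0" for n z s
      proof -
        have "\<beta> n < w \<bullet> (z - (s * d n) *\<^sub>R w)" "w \<bullet> (z - (s * d n) *\<^sub>R w) < \<beta> n + l n / 8"
          using that(3) M0 by blast+
        moreover have "w \<bullet> (z - (s * d n) *\<^sub>R w) = w \<bullet> z - s * d n" by (simp add: inner_diff_right
            w_inner_w)
        ultimately show ?thesis
          using ds[OF that(1,2), of n] \<alpha>[of n] l(1)[of n] unfolding ph \<beta>_def by linarith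
      qed
      show "m = n" if "0 \<le> s" "s \<le> 1" "M m (z - (s * d m) *\<^sub>R w) \<noteq> 0" "M n (z - (s * d n) *\<^sub>R w) \<noteq>
          0" for m n z s
        using gap_unique[of "m + n0" "phase (z, t)" "n + n0"] gap[OF that(1,2,3)] gap[OF
            that(1,2,4)] by simp
    qed auto
    finally show ?thesis .
  qed
  have "summable (\<lambda>i. \<kappa> * l i powr \<theta>)"
    by (rule summableI_nonneg_bounded[OF _ sums]) (use \<kappa> in simp)
  then have "summable (\<lambda>i. l i powr \<theta>)" using \<kappa> by simp
  then have "summable (\<lambda>n. (c (Suc n) - c n) powr \<theta>)"
    unfolding l_def by (subst (asm) summable_iff_shift[of "\<lambda>n. (c (Suc n) - c n) powr \<theta>" n0]) 
  then show False using div by (simp add: \<theta>_def)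
qed

end

section \<open>Choice of the flux direction and of the centres\<close>

lemma C_infinity_vector_derivative:
  fixes f :: "real \<Rightarrow> 'b::euclidean_space"
  assumes "C_infinity f"
  shows "(f has_vector_derivative vector_derivative f (at x)) (at x)"
    and "C_infinity (\<lambda>x. vector_derivative f (at x))"
proof -
  have C: "C_k (Suc k) f" for k using assms by (simp add: C_infinity_def)
  have d: "(f has_vector_derivative vector_derivative f (at x)) (at x)" for x
    using C[of 0] vector_derivative_works by auto
  then show "(f has_vector_derivative vector_derivative f (at x)) (at x)" .
  have "frechet_derivative f (at x) 1 = vector_derivative f (at x)" for x
    using frechet_derivative_at[OF d[of x, unfolded has_vector_derivative_def]] by (metis scaleR_one)
  moreover have "C_k k (\<lambda>x. frechet_derivative f (at x) 1)" for k using C[of k] by simp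
  ultimately show "C_infinity (\<lambda>x. vector_derivative f (at x))" by (simp add: C_infinity_def)
qed

lemma nth_derivative_Suc: "nth_derivative (Suc n) F x = vector_derivative (nth_derivative n F) (at x)"
  by (simp add: nth_derivative_def)

lemma C_infinity_nth_derivative: "C_infinity F \<Longrightarrow> C_infinity (nth_derivative n F)"
proof (induction n)
  case (Suc n)
  have "nth_derivative (Suc n) F = (\<lambda>x. vector_derivative (nth_derivative n F) (at x))"
    by (rule ext) (rule nth_derivative_Suc)
  then show ?case using C_infinity_vector_derivative(2)[OF Suc.IH[OF Suc.prems]] by simp
qed (simp add: nth_derivative_def)

lemma DERIV_inner_nth_derivative:
  assumes "C_infinity F"
  shows "((\<lambda>x. w \<bullet> nth_derivative n F x) has_real_derivative w \<bullet> nth_derivative (Suc n) F x) (at x)"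
proof -
  have "(nth_derivative n F has_vector_derivative nth_derivative (Suc n) F x) (at x)"
    using C_infinity_vector_derivative(1)[OF C_infinity_nth_derivative[OF assms]] by (simp add:
        nth_derivative_Suc)
  from bounded_linear.has_vector_derivative[OF bounded_linear_inner_right this, of w]
  show ?thesis by (simp add: has_real_derivative_iff_has_vector_derivative)
qed

text \<open>A finite supremum of extended naturals is attained: if all values were below
  \<open>p\<close>, then \<open>p - 1\<close> would already bound them. At a point of attainment,
  minimality of \<open>p\<close> separates the two spans.\<close>

lemma nonlinearity_index_attained:
  fixes F :: "real \<Rightarrow> 'a::euclidean_space"
  assumes idx: "nonlinearity_index F a b = enat p" and "a \<le> b"
  obtains u where "1 \<le> p" "span ((\<lambda>j. nth_derivative j F u) ` {2..p + 1}) = UNIV"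
    "span ((\<lambda>j. nth_derivative j F u) ` {2..p}) \<noteq> UNIV"
proof -
  define S where "S u = {k::nat. k \<ge> 1 \<and> span ((\<lambda>j. nth_derivative j F u) ` {2..k+1}) = UNIV}" for u
  define I where "I u = (INF k\<in>S u. enat k)" for u
  have sup: "(SUP u\<in>{a..b}. I u) = enat p" using idx by (simp add: nonlinearity_index_def I_def S_def)
  have "\<exists>u\<in>{a..b}. I u = enat p"
  proof (rule ccontr)
    assume "\<not> ?thesis"
    moreover have "I u \<le> enat p" if "u \<in> {a..b}" for u using SUP_upper[OF that, of I] sup by simp
    ultimately have lt: "I u < enat p" if "u \<in> {a..b}" for u using that by (meson order_le_neq_trans)
    have "I a < enat p" using lt \<open>a \<le> b\<close> by simp
    then obtain q where q: "p = Suc q" by (cases p) (auto simp: zero_enat_def[symmetric])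
    have "I u \<le> enat q" if "u \<in> {a..b}" for u using lt[OF that] q by (cases "I u") auto
    then have "(SUP u\<in>{a..b}. I u) \<le> enat q" by (rule SUP_least)
    then show False using sup q by simp
  qed
  then obtain u where u: "I u = enat p" by blast
  have "S u \<noteq> {}" using u by (auto simp: I_def Inf_enat_def top_enat_def)
  then have "enat p \<in> enat ` S u"
    using u LeastI_ex[of "\<lambda>x. x \<in> enat ` S u"] by (auto simp: I_def Inf_enat_def)
  then have p: "p \<in> S u" by auto
  have min: "p \<le> k" if "k \<in> S u" for k using INF_lower[OF that, of enat] u by (simp add: I_def)
  have "span ((\<lambda>j. nth_derivative j F u) ` {2..p}) \<noteq> UNIV"
  \<comment> \<open>For \<open>p = 1\<close> the index set \<open>{2..p}\<close> is empty and its
    span is the zero space, which misses every basis vector.\<close>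
  proof (cases "p = 1")
    case True
    have "(SOME i. i \<in> Basis) \<in> (Basis :: 'a set)" by (simp add: some_in_eq)
    then have "(SOME i. i \<in> Basis) \<noteq> (0::'a)" by (rule nonzero_Basis)
    then show ?thesis using True by auto
  next
    case False
    then have "p - 1 \<notin> S u" using min[of "p - 1"] p by (auto simp: S_def)
    then show ?thesis using False p by (auto simp: S_def)
  qed
  then show ?thesis using that[of u] p by (simp add: S_def)
qed

text \<open>A nonzero vector orthogonal to the smaller span cannot be orthogonal to
  \<open>V (p + 1)\<close> as well, or it would be orthogonal to the whole space; its sign is then
  adjusted.\<close>

lemma flux_direction:
  fixes V :: "nat \<Rightarrow> 'a::euclidean_space"
  assumes "span (V ` {2..p + 1}) = UNIV" "span (V ` {2..p}) \<noteq> UNIV" "1 \<le> p"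
  obtains w where "norm w = 1" "\<And>j. 2 \<le> j \<Longrightarrow> j \<le> p \<Longrightarrow> w \<bullet> V j = 0" "0 < w \<bullet> V (p + 1)"
proof -
  obtain e where e: "e \<noteq> 0" "\<forall>x\<in>span (V ` {2..p}). e \<bullet> x = 0"
    using span_not_UNIV_orthogonal[OF assms(2)] by blast
  have ej: "e \<bullet> V j = 0" if "2 \<le> j" "j \<le> p" for j using e(2) span_base[of "V j" "V ` {2..p}"] that
      by auto
  have "e \<bullet> V (p + 1) \<noteq> 0"
  proof
    assume "e \<bullet> V (p + 1) = 0"
    then have "orthogonal e y" if "y \<in> V ` {2..p + 1}" for y
      using that ej by (auto simp: orthogonal_def le_Suc_eq)
    then have "orthogonal e e" using orthogonal_to_span[of e "V ` {2..p + 1}" e] assms(1) by simp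
    then show False using e(1) by (simp add: orthogonal_self)
  qed
  define w where "w = (sgn (e \<bullet> V (p + 1)) / norm e) *\<^sub>R e"
  show ?thesis
  proof (rule that[of w])
    show "norm w = 1" using e(1) \<open>e \<bullet> V (p + 1) \<noteq> 0\<close> by (simp add: w_def abs_sgn_eq)
    show "w \<bullet> V j = 0" if "2 \<le> j" "j \<le> p" for j using ej[OF that] by (simp add: w_def)
    have "w \<bullet> V (p + 1) = \<bar>e \<bullet> V (p + 1)\<bar> / norm e" by (simp add: w_def abs_sgn mult.commute)
    then show "0 < w \<bullet> V (p + 1)" using e(1) \<open>e \<bullet> V (p + 1) \<noteq> 0\<close> by simp
  qed
qed

section \<open>Local comparison of the flux with an even power\<close>

lemma power_superadditive:
  fixes x y :: real
  assumes "0 \<le> x" "0 \<le> y" "0 < p" shows "x ^ p + y ^ p \<le> (x + y) ^ p"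
  using assms(3)
proof (induction p rule: nat_induct_non_zero)
  case (Suc p)
  have "x ^ Suc p + y ^ Suc p \<le> (x + y) * (x ^ p + y ^ p)"
    using assms(1,2) by (simp add: algebra_simps)
  also have "\<dots> \<le> (x + y) * (x + y) ^ p" using Suc assms(1,2) by (intro mult_left_mono) auto
  finally show ?case by simp
qed simp

text \<open>For arguments of equal sign this is superadditivity of the power. For opposite signs
  \<open>y - x\<close> is at most twice the larger modulus, whence the factor
  \<open>2 ^ p\<close>.\<close>

lemma odd_power_diff_lower:
  fixes x y :: real
  assumes "odd p" "x \<le> y" shows "(y - x) ^ p \<le> 2 ^ p * (y ^ p - x ^ p)"
proof -
  have p: "0 < p" using assms(1) by (cases p) auto
  have pow: "x ^ p \<le> y ^ p" using assms by (intro power_mono_odd)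
  have one: "y ^ p - x ^ p \<le> 2 ^ p * (y ^ p - x ^ p)"
    using mult_right_mono[of 1 "2 ^ p" "y ^ p - x ^ p"] pow by simp
  consider "0 \<le> x" | "y \<le> 0" | "x < 0" "0 < y" by linarith
  then show ?thesis
  proof cases
    case 1
    then show ?thesis using power_superadditive[of "y - x" x p] assms p one by simp
  next
    case 2
    then show ?thesis using power_superadditive[of "y - x" "- y" p] assms p one by simp
  next
    case 3
    define m where "m = max y (- x)"
    have "(y - x) ^ p \<le> (2 * m) ^ p" using 3 by (intro power_mono) (auto simp: m_def)
    also have "\<dots> = 2 ^ p * m ^ p" by (rule power_mult_distrib)
    also have "m ^ p \<le> y ^ p + (- x) ^ p" using 3 by (auto simp: m_def max_def)
    finally show ?thesis using assms(1) by simp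
  qed
qed

text \<open>In the Taylor formula for the second derivative at the base state all terms below degree
  \<open>p - 1\<close> vanish, and the coefficient of the remainder is near a positive number. The
  degree is even, so the bounds hold on both sides of 0; monotonicity and the mean value theorem
  carry them over to \<open>h\<close>.\<close>

lemma power_like_flux_exists:
  fixes F :: "real \<Rightarrow> 'a::euclidean_space"
  assumes F: "C_infinity F" and p: "odd p"
    and w: "\<And>j. 2 \<le> j \<Longrightarrow> j \<le> p \<Longrightarrow> w \<bullet> nth_derivative j F u = 0" "0 < w \<bullet> nth_derivative (p + 1) F u"
  obtains r a A where "power_like_flux
      (\<lambda>y. w \<bullet> (F (u + y) - F u) - (w \<bullet> nth_derivative 1 F u) * y)
      (\<lambda>y. w \<bullet> nth_derivative 1 F (u + y) - w \<bullet> nth_derivative 1 F u) r a A p"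
proof -
  define D where "D n y = w \<bullet> nth_derivative n F (u + y)" for n y
  have DD: "(D n has_real_derivative D (Suc n) y) (at y)" for n y
  proof -
    have "((\<lambda>y. u + y) has_real_derivative 1) (at y)" by (auto intro!: derivative_eq_intros)
    from DERIV_chain2[OF DERIV_inner_nth_derivative[OF F, of w n "u + y"] this]
    show ?thesis by (simp add: D_def[abs_def])
  qed
  have p0: "0 < p" using p by (cases p) auto
  have ev: "even (p - 1)" using p by simp
  define q where "q = D (p + 1) 0"
  have q: "0 < q" using w(2) by (simp add: q_def D_def)
  have "isCont (D (p + 1)) 0" by (rule DERIV_isCont[OF DD])
  then have "\<forall>e>0. \<exists>d>0. \<forall>y. \<bar>y\<bar> < d \<longrightarrow> \<bar>D (p + 1) y - q\<bar> < e"
    unfolding continuous_at_real_range q_def by (simp only: diff_zero real_norm_def)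
  from this[rule_format, OF half_gt_zero[OF q]]
  obtain r0 where r0: "0 < r0" "\<And>y. \<bar>y\<bar> < r0 \<Longrightarrow> \<bar>D (p + 1) y - q\<bar> < q / 2"
    by (elim exE conjE) blast
  define r where "r = r0 / 2"
  have r: "0 < r" "r < r0" using r0 by (auto simp: r_def)
  \<comment> \<open>Up to the factorial of Taylor's formula, these are bounds \<open>q / 2\<close>
    and \<open>2 * q\<close> for \<open>D (p + 1)\<close> near 0.\<close>
  define \<alpha> where "\<alpha> = q / 2 / fact (p - 1)"
  define \<beta> where "\<beta> = 2 * q / fact (p - 1)"
  have \<alpha>: "0 < \<alpha>" using q by (simp add: \<alpha>_def)
  have D2: "\<alpha> * y ^ (p - 1) \<le> D 2 y" "D 2 y \<le> \<beta> * y ^ (p - 1)" if y: "\<bar>y\<bar> \<le> r" for y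
  proof -
    have "\<exists>t. \<bar>t\<bar> \<le> \<bar>y\<bar> \<and>
      D 2 y = (\<Sum>m<p - 1. (D (m + 2) 0 / fact m) * y ^ m) + (D (p - 1 + 2) t / fact (p - 1)) * y ^
          (p - 1)"
    proof (rule Maclaurin_all_le[of "\<lambda>m. D (m + 2)"])
      show "D (0 + 2) = D 2" by (simp add: numeral_2_eq_2)
      show "\<forall>m x. DERIV (D (m + 2)) x :> D (Suc m + 2) x" using DD by simp
    qed
    then obtain t where t: "\<bar>t\<bar> \<le> \<bar>y\<bar>"
      "D 2 y = (\<Sum>m<p - 1. (D (m + 2) 0 / fact m) * y ^ m) + (D (p - 1 + 2) t / fact (p - 1)) * y ^
          (p - 1)"
      by (elim exE conjE)
    have "D (m + 2) 0 = 0" if "m < p - 1" for m using w(1)[of "m + 2"] that by (simp add: D_def)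
    then have "D 2 y = (D (p + 1) t / fact (p - 1)) * y ^ (p - 1)" using t(2) p0 by simp
    moreover have "\<bar>D (p + 1) t - q\<bar> < q / 2" using r0(2)[of t] t(1) y r by simp
    then have "q / 2 \<le> D (p + 1) t" "D (p + 1) t \<le> 2 * q" by linarith+
    then have "\<alpha> \<le> D (p + 1) t / fact (p - 1)" "D (p + 1) t / fact (p - 1) \<le> \<beta>"
      unfolding \<alpha>_def \<beta>_def by (intro divide_right_mono; simp)+
    moreover have "0 \<le> y ^ (p - 1)" using ev by (rule zero_le_even_power)
    ultimately show "\<alpha> * y ^ (p - 1) \<le> D 2 y" "D 2 y \<le> \<beta> * y ^ (p - 1)"
      by (simp_all only: mult_right_mono)
  qed
  define h where "h y = D 1 y - D 1 0" for y
  have dh: "(h has_real_derivative D 2 y) (at y)" for y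
    unfolding h_def[abs_def] using DERIV_diff[OF DD[of 1 y] DERIV_const[of "D 1 0"]] by (simp add:
        numeral_2_eq_2)
  have lower: "\<alpha> / p / 2 ^ p * (y - x) ^ p \<le> h y - h x" if xy: "-r \<le> x" "x \<le> y" "y \<le> r" for x y
  proof -
    have "h x - \<alpha> / p * x ^ p \<le> h y - \<alpha> / p * y ^ p"
    proof (rule DERIV_nonneg_imp_nondecreasing[OF xy(2)])
      fix z assume z: "x \<le> z" "z \<le> y"
      have "((\<lambda>z. h z - \<alpha> / p * z ^ p) has_real_derivative D 2 z - \<alpha> / p * (p * z ^ (p - 1))) (at z)"
        by (auto intro!: derivative_eq_intros dh)
      moreover have "0 \<le> D 2 z - \<alpha> / p * (p * z ^ (p - 1))" using D2(1)[of z] z xy p0 by (simp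
          add: abs_le_iff)
      ultimately show "\<exists>y. ((\<lambda>z. h z - \<alpha> / p * z ^ p) has_real_derivative y) (at z) \<and> 0 \<le> y" by blast
    qed
    then have "\<alpha> / p * (y ^ p - x ^ p) \<le> h y - h x" by (simp add: algebra_simps)
    moreover have "\<alpha> / p / 2 ^ p * (y - x) ^ p \<le> \<alpha> / p / 2 ^ p * (2 ^ p * (y ^ p - x ^ p))"
      using \<alpha> by (intro mult_left_mono odd_power_diff_lower[OF p xy(2)]) simp
    ultimately show ?thesis by simp
  qed
  have upper: "h y - h x \<le> \<beta> * max \<bar>x\<bar> \<bar>y\<bar> ^ (p - 1) * (y - x)" if xy: "-r \<le> x" "x \<le> y" "y \<le> r" for x y
  proof (cases "x = y")
    case False
    then obtain z where z: "x < z" "z < y" "h y - h x = (y - x) * D 2 z"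
      using MVT2[of x y h "D 2"] dh xy by auto
    have "D 2 z \<le> \<beta> * z ^ (p - 1)" using D2(2)[of z] z xy by (simp add: abs_le_iff)
    also have "\<dots> = \<beta> * \<bar>z\<bar> ^ (p - 1)" using ev by (simp add: power_even_abs)
    also have "\<dots> \<le> \<beta> * max \<bar>x\<bar> \<bar>y\<bar> ^ (p - 1)"
      using z q by (intro mult_left_mono power_mono) (auto simp: \<beta>_def)
    finally have "(y - x) * D 2 z \<le> (y - x) * (\<beta> * max \<bar>x\<bar> \<bar>y\<bar> ^ (p - 1))"
      using xy by (intro mult_left_mono) auto
    then show ?thesis unfolding z(3) by (simp only: mult.commute)
  qed simp
  have "power_like_flux (\<lambda>y. w \<bullet> (F (u + y) - F u) - (w \<bullet> nth_derivative 1 F u) * y) h r (\<alpha> / p /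
      2 ^ p) \<beta> p"
  proof
    show "((\<lambda>y. w \<bullet> (F (u + y) - F u) - (w \<bullet> nth_derivative 1 F u) * y) has_real_derivative h y)
        (at y)" for y
    proof -
      have D0: "D 0 y = w \<bullet> F (u + y)" for y by (simp add: D_def nth_derivative_def)
      have eq: "(\<lambda>y. w \<bullet> (F (u + y) - F u) - (w \<bullet> nth_derivative 1 F u) * y) = (\<lambda>y. D 0 y - D 0 0
          - D 1 0 * y)"
        by (simp add: D0 inner_diff_right) (simp add: D_def)
      have "((\<lambda>y. D 0 y - D 0 0 - D 1 0 * y) has_real_derivative D (Suc 0) y - 0 - D 1 0 * 1) (at y)"
        by (intro derivative_intros DD DERIV_cmult[where c="D 1 0", simplified] ) (auto intro!:
            derivative_eq_intros)
      then show ?thesis unfolding eq by (simp add: h_def)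
    qed
    show "continuous_on {-r..r} h" using dh DERIV_isCont by (intro
        continuous_at_imp_continuous_on) blast
  qed (use r \<alpha> p0 lower upper in \<open>auto simp: h_def\<close>)
  moreover have "h = (\<lambda>y. w \<bullet> nth_derivative 1 F (u + y) - w \<bullet> nth_derivative 1 F u)"
    by (simp add: h_def[abs_def] D_def)
  ultimately show ?thesis using that by blast
qed

text \<open>The gaps are of order 1 / (n ln^2 n): summable, but no longer so after raising to any
  power below 1. One sequence, hence one solution, thus serves all \<epsilon>. The shift by 2 keeps
  the logarithm positive.\<close>

definition centre_seq :: "nat \<Rightarrow> real" where "centre_seq n = - 1 / ln (real n + 2)"

lemma centre_seq_mono: "centre_seq n < centre_seq (Suc n)"
proof -
  have "0 < ln (real n + 2)" "ln (real n + 2) < ln (real (Suc n) + 2)" by simp_all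
  then show ?thesis unfolding centre_seq_def by (simp add: frac_less2)
qed

lemma centre_seq_tendsto: "centre_seq \<longlonglongrightarrow> 0"
  unfolding centre_seq_def by real_asymp

text \<open>Powers of the logarithm lose against n^(1 - \<theta>), so the terms eventually exceed
  those of the harmonic series.\<close>

lemma centre_seq_gaps_not_summable:
  assumes "0 < \<theta>" "\<theta> < 1"
  shows "\<not> summable (\<lambda>n. (centre_seq (Suc n) - centre_seq n) powr \<theta>)"
proof
  assume s: "summable (\<lambda>n. (centre_seq (Suc n) - centre_seq n) powr \<theta>)"
  have "filterlim (\<lambda>n. (centre_seq (Suc n) - centre_seq n) powr \<theta> * real n) at_top sequentially"
    unfolding centre_seq_def using assms by real_asymp
  then have "\<forall>\<^sub>F n in sequentially. 1 \<le> (centre_seq (Suc n) - centre_seq n) powr \<theta> * real n"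
    by (simp add: filterlim_at_top)
  then have "\<forall>\<^sub>F n in sequentially. norm (inverse (real n)) \<le> (centre_seq (Suc n) - centre_seq n)
      powr \<theta>"
    using eventually_gt_at_top[of 0] by eventually_elim (simp add: field_simps)
  from summable_comparison_test_ev[OF this s] show False using not_summable_harmonic[where
      'a=real] by simp
qed

theorem corollary4p1:
  fixes F :: "real \<Rightarrow> real ^ 'm" and M s :: real and p :: nat
  assumes "C_infinity F"
    and "M > 0"
    and "nonlinearity_index F (- M) M = enat p"
    and "odd p"
    and "s = 1 / real p"
  shows "\<exists>U\<^sub>0 U. U\<^sub>0 \<in> L_infinity \<and> entropy_solution F U\<^sub>0 U \<and>
           (\<forall>\<epsilon>>0. \<forall>t>0. (\<lambda>X. U X t) \<in> BV_pow_loc s \<and> (\<lambda>X. U X t) \<notin> BV_pow_loc (s + \<epsilon>))"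
proof -
  obtain u where u: "1 \<le> p" "span ((\<lambda>j. nth_derivative j F u) ` {2..p + 1}) = UNIV"
    "span ((\<lambda>j. nth_derivative j F u) ` {2..p}) \<noteq> UNIV"
    by (rule nonlinearity_index_attained[OF assms(3)]) (use assms(2) in auto)
  obtain w where w: "norm w = 1" "\<And>j. 2 \<le> j \<Longrightarrow> j \<le> p \<Longrightarrow> w \<bullet> nth_derivative j F u = 0"
    "0 < w \<bullet> nth_derivative (p + 1) F u"
    by (rule flux_direction[OF u(2,3,1)]) blast
  \<comment> \<open>The characteristic speed of the base state \<open>u\<close> in the direction
    \<open>w\<close>.\<close>
  define lam where "lam = w \<bullet> nth_derivative 1 F u"
  define g where "g y = w \<bullet> (F (u + y) - F u) - lam * y" for y
  define h where "h y = w \<bullet> nth_derivative 1 F (u + y) - lam" for y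
  obtain r a A where "power_like_flux g h r a A p"
    unfolding g_def[abs_def] h_def[abs_def] lam_def
    by (rule power_like_flux_exists[OF assms(1,4) w(2,3)]) blast+
  then interpret power_like_flux g h r a A p .
  interpret planar_train g h r a A p w lam centre_seq F u
  proof
    show "continuous_on UNIV F" using assms(1) unfolding C_infinity_def by (metis C_k.simps(1))
  qed (use w centre_seq_mono centre_seq_tendsto in \<open>auto simp: g_def\<close>)
  have "(\<lambda>X. U X t) \<in> BV_pow_loc s \<and> (\<lambda>X. U X t) \<notin> BV_pow_loc (s + \<epsilon>)" if "0 < \<epsilon>" for \<epsilon> t
  proof
    show "(\<lambda>X. U X t) \<in> BV_pow_loc s" unfolding assms(5) by (rule U_in_BV_pow_loc)
    show "(\<lambda>X. U X t) \<notin> BV_pow_loc (s + \<epsilon>)"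
    proof (rule U_not_in_BV_pow_loc)
      show "0 < s + \<epsilon>" using that by (simp add: assms(5) add_nonneg_pos)
      \<comment> \<open>The exponent on the gaps is 1 / (1 + p \<epsilon>), below 1 for every
        positive \<epsilon>.\<close>
      have "real p * (s + \<epsilon>) = 1 + real p * \<epsilon>" using u(1) by (simp add: assms(5) distrib_left)
      moreover have "0 < real p * \<epsilon>" using that u(1) by simp
      ultimately have "0 < 1 / (real p * (s + \<epsilon>))" "1 / (real p * (s + \<epsilon>)) < 1" by simp_all
      then show "\<not> summable (\<lambda>n. (centre_seq (Suc n) - centre_seq n) powr (1 / (real p * (s + \<epsilon>))))"
        by (rule centre_seq_gaps_not_summable)
    qed
  qed
  then show ?thesis using U_L_infinity U_entropy_solution by blast
qed

end
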